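(* Let $p\ge1$. Suppose that $\psi_i:\mathbb{R}\to\mathbb{R}$ are real analytic for $i=1,2$ and that $\psi_i^{(p+3)}$ and $\psi_i^{(p+4)}$ are positive on $\mathbb{R}$. Let $\mathcal{N}_{6+4p,\psi_i}$ be the pseudo-Riemannian manifolds and $\alpha^k_{6+4p,\psi_i}$ the functions defined in the context, and let $P_1,P_2\in\mathbb{R}^{6+4p}$. The following assertions are equivalent: \begin{enumerate} \item There exists a local diffeomorphism $\phi$ from $\mathcal{N}_{6+4p,\psi_1}$ to $\mathcal{N}_{6+4p,\psi_2}$ (from a neighborhood of $P_1$ to a neighborhood of $P_2$) with $\phi(P_1)=P_2$ and $\phi^*\nabla_{\mathcal{N}_{6+4p,\psi_2}}=\nabla_{\mathcal{N}_{6+4p,\psi_1}}$, where $\nabla$ denotes the Levi-Civita connection. \item We have $\alpha_{6+4p,\psi_1}^k(P_1)=\alpha_{6+4p,\psi_2}^k(P_2)$ for all $k\ge2$. \item There exists an isometry $\phi:\mathcal{N}_{6+4p,\psi_1}\to\mathcal{N}_{6+4p,\psi_2}$ with $\phi(P_1)=P_2$. \end{enumerate}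
   Context: Let $(x,z_0,\dots,z_p,\tilde z_0,\dots,\tilde z_p,x^*,z_0^*,\dots,z_p^*,\tilde z_0^*,\dots,\tilde z_p^* )$ be coordinates on $\mathbb{R}^{6+4p}$. For a smooth function $f=f(z_0,\dots,z_p)$ on $\mathbb{R}^{p+1}$, $\mathcal{M}_{6+4p,f}:=(\mathbb{R}^{6+4p},g_{6+4p,f})$, where $g_{6+4p,f}$ is the metric of neutral signature $(3+2p,3+2p)$ whose only non-zero components (up to symmetry) are $$g_{6+4p,f}(\partial_x,\partial_x)=-2\{f(z_0,\dots,z_p)+z_0\tilde z_0+\dots+z_p\tilde z_p\},$$ $$g_{6+4p,f}(\partial_x,\partial_{x^*})=g_{6+4p,f}(\partial_{z_i},\partial_{z_i^*})=g_{6+4p,f}(\partial_{\tilde z_i},\partial_{\tilde z_i^*})=1\quad(0\le i\le p).$$ For $\psi\in C^\infty(\mathbb{R})$ with $\psi^{(p+3)}>0$ and $\psi^{(p+4)}>0$ everywhere, $\mathcal{N}_{6+4p,\psi}:=\mathcal{M}_{6+4p,f_\psi}$ where $$f_\psi:=z_1z_0^2+\dots+z_pz_0^{p+1}+\psi(z_0),$$ and for $k\ge2$ and $P\in\mathbb{R}^{6+4p}$, $$\alpha_{6+4p,\psi}^k(P):=\psi^{(k+p+3)}\{\psi^{(p+3)}\}^{k-1}\{\psi^{(p+4)}\}^{-k}(P),$$ the derivatives of $\psi$ being evaluated at the $z_0$-coordinate of $P$. Here $\psi^{(j)}$ is the $j$-th derivative of $\psi$. *)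

theory Defs
  imports "HOL-Analysis.Analysis"
begin

section \<open>Smooth and real analytic functions\<close>

text \<open>
  \<open>C_on n S f\<close>: the function \<open>f\<close> is \<open>n\<close> times continuously differentiable on the set
  \<open>S\<close>, which is meant to be open. The values of \<open>f\<close> off \<open>S\<close> are irrelevant.
\<close>

primrec C_on :: "nat \<Rightarrow> 'a::real_normed_vector set \<Rightarrow> ('a \<Rightarrow> 'b::real_normed_vector) \<Rightarrow> bool" where
  "C_on 0 S f \<longleftrightarrow> continuous_on S f"
| "C_on (Suc n) S f \<longleftrightarrow>
     (\<forall>P\<in>S. f differentiable (at P)) \<and> (\<forall>v. C_on n S (\<lambda>P. frechet_derivative f (at P) v))"

definition smooth_on :: "'a::real_normed_vector set \<Rightarrow> ('a \<Rightarrow> 'b::real_normed_vector) \<Rightarrow> bool" where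
  "smooth_on S f \<longleftrightarrow> (\<forall>n. C_on n S f)"

definition real_analytic_on :: "real set \<Rightarrow> (real \<Rightarrow> real) \<Rightarrow> bool" where
  "real_analytic_on S f \<longleftrightarrow>
     (\<forall>t\<in>S. \<exists>r>0. \<exists>a. \<forall>s. \<bar>s - t\<bar> < r \<longrightarrow> (\<lambda>n. a n * (s - t) ^ n) sums f s)"

definition diffeomorphism ::
    "'a::real_normed_vector set \<Rightarrow> 'b::real_normed_vector set \<Rightarrow> ('a \<Rightarrow> 'b) \<Rightarrow> ('b \<Rightarrow> 'a) \<Rightarrow> bool" where
  "diffeomorphism U V \<phi> \<phi>' \<longleftrightarrow>
     open U \<and> open V \<and> smooth_on U \<phi> \<and> smooth_on V \<phi>' \<and>
     \<phi> ` U = V \<and> \<phi>' ` V = U \<and> (\<forall>P\<in>U. \<phi>' (\<phi> P) = P) \<and> (\<forall>Q\<in>V. \<phi> (\<phi>' Q) = Q)"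


section \<open>Metrics and connections on open subsets of Euclidean space\<close>

text \<open>
  A metric is given by the matrix of its components \<open>g(\<partial>\<^sub>i, \<partial>\<^sub>j)\<close> at each point. Tangent
  vectors, and hence the values of vector fields, are identified with elements of
  \<open>real^'n\<close> through the coordinate frame.
\<close>

type_synonym 'n metric = "real^'n \<Rightarrow> real^'n^'n"
type_synonym 'n vfield = "real^'n \<Rightarrow> real^'n"
type_synonym 'n connection = "'n vfield \<Rightarrow> 'n vfield \<Rightarrow> 'n vfield"

definition metric_form :: "'n::finite metric \<Rightarrow> real^'n \<Rightarrow> real^'n \<Rightarrow> real^'n \<Rightarrow> real" where
  "metric_form g P v w = (\<Sum>i\<in>UNIV. \<Sum>j\<in>UNIV. g P $ i $ j * v $ i * w $ j)"

definition deriv_along :: "'n::finite vfield \<Rightarrow> (real^'n \<Rightarrow> 'b::real_normed_vector) \<Rightarrow> real^'n \<Rightarrow> 'b" where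
  "deriv_along X f P = frechet_derivative f (at P) (X P)"

definition lie_bracket :: "'n::finite vfield \<Rightarrow> 'n vfield \<Rightarrow> 'n vfield" where
  "lie_bracket X Y P = deriv_along X Y P - deriv_along Y X P"

definition affine_connection_on :: "(real^'n::finite) set \<Rightarrow> 'n connection \<Rightarrow> bool" where
  "affine_connection_on U D \<longleftrightarrow>
     (\<forall>X Y. smooth_on U X \<longrightarrow> smooth_on U Y \<longrightarrow> smooth_on U (D X Y)) \<and>
     (\<forall>X X' Y. smooth_on U X \<longrightarrow> smooth_on U X' \<longrightarrow> smooth_on U Y \<longrightarrow>
        (\<forall>P\<in>U. D (\<lambda>Q. X Q + X' Q) Y P = D X Y P + D X' Y P)) \<and>
     (\<forall>X Y Y'. smooth_on U X \<longrightarrow> smooth_on U Y \<longrightarrow> smooth_on U Y' \<longrightarrow>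
        (\<forall>P\<in>U. D X (\<lambda>Q. Y Q + Y' Q) P = D X Y P + D X Y' P)) \<and>
     (\<forall>(f :: real^'n \<Rightarrow> real) X Y. smooth_on U f \<longrightarrow> smooth_on U X \<longrightarrow> smooth_on U Y \<longrightarrow>
        (\<forall>P\<in>U. D (\<lambda>Q. f Q *\<^sub>R X Q) Y P = f P *\<^sub>R D X Y P)) \<and>
     (\<forall>(f :: real^'n \<Rightarrow> real) X Y. smooth_on U f \<longrightarrow> smooth_on U X \<longrightarrow> smooth_on U Y \<longrightarrow>
        (\<forall>P\<in>U. D X (\<lambda>Q. f Q *\<^sub>R Y Q) P = deriv_along X f P *\<^sub>R Y P + f P *\<^sub>R D X Y P))"

definition torsion_free_on :: "(real^'n::finite) set \<Rightarrow> 'n connection \<Rightarrow> bool" where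
  "torsion_free_on U D \<longleftrightarrow>
     (\<forall>X Y. smooth_on U X \<longrightarrow> smooth_on U Y \<longrightarrow>
        (\<forall>P\<in>U. D X Y P - D Y X P = lie_bracket X Y P))"

definition metric_compatible_on :: "(real^'n::finite) set \<Rightarrow> 'n metric \<Rightarrow> 'n connection \<Rightarrow> bool" where
  "metric_compatible_on U g D \<longleftrightarrow>
     (\<forall>X Y W. smooth_on U X \<longrightarrow> smooth_on U Y \<longrightarrow> smooth_on U W \<longrightarrow>
        (\<forall>P\<in>U. deriv_along X (\<lambda>Q. metric_form g Q (Y Q) (W Q)) P =
           metric_form g P (D X Y P) (W P) + metric_form g P (Y P) (D X W P)))"

definition is_levi_civita_on :: "(real^'n::finite) set \<Rightarrow> 'n metric \<Rightarrow> 'n connection \<Rightarrow> bool" where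
  "is_levi_civita_on U g D \<longleftrightarrow>
     affine_connection_on U D \<and> torsion_free_on U D \<and> metric_compatible_on U g D"

text \<open>
  The Levi-Civita connection of the open submanifold \<open>U\<close>. For a pseudo-Riemannian metric it
  exists, and its values at points of \<open>U\<close> on fields that are smooth on \<open>U\<close> are unique; only
  these values may be used.
\<close>

definition levi_civita :: "(real^'n::finite) set \<Rightarrow> 'n metric \<Rightarrow> 'n connection" where
  "levi_civita U g = (SOME D. is_levi_civita_on U g D)"

text \<open>In the following two definitions \<open>\<phi>'\<close> is the inverse of the diffeomorphism \<open>\<phi>\<close>.\<close>

definition pushforward ::
    "(real^'n::finite \<Rightarrow> real^'n) \<Rightarrow> (real^'n \<Rightarrow> real^'n) \<Rightarrow> 'n vfield \<Rightarrow> 'n vfield" where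
  "pushforward \<phi> \<phi>' X Q = frechet_derivative \<phi> (at (\<phi>' Q)) (X (\<phi>' Q))"

definition pullback_connection ::
    "(real^'n::finite \<Rightarrow> real^'n) \<Rightarrow> (real^'n \<Rightarrow> real^'n) \<Rightarrow> 'n connection \<Rightarrow> 'n connection" where
  "pullback_connection \<phi> \<phi>' D X Y =
     pushforward \<phi>' \<phi> (D (pushforward \<phi> \<phi>' X) (pushforward \<phi> \<phi>' Y))"

definition affine_diffeomorphism ::
    "(real^'n::finite) set \<Rightarrow> 'n metric \<Rightarrow> (real^'n) set \<Rightarrow> 'n metric \<Rightarrow>
     (real^'n \<Rightarrow> real^'n) \<Rightarrow> bool" where
  "affine_diffeomorphism U g V h \<phi> \<longleftrightarrow>
     (\<exists>\<phi>'. diffeomorphism U V \<phi> \<phi>' \<and>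
       (\<forall>X Y. smooth_on U X \<longrightarrow> smooth_on U Y \<longrightarrow>
          (\<forall>P\<in>U. pullback_connection \<phi> \<phi>' (levi_civita V h) X Y P = levi_civita U g X Y P)))"

definition isometry :: "'n::finite metric \<Rightarrow> 'n metric \<Rightarrow> (real^'n \<Rightarrow> real^'n) \<Rightarrow> bool" where
  "isometry g h \<phi> \<longleftrightarrow>
     (\<exists>\<phi>'. diffeomorphism UNIV UNIV \<phi> \<phi>') \<and>
     (\<forall>P v w. metric_form h (\<phi> P) (frechet_derivative \<phi> (at P) v) (frechet_derivative \<phi> (at P) w) =
        metric_form g P v w)"


section \<open>The manifolds\<close>

text \<open>
  The number \<open>p \<ge> 1\<close> is represented as \<open>CARD('p)\<close> for a finite type \<open>'p\<close>, so \<open>'p zindex\<close> is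
  the index set \<open>{0, \<dots>, p}\<close> and \<open>zi i\<close> is the index \<open>i \<le> p\<close>.
\<close>

typedef (overloaded) ('p::finite) zindex = "{..CARD('p)}"
  by auto

abbreviation zi :: "nat \<Rightarrow> 'p::finite zindex" where
  "zi \<equiv> Abs_zindex"

text \<open>
  Indices of the coordinates \<open>x\<close>, \<open>z\<^sub>i\<close>, \<open>z\<^sub>i\<close> with tilde, and of their starred counterparts.
\<close>

datatype 'i coord = Cx | Cz 'i | Czt 'i | Cxs | Czs 'i | Czts 'i

lemma UNIV_zindex: "(UNIV :: 'p::finite zindex set) = zi ` {..CARD('p)}"
  using type_definition.Abs_image[OF type_definition_zindex] by metis

instance zindex :: (finite) finite
  by standard (simp add: UNIV_zindex)

lemma UNIV_coord:
  "(UNIV :: 'i coord set) =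
     {Cx} \<union> range Cz \<union> range Czt \<union> {Cxs} \<union> range Czs \<union> range Czts"
proof -
  have "c \<in> {Cx} \<union> range Cz \<union> range Czt \<union> {Cxs} \<union> range Czs \<union> range Czts" for c :: "'i coord"
    by (cases c) simp_all
  then show ?thesis
    by blast
qed

instance coord :: (finite) finite
  by standard (simp add: UNIV_coord)

lemma CARD_zindex: "CARD('p::finite zindex) = CARD('p) + 1"
  using type_definition.card[OF type_definition_zindex[where 'p='p]] by simp

lemma CARD_coord: "CARD('p::finite zindex coord) = 6 + 4 * CARD('p)"
proof -
  have c: "card (range f) = CARD('p) + 1" if "inj f" for f :: "'p zindex \<Rightarrow> 'p zindex coord"
    using that by (simp add: card_image CARD_zindex)
  have u: "card (A \<union> range f) = card A + (CARD('p) + 1)"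
    if "inj f" "A \<inter> range f = {}" for A and f :: "'p zindex \<Rightarrow> 'p zindex coord"
    using that by (simp add: card_Un_disjoint c)
  have i: "inj Cz" "inj Czt" "inj Czs" "inj Czts"
    by (simp_all add: inj_def)
  have U: "(UNIV :: 'p zindex coord set) =
      {Cx, Cxs} \<union> range Cz \<union> range Czt \<union> range Czs \<union> range Czts"
    by (subst UNIV_coord) blast
  have "card ({Cx, Cxs} \<union> range Cz \<union> range Czt \<union> range Czs \<union> range Czts :: 'p zindex coord set)
      = 2 + (CARD('p) + 1) + (CARD('p) + 1) + (CARD('p) + 1) + (CARD('p) + 1)"
    by (subst u, simp add: inj_def, blast)+ simp
  then show ?thesis
    by (simp add: U)
qed

definition M_metric :: "(real^('p::finite zindex) \<Rightarrow> real) \<Rightarrow> ('p zindex coord) metric" where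
  "M_metric f P = (\<chi> a b. case (a, b) of
      (Cx, Cx) \<Rightarrow> - 2 * (f (\<chi> i. P $ Cz i) + (\<Sum>i\<in>UNIV. P $ Cz i * P $ Czt i))
    | (Cx, Cxs) \<Rightarrow> 1 | (Cxs, Cx) \<Rightarrow> 1
    | (Cz i, Czs j) \<Rightarrow> if i = j then 1 else 0 | (Czs i, Cz j) \<Rightarrow> if i = j then 1 else 0
    | (Czt i, Czts j) \<Rightarrow> if i = j then 1 else 0 | (Czts i, Czt j) \<Rightarrow> if i = j then 1 else 0
    | _ \<Rightarrow> 0)"

definition f_psi :: "(real \<Rightarrow> real) \<Rightarrow> real^('p::finite zindex) \<Rightarrow> real" where
  "f_psi \<psi> z = (\<Sum>i = 1..CARD('p). z $ zi i * (z $ zi 0) ^ (i + 1)) + \<psi> (z $ zi 0)"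

definition N_metric :: "(real \<Rightarrow> real) \<Rightarrow> ('p::finite zindex coord) metric" where
  "N_metric \<psi> = M_metric (f_psi \<psi>)"

definition alpha :: "nat \<Rightarrow> (real \<Rightarrow> real) \<Rightarrow> real^('p::finite zindex coord) \<Rightarrow> real" where
  "alpha k \<psi> P =
     (deriv ^^ (k + CARD('p) + 3)) \<psi> (P $ Cz (zi 0))
     * ((deriv ^^ (CARD('p) + 3)) \<psi> (P $ Cz (zi 0))) ^ (k - 1)
     / ((deriv ^^ (CARD('p) + 4)) \<psi> (P $ Cz (zi 0))) ^ k"

end

theory Submission
  imports Defs
begin

text \<open>
  Write \<open>F\<close> for the potential, so that \<open>g(\<partial>\<^sub>x, \<partial>\<^sub>x) = - 2 F\<close>. The Christoffel symbols are first
  derivatives of \<open>F\<close> and take values in the span of the starred directions.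

  Let \<open>\<phi>\<close> be affine. Symmetry of third derivatives in the transformation law of the Christoffel
  symbols, together with nondegeneracy of the Hessian of \<open>F\<close>, shows that the unstarred components
  of \<open>\<phi>\<close> are affine functions of the unstarred coordinates and that the Hessians of \<open>F\<^sub>2 \<circ> \<phi>\<close> and
  \<open>F\<^sub>1\<close> in the direction \<open>z\<^sub>0\<close> are proportional with a constant factor. On a line in this direction
  \<open>F\<^sub>1\<close> is \<open>\<psi>\<^sub>1\<close> plus a polynomial of degree at most \<open>p + 2\<close>, and similarly for \<open>F\<^sub>2 \<circ> \<phi>\<close>. Hence
  \<open>l^n \<psi>\<^sub>2^(n) = c \<psi>\<^sub>1^(n)\<close> at the base points for all \<open>n \<ge> p + 3\<close>, and the invariants are the
  combinations in which \<open>l\<close> and \<open>c\<close> cancel.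

  Conversely, if the invariants agree, such \<open>l\<close> and \<open>c\<close> exist, and by analyticity
  \<open>\<psi>\<^sub>2(l t + m) = s \<psi>\<^sub>1(t) + q(t)\<close> with a polynomial \<open>q\<close> of degree at most \<open>p + 2\<close>. The terms
  \<open>z\<^sub>i z\<^sub>0^(i+1)\<close> absorb \<open>q\<close> up to degree two under an affine substitution of the \<open>z\<^sub>i\<close>, the terms
  \<open>z\<^sub>i zt\<^sub>i\<close> absorb the quadratic rest, and an affine change of \<open>F\<close> is undone by a quadratic change of
  the starred coordinates; this gives a global isometry.
\<close>

section \<open>Calculus of smooth maps\<close>

text \<open>The point comes last, so that \<open>dd v f\<close> is again a function and mixed
  derivatives are plain iterations, as in the recursion of \<open>C_on\<close>.\<close>

abbreviation dd :: "'a::real_normed_vector \<Rightarrow> ('a \<Rightarrow> 'b::real_normed_vector) \<Rightarrow> 'a \<Rightarrow> 'b" where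
  "dd v f \<equiv> (\<lambda>P. frechet_derivative f (at P) v)"

lemma dd_eqI: "(f has_derivative f') (at P) \<Longrightarrow> dd v f P = f' v"
  by (metis frechet_derivative_at)

text \<open>A derivative at a point depends only on the germ there. This allows differentiating
  identities that hold merely on an open set, although all functions are total.\<close>

lemma fd_cong_open:
  assumes "open S" "P \<in> S" "\<And>Q. Q \<in> S \<Longrightarrow> f Q = g Q"
  shows "frechet_derivative f (at P) = frechet_derivative g (at P)"
    and "f differentiable (at P) \<longleftrightarrow> g differentiable (at P)"
proof -
  have *: "(f has_derivative D) (at P) \<longleftrightarrow> (g has_derivative D) (at P)" for D
    using assms has_derivative_transform_within_open[of f D P UNIV S g]
      has_derivative_transform_within_open[of g D P UNIV S f] by auto
  show "frechet_derivative f (at P) = frechet_derivative g (at P)"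
    unfolding frechet_derivative_def using * by simp
  show "f differentiable (at P) \<longleftrightarrow> g differentiable (at P)"
    unfolding differentiable_def using * by simp
qed

lemma C_on_cong:
  assumes "open S" "\<And>P. P \<in> S \<Longrightarrow> f P = g P"
  shows "C_on n S f \<longleftrightarrow> C_on n S g"
  using assms(2)
proof (induction n arbitrary: f g)
  case 0
  then show ?case by (simp cong: continuous_on_cong)
next
  case (Suc n)
  have "C_on n S (dd v f) \<longleftrightarrow> C_on n S (dd v g)" for v
    using fd_cong_open(1)[OF assms(1) _ Suc.prems] by (intro Suc.IH) simp
  moreover have "f differentiable (at P) \<longleftrightarrow> g differentiable (at P)" if "P \<in> S" for P
    using fd_cong_open(2)[OF assms(1) that Suc.prems] by simp
  ultimately show ?case by simp
qed

lemma smooth_on_cong: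
  assumes "open S" "\<And>P. P \<in> S \<Longrightarrow> f P = g P"
  shows "smooth_on S f \<longleftrightarrow> smooth_on S g"
  using C_on_cong[OF assms] by (simp add: smooth_on_def)

lemma C_on_Suc_imp: "C_on (Suc n) S f \<Longrightarrow> C_on n S f"
proof (induction n arbitrary: f)
  case 0
  then show ?case
    by (auto intro!: continuous_at_imp_continuous_on differentiable_imp_continuous_within)
next
  case (Suc n)
  then show ?case by (metis C_on.simps(2))
qed

lemma smooth_on_imp_differentiable: "smooth_on S f \<Longrightarrow> P \<in> S \<Longrightarrow> f differentiable (at P)"
  unfolding smooth_on_def using C_on.simps(2) by blast

lemma smooth_on_dd: "smooth_on S f \<Longrightarrow> smooth_on S (dd v f)"
  unfolding smooth_on_def using C_on.simps(2) by blast

lemma smooth_on_imp_continuous_on: "smooth_on S f \<Longrightarrow> continuous_on S f"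
  unfolding smooth_on_def using C_on.simps(1) by blast

lemma smooth_on_has_derivative:
  "smooth_on S f \<Longrightarrow> P \<in> S \<Longrightarrow> (f has_derivative frechet_derivative f (at P)) (at P)"
  using smooth_on_imp_differentiable frechet_derivative_works by blast

section \<open>Closure properties of the classes \<open>C_on\<close> and of smooth functions\<close>

lemma C_on_const [simp]: "C_on n S (\<lambda>P. c)"
  by (induction n arbitrary: c) simp_all

lemma C_on_bounded_linear:
  assumes "bounded_linear h"
  shows "C_on n S h"
proof (cases n)
  case 0
  then show ?thesis using assms by (simp add: linear_continuous_on)
next
  case (Suc m)
  have "(h has_derivative h) (at P)" for P
    using assms by (rule bounded_linear_imp_has_derivative)
  then show ?thesis
    unfolding Suc by (auto simp: differentiable_def dd_eqI[OF \<open>(h has_derivative h) (at _)\<close>])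
qed

lemma C_on_add:
  assumes "open S" "C_on n S f" "C_on n S g"
  shows "C_on n S (\<lambda>P. f P + g P)"
  using assms(2,3)
proof (induction n arbitrary: f g)
  case 0
  then show ?case by (simp add: continuous_on_add)
next
  case (Suc n)
  have d: "((\<lambda>P. f P + g P) has_derivative
      (\<lambda>v. dd v f P + dd v g P)) (at P)" if "P \<in> S" for P
    using Suc.prems that by (auto intro!: has_derivative_add simp: frechet_derivative_works)
  have "C_on n S (dd v (\<lambda>P. f P + g P))" for v
    using Suc.IH[of "dd v f" "dd v g"] Suc.prems
    by (subst C_on_cong[OF assms(1) dd_eqI[OF d]]) simp_all
  then show ?case using d by (auto simp: differentiable_def)
qed

text \<open>The product rule gives two products with one factor differentiated in each; the other
  factor is lowered by \<open>C_on_Suc_imp\<close>, so the induction hypothesis covers both.\<close>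

lemma C_on_bilinear:
  assumes "open S" "bounded_bilinear h" "C_on n S f" "C_on n S g"
  shows "C_on n S (\<lambda>P. h (f P) (g P))"
  using assms(3,4)
proof (induction n arbitrary: f g)
  case 0
  then show ?case using bounded_bilinear.continuous_on[OF assms(2)] by simp
next
  case (Suc n)
  have d: "((\<lambda>P. h (f P) (g P)) has_derivative
      (\<lambda>v. h (f P) (dd v g P) + h (dd v f P) (g P))) (at P)" if "P \<in> S" for P
    using Suc.prems that
    by (auto intro!: bounded_bilinear.FDERIV[OF assms(2)] simp: frechet_derivative_works)
  have "C_on n S (dd v (\<lambda>P. h (f P) (g P)))" for v
  proof -
    have "C_on n S (\<lambda>P. h (f P) (dd v g P) + h (dd v f P) (g P))"
      using Suc.prems C_on_Suc_imp[OF Suc.prems(1)] C_on_Suc_imp[OF Suc.prems(2)]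
      by (intro C_on_add[OF assms(1)] Suc.IH) simp_all
    then show ?thesis
      by (subst C_on_cong[OF assms(1) dd_eqI[OF d]]) simp_all
  qed
  then show ?case using d by (auto simp: differentiable_def)
qed

lemma C_on_linear_compose:
  assumes "open S" "bounded_linear h" "C_on n S f"
  shows "C_on n S (\<lambda>P. h (f P))"
  using assms(3)
proof (induction n arbitrary: f)
  case 0
  then show ?case using bounded_linear.continuous_on[OF assms(2)] by simp
next
  case (Suc n)
  have d: "((\<lambda>P. h (f P)) has_derivative (\<lambda>v. h (dd v f P))) (at P)" if "P \<in> S" for P
    using Suc.prems that
    by (auto intro!: bounded_linear.has_derivative[OF assms(2)] simp: frechet_derivative_works)
  have "C_on n S (dd v (\<lambda>P. h (f P)))" for v
    using Suc.IH[of "dd v f"] Suc.prems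
    by (subst C_on_cong[OF assms(1) dd_eqI[OF d]]) simp_all
  then show ?case using d by (auto simp: differentiable_def)
qed

lemma C_on_sum:
  assumes "open S" "\<And>i. i \<in> I \<Longrightarrow> C_on n S (f i)"
  shows "C_on n S (\<lambda>P. \<Sum>i\<in>I. f i P)"
  using assms(2) by (induction I rule: infinite_finite_induct) (simp_all add: C_on_add[OF assms(1)])

text \<open>\<open>C_on\<close> speaks of derivatives in fixed directions only; this expansion
  reduces a direction that varies with the point to those.\<close>

lemma fd_basis:
  fixes g :: "'a::euclidean_space \<Rightarrow> 'b::real_normed_vector"
  assumes "g differentiable (at Q)"
  shows "frechet_derivative g (at Q) w = (\<Sum>b\<in>Basis. (w \<bullet> b) *\<^sub>R frechet_derivative g (at Q) b)"
proof -
  interpret linear "frechet_derivative g (at Q)"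
    using assms by (rule linear_frechet_derivative)
  show ?thesis
    by (subst euclidean_representation[symmetric, of w]) (simp add: sum scaleR)
qed

text \<open>The chain rule, expanded in a basis of the middle space, gives a finite sum of products
  in which \<open>g\<close> is replaced by a partial derivative \<open>dd b g\<close>; hence the
  induction is over all \<open>g\<close>.\<close>

lemma C_on_compose:
  fixes f :: "'a::real_normed_vector \<Rightarrow> 'b::euclidean_space"
    and g :: "'b \<Rightarrow> 'c::real_normed_vector"
  assumes "open S" "open T" "f ` S \<subseteq> T" "C_on n S f" "C_on n T g"
  shows "C_on n S (\<lambda>P. g (f P))"
  using assms(4,5)
proof (induction n arbitrary: g)
  case 0
  then show ?case using assms(3) continuous_on_compose2[of T g S f] by simp
next
  case (Suc n)
  have d: "((\<lambda>P. g (f P)) has_derivative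
      (\<lambda>v. \<Sum>b\<in>Basis. (dd v f P \<bullet> b) *\<^sub>R dd b g (f P))) (at P)" if "P \<in> S" for P
  proof -
    have g: "g differentiable (at (f P))" using Suc.prems(2) assms(3) that by auto
    have f: "f differentiable (at P)" using Suc.prems(1) that by simp
    have "((\<lambda>P. g (f P)) has_derivative (\<lambda>v. dd (dd v f P) g (f P))) (at P)"
      using f g unfolding frechet_derivative_works
      by (rule has_derivative_compose)
    moreover have "(\<lambda>v. dd (dd v f P) g (f P)) = (\<lambda>v. \<Sum>b\<in>Basis. (dd v f P \<bullet> b) *\<^sub>R dd b g (f P))"
      by (rule ext) (rule fd_basis[OF g])
    ultimately show ?thesis by simp
  qed
  have "C_on n S (dd v (\<lambda>P. g (f P)))" for v
  proof -
    have "C_on n S (\<lambda>P. \<Sum>b\<in>Basis. (dd v f P \<bullet> b) *\<^sub>R dd b g (f P))"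
    proof (intro C_on_sum[OF assms(1)] C_on_bilinear[OF assms(1) bounded_bilinear_scaleR]
            C_on_linear_compose[OF assms(1) bounded_linear_inner_left])
      show "C_on n S (dd v f)" using Suc.prems(1) by simp
      show "C_on n S (\<lambda>P. dd b g (f P))" for b
        using Suc.IH[OF C_on_Suc_imp[OF Suc.prems(1)], of "dd b g"] Suc.prems(2) by simp
    qed
    then show ?thesis
      by (subst C_on_cong[OF assms(1) dd_eqI[OF d]]) simp_all
  qed
  then show ?case using d by (auto simp: differentiable_def)
qed

lemma C_on_vec_nth:
  fixes f :: "'a::real_normed_vector \<Rightarrow> real^'n::finite"
  assumes "open S"
  shows "C_on n S f \<longleftrightarrow> (\<forall>i. C_on n S (\<lambda>P. f P $ i))"
proof
  show "C_on n S f \<Longrightarrow> \<forall>i. C_on n S (\<lambda>P. f P $ i)"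
    using C_on_linear_compose[OF assms bounded_linear_vec_nth] by blast
  assume f: "\<forall>i. C_on n S (\<lambda>P. f P $ i)"
  have "C_on n S (\<lambda>P. \<Sum>i\<in>UNIV. f P $ i *\<^sub>R axis i (1::real))"
    using f by (intro C_on_sum[OF assms] C_on_bilinear[OF assms bounded_bilinear_scaleR]) simp_all
  moreover have "(\<Sum>i\<in>UNIV. x $ i *\<^sub>R axis i (1::real)) = x" for x :: "real^'n"
    using basis_expansion[of x] by (simp only: scalar_mult_eq_scaleR)
  ultimately show "C_on n S f" by simp
qed

lemma smooth_on_const [simp]: "smooth_on S (\<lambda>P. c)"
  by (simp add: smooth_on_def)

lemma smooth_on_bounded_linear: "bounded_linear h \<Longrightarrow> smooth_on S h"
  by (simp add: smooth_on_def C_on_bounded_linear)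

lemma smooth_on_add:
  "open S \<Longrightarrow> smooth_on S f \<Longrightarrow> smooth_on S g \<Longrightarrow> smooth_on S (\<lambda>P. f P + g P)"
  by (simp add: smooth_on_def C_on_add)

lemma smooth_on_bilinear:
  "open S \<Longrightarrow> bounded_bilinear h \<Longrightarrow> smooth_on S f \<Longrightarrow> smooth_on S g \<Longrightarrow>
    smooth_on S (\<lambda>P. h (f P) (g P))"
  by (simp add: smooth_on_def C_on_bilinear)

lemmas smooth_on_scaleR = smooth_on_bilinear[OF _ bounded_bilinear_scaleR]
lemmas smooth_on_mult = smooth_on_bilinear[OF _ bounded_bilinear_mult]
lemmas smooth_on_inner = smooth_on_bilinear[OF _ bounded_bilinear_inner]

lemma smooth_on_linear_compose:
  "open S \<Longrightarrow> bounded_linear h \<Longrightarrow> smooth_on S f \<Longrightarrow> smooth_on S (\<lambda>P. h (f P))"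
  by (simp add: smooth_on_def C_on_linear_compose)

lemma smooth_on_minus: "open S \<Longrightarrow> smooth_on S f \<Longrightarrow> smooth_on S (\<lambda>P. - f P)"
  by (rule smooth_on_linear_compose[OF _ bounded_linear_minus[OF bounded_linear_ident]])

lemma smooth_on_diff:
  "open S \<Longrightarrow> smooth_on S f \<Longrightarrow> smooth_on S g \<Longrightarrow> smooth_on S (\<lambda>P. f P - g P)"
  using smooth_on_add[of S f "\<lambda>P. - g P"] smooth_on_minus[of S g] by simp

lemma smooth_on_sum:
  "open S \<Longrightarrow> (\<And>i. i \<in> I \<Longrightarrow> smooth_on S (f i)) \<Longrightarrow> smooth_on S (\<lambda>P. \<Sum>i\<in>I. f i P)"
  by (simp add: smooth_on_def C_on_sum)

lemma smooth_on_power: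
  fixes f :: "'a::real_normed_vector \<Rightarrow> real"
  shows "open S \<Longrightarrow> smooth_on S f \<Longrightarrow> smooth_on S (\<lambda>P. f P ^ k)"
  by (induction k) (simp_all add: smooth_on_mult)

lemma smooth_on_compose:
  fixes f :: "'a::real_normed_vector \<Rightarrow> 'b::euclidean_space"
  shows "open S \<Longrightarrow> open T \<Longrightarrow> f ` S \<subseteq> T \<Longrightarrow> smooth_on S f \<Longrightarrow> smooth_on T g \<Longrightarrow>
    smooth_on S (\<lambda>P. g (f P))"
  by (simp add: smooth_on_def C_on_compose)

lemma smooth_on_vec_nth_iff:
  fixes f :: "'a::real_normed_vector \<Rightarrow> real^'n::finite"
  shows "open S \<Longrightarrow> smooth_on S f \<longleftrightarrow> (\<forall>i. smooth_on S (\<lambda>P. f P $ i))"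
  unfolding smooth_on_def using C_on_vec_nth by blast

lemma smooth_on_vec_nth:
  fixes f :: "'a::real_normed_vector \<Rightarrow> real^'n::finite"
  shows "open S \<Longrightarrow> smooth_on S f \<Longrightarrow> smooth_on S (\<lambda>P. f P $ i)"
  by (simp add: smooth_on_vec_nth_iff)

lemma smooth_on_frechet_derivative:
  fixes g :: "'a::euclidean_space \<Rightarrow> 'b::real_normed_vector"
  assumes "open S" "smooth_on S g" "smooth_on S X"
  shows "smooth_on S (\<lambda>P. dd (X P) g P)"
proof -
  have "smooth_on S (\<lambda>P. \<Sum>b\<in>Basis. (X P \<bullet> b) *\<^sub>R dd b g P)"
    using assms by (intro smooth_on_sum smooth_on_scaleR smooth_on_inner smooth_on_dd) simp_all
  then show ?thesis
    using smooth_on_cong[OF assms(1) fd_basis[OF smooth_on_imp_differentiable[OF assms(2)]],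
        of "\<lambda>P. P" X] by simp
qed

section \<open>Rules for directional derivatives\<close>

lemma dd_bilinear:
  assumes "bounded_bilinear h" "f differentiable (at P)" "g differentiable (at P)"
  shows "dd v (\<lambda>P. h (f P) (g P)) P = h (f P) (dd v g P) + h (dd v f P) (g P)"
  by (rule dd_eqI[OF bounded_bilinear.FDERIV[OF assms(1) assms(2,3)[unfolded frechet_derivative_works]]])

lemmas dd_mult = dd_bilinear[OF bounded_bilinear_mult]
lemmas dd_scaleR = dd_bilinear[OF bounded_bilinear_scaleR]

lemma dd_add:
  assumes "f differentiable (at P)" "g differentiable (at P)"
  shows "dd v (\<lambda>P. f P + g P) P = dd v f P + dd v g P"
  by (rule dd_eqI[OF has_derivative_add[OF assms[unfolded frechet_derivative_works]]])

lemma dd_linear_compose: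
  assumes "bounded_linear h" "f differentiable (at P)"
  shows "dd v (\<lambda>P. h (f P)) P = h (dd v f P)"
  by (rule dd_eqI[OF bounded_linear.has_derivative[OF assms(1) assms(2)[unfolded frechet_derivative_works]]])

lemma dd_minus: "f differentiable (at P) \<Longrightarrow> dd v (\<lambda>P. - f P) P = - dd v f P"
  by (rule dd_linear_compose[OF bounded_linear_minus[OF bounded_linear_ident]])

lemma dd_diff:
  assumes "f differentiable (at P)" "g differentiable (at P)"
  shows "dd v (\<lambda>P. f P - g P) P = dd v f P - dd v g P"
  by (rule dd_eqI[OF has_derivative_diff[OF assms[unfolded frechet_derivative_works]]])

lemma dd_sum:
  assumes "\<And>i. i \<in> I \<Longrightarrow> f i differentiable (at P)"
  shows "dd v (\<lambda>P. \<Sum>i\<in>I. f i P) P = (\<Sum>i\<in>I. dd v (f i) P)"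
  by (rule dd_eqI[OF has_derivative_sum]) (rule assms[unfolded frechet_derivative_works])

lemma dd_vec_nth:
  fixes f :: "'a::real_normed_vector \<Rightarrow> real^'n::finite"
  shows "f differentiable (at P) \<Longrightarrow> dd v (\<lambda>P. f P $ i) P = dd v f P $ i"
  by (rule dd_linear_compose[OF bounded_linear_vec_nth])

lemma dd_compose:
  assumes "f differentiable (at P)" "g differentiable (at (f P))"
  shows "dd v (\<lambda>P. g (f P)) P = dd (dd v f P) g (f P)"
  by (rule dd_eqI[OF has_derivative_compose[OF assms[unfolded frechet_derivative_works]]])

lemma dd_lin:
  assumes "f differentiable (at P)"
  shows "dd (v + w) f P = dd v f P + dd w f P" "dd (c *\<^sub>R v) f P = c *\<^sub>R dd v f P"
    "dd 0 f P = 0" "dd (v - w) f P = dd v f P - dd w f P" "dd (- v) f P = - dd v f P"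
  "dd (\<Sum>i\<in>I. u i) f P = (\<Sum>i\<in>I. dd (u i) f P)"
proof -
  interpret linear "frechet_derivative f (at P)"
    using assms by (rule linear_frechet_derivative)
  show "dd (v + w) f P = dd v f P + dd w f P" "dd (c *\<^sub>R v) f P = c *\<^sub>R dd v f P"
    "dd 0 f P = 0" "dd (v - w) f P = dd v f P - dd w f P" "dd (- v) f P = - dd v f P"
    "dd (\<Sum>i\<in>I. u i) f P = (\<Sum>i\<in>I. dd (u i) f P)"
    by (simp_all add: add scaleR diff neg sum)
qed

section \<open>Symmetry of second derivatives\<close>

lemma line_has_real_derivative:
  fixes f :: "'a::real_normed_vector \<Rightarrow> real"
  assumes "f differentiable (at (P + t *\<^sub>R v))"
  shows "((\<lambda>t. f (P + t *\<^sub>R v)) has_real_derivative dd v f (P + t *\<^sub>R v)) (at t)"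
proof -
  have "((\<lambda>t. f (P + t *\<^sub>R v)) has_derivative (\<lambda>h. dd (h *\<^sub>R v) f (P + t *\<^sub>R v))) (at t)"
  proof (rule has_derivative_compose[where g = f])
    show "((\<lambda>t. P + t *\<^sub>R v) has_derivative (\<lambda>h. h *\<^sub>R v)) (at t)"
      by (auto intro!: derivative_eq_intros)
    show "(f has_derivative frechet_derivative f (at (P + t *\<^sub>R v))) (at (P + t *\<^sub>R v))"
      using assms by (simp add: frechet_derivative_works)
  qed
  moreover have "(\<lambda>h. dd (h *\<^sub>R v) f (P + t *\<^sub>R v)) = (*) (dd v f (P + t *\<^sub>R v))"
    by (simp add: dd_lin[OF assms] fun_eq_iff mult.commute)
  ultimately show ?thesis by (simp add: has_field_derivative_def)
qed

text \<open>The mean value theorem is applied twice: to the increment in direction \<open>w\<close>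
  as a function of the step along \<open>v\<close>, then to \<open>dd v f\<close> along
  \<open>w\<close>. The second difference is symmetric in \<open>v\<close> and \<open>w\<close>, the
  right side not visibly so.\<close>

lemma second_difference_mvt:
  fixes f :: "'a::real_normed_vector \<Rightarrow> real"
  assumes h: "0 < h"
    and box: "\<And>s t. 0 \<le> s \<Longrightarrow> s \<le> h \<Longrightarrow> 0 \<le> t \<Longrightarrow> t \<le> h \<Longrightarrow> P + s *\<^sub>R v + t *\<^sub>R w \<in> U"
    and f: "\<And>Q. Q \<in> U \<Longrightarrow> f differentiable (at Q)"
    and fv: "\<And>Q. Q \<in> U \<Longrightarrow> (dd v f) differentiable (at Q)"
  shows "\<exists>s t. 0 \<le> s \<and> s \<le> h \<and> 0 \<le> t \<and> t \<le> h \<and>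
    f (P + h *\<^sub>R v + h *\<^sub>R w) - f (P + h *\<^sub>R v) - f (P + h *\<^sub>R w) + f P
      = h * h * dd w (dd v f) (P + s *\<^sub>R v + t *\<^sub>R w)"
proof -
  define g where "g s = f (P + h *\<^sub>R w + s *\<^sub>R v) - f (P + s *\<^sub>R v)" for s
  have "(g has_real_derivative dd v f (P + h *\<^sub>R w + s *\<^sub>R v) - dd v f (P + s *\<^sub>R v)) (at s)"
    if "0 \<le> s" "s \<le> h" for s
    unfolding g_def using box[OF that, of h] box[OF that, of 0] h
    by (intro DERIV_diff line_has_real_derivative f) (simp_all add: add_ac)
  from MVT2[OF h, of g, OF this] obtain s where s: "0 < s" "s < h"
    and gs: "g h - g 0 = h * (dd v f (P + h *\<^sub>R w + s *\<^sub>R v) - dd v f (P + s *\<^sub>R v))"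
    by auto
  have "((\<lambda>t. dd v f (P + s *\<^sub>R v + t *\<^sub>R w)) has_real_derivative
      dd w (dd v f) (P + s *\<^sub>R v + t *\<^sub>R w)) (at t)" if "0 \<le> t" "t \<le> h" for t
    using box[of s t] s that by (intro line_has_real_derivative fv) simp_all
  from MVT2[OF h, of "\<lambda>t. dd v f (P + s *\<^sub>R v + t *\<^sub>R w)", OF this]
  obtain t where t: "0 < t" "t < h"
    and gt: "dd v f (P + s *\<^sub>R v + h *\<^sub>R w) - dd v f (P + s *\<^sub>R v)
      = h * dd w (dd v f) (P + s *\<^sub>R v + t *\<^sub>R w)"
    by auto
  have "f (P + h *\<^sub>R v + h *\<^sub>R w) - f (P + h *\<^sub>R v) - f (P + h *\<^sub>R w) + f P = g h - g 0"
    by (simp add: g_def add_ac)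
  also have "\<dots> = h * h * dd w (dd v f) (P + s *\<^sub>R v + t *\<^sub>R w)"
    using gs gt by (simp add: add_ac)
  finally show ?thesis using s t by (intro exI[of _ s] exI[of _ t]) auto
qed

text \<open>The second difference is \<open>h * h\<close> times either mixed derivative at some
  point near \<open>P\<close>, so by continuity the two cannot differ at \<open>P\<close>.\<close>

lemma dd_commute_real:
  fixes f :: "'a::real_normed_vector \<Rightarrow> real"
  assumes U: "open U" "P \<in> U" and f: "smooth_on U f"
  shows "dd w (dd v f) P = dd v (dd w f) P"
proof (rule ccontr)
  assume ne: "dd w (dd v f) P \<noteq> dd v (dd w f) P"
  \<comment> \<open>Half the distance, so that no value is within \<open>e\<close> of both mixed
    derivatives.\<close>
  define e where "e = dist (dd w (dd v f) P) (dd v (dd w f) P) / 2"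
  have e: "e > 0" using ne by (simp add: e_def)
  have c: "isCont (dd w (dd v f)) P" "isCont (dd v (dd w f)) P"
    using smooth_on_imp_continuous_on[OF smooth_on_dd[OF smooth_on_dd[OF f]]] U
    by (simp_all add: continuous_on_eq_continuous_at)
  obtain d1 where d1: "d1 > 0" "\<And>Q. dist Q P < d1 \<Longrightarrow> dist (dd w (dd v f) Q) (dd w (dd v f) P) < e"
    using c(1) e unfolding continuous_at_eps_delta by (metis dist_commute)
  obtain d2 where d2: "d2 > 0" "\<And>Q. dist Q P < d2 \<Longrightarrow> dist (dd v (dd w f) Q) (dd v (dd w f) P) < e"
    using c(2) e unfolding continuous_at_eps_delta by (metis dist_commute)
  obtain d3 where d3: "d3 > 0" "ball P d3 \<subseteq> U" using U openE by blast
  define d where "d = min d1 (min d2 d3)"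
  have d: "d > 0" using d1 d2 d3 by (simp add: d_def)
  \<comment> \<open>Keeps the parallelogram spanned by \<open>h *\<^sub>R v\<close> and
    \<open>h *\<^sub>R w\<close> within \<open>d\<close> of \<open>P\<close>; the summand 1 covers
    \<open>v = w = 0\<close>.\<close>
  define h where "h = d / (norm v + norm w + 1)"
  have h: "h > 0" using d by (simp add: h_def add_nonneg_pos)
  have near: "dist (P + s *\<^sub>R v + t *\<^sub>R w) P < d" if "0 \<le> s" "s \<le> h" "0 \<le> t" "t \<le> h" for s t
  proof -
    have "dist (P + s *\<^sub>R v + t *\<^sub>R w) P = norm (s *\<^sub>R v + t *\<^sub>R w)"
      by (simp add: dist_norm add.assoc)
    also have "\<dots> \<le> s * norm v + t * norm w"
      using norm_triangle_ineq[of "s *\<^sub>R v" "t *\<^sub>R w"] that by simp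
    also have "\<dots> \<le> h * norm v + h * norm w"
      using that by (intro add_mono mult_right_mono) simp_all
    also have "\<dots> < h * (norm v + norm w + 1)"
      using h by (simp add: algebra_simps)
    also have "\<dots> = d"
      using add_nonneg_pos[of "norm v + norm w" 1] by (simp add: h_def)
    finally show ?thesis .
  qed
  have box: "P + s *\<^sub>R v + t *\<^sub>R w \<in> U" if "0 \<le> s" "s \<le> h" "0 \<le> t" "t \<le> h" for s t
    using near[OF that] d3 by (auto simp: d_def dist_commute)
  have sm: "\<And>Q. Q \<in> U \<Longrightarrow> f differentiable (at Q)" "\<And>Q. Q \<in> U \<Longrightarrow> (dd v f) differentiable (at Q)"
    "\<And>Q. Q \<in> U \<Longrightarrow> (dd w f) differentiable (at Q)"
    using smooth_on_imp_differentiable[OF f] smooth_on_imp_differentiable[OF smooth_on_dd[OF f]]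
    by simp_all
  obtain s t where st: "0 \<le> s" "s \<le> h" "0 \<le> t" "t \<le> h"
    and e1: "f (P + h *\<^sub>R v + h *\<^sub>R w) - f (P + h *\<^sub>R v) - f (P + h *\<^sub>R w) + f P
      = h * h * dd w (dd v f) (P + s *\<^sub>R v + t *\<^sub>R w)"
    using second_difference_mvt[where v=v and w=w, OF h box sm(1,2)] by blast
  have box': "P + t *\<^sub>R w + s *\<^sub>R v \<in> U" if "0 \<le> t" "t \<le> h" "0 \<le> s" "s \<le> h" for s t
    using box that by (simp add: add_ac)
  obtain s' t' where st': "0 \<le> s'" "s' \<le> h" "0 \<le> t'" "t' \<le> h"
    and e2: "f (P + h *\<^sub>R w + h *\<^sub>R v) - f (P + h *\<^sub>R w) - f (P + h *\<^sub>R v) + f P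
      = h * h * dd v (dd w f) (P + t' *\<^sub>R w + s' *\<^sub>R v)"
    using second_difference_mvt[where v=w and w=v, OF h box' sm(1,3)] by blast
  have "P + h *\<^sub>R w + h *\<^sub>R v = P + h *\<^sub>R v + h *\<^sub>R w"
    "P + t' *\<^sub>R w + s' *\<^sub>R v = P + s' *\<^sub>R v + t' *\<^sub>R w"
    by (simp_all add: add_ac)
  with e1 e2 have "h * h * dd w (dd v f) (P + s *\<^sub>R v + t *\<^sub>R w)
      = h * h * dd v (dd w f) (P + s' *\<^sub>R v + t' *\<^sub>R w)"
    by (simp only:)
  then have "dd w (dd v f) (P + s *\<^sub>R v + t *\<^sub>R w) = dd v (dd w f) (P + s' *\<^sub>R v + t' *\<^sub>R w)"
    using h by simp
  moreover have a: "dist (dd w (dd v f) (P + s *\<^sub>R v + t *\<^sub>R w)) (dd w (dd v f) P) < e"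
    using near[OF st] by (intro d1) (simp add: d_def)
  moreover have b: "dist (dd v (dd w f) (P + s' *\<^sub>R v + t' *\<^sub>R w)) (dd v (dd w f) P) < e"
    using near[OF st'] by (intro d2) (simp add: d_def)
  ultimately show False
    using dist_triangle_half_r[OF a[unfolded e_def], of "dd v (dd w f) P"] unfolding e_def by simp
qed

lemma dd_commute_vec:
  fixes f :: "'a::real_normed_vector \<Rightarrow> real^'n::finite"
  assumes U: "open U" "P \<in> U" and f: "smooth_on U f"
  shows "dd w (dd v f) P = dd v (dd w f) P"
proof -
  have "dd w (dd v f) P $ i = dd v (dd w f) P $ i" for i
  proof -
    have fi: "smooth_on U (\<lambda>P. f P $ i)" using f U smooth_on_vec_nth by blast
    have *: "dd w (dd v f) P $ i = dd w (dd v (\<lambda>P. f P $ i)) P" for v w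
    proof -
      have "dd w (dd v f) P $ i = dd w (\<lambda>P. dd v f P $ i) P"
        using smooth_on_imp_differentiable[OF smooth_on_dd[OF f] U(2)] by (rule dd_vec_nth[symmetric])
      also have "\<dots> = dd w (dd v (\<lambda>P. f P $ i)) P"
        using fd_cong_open(1)[OF U, of "\<lambda>P. dd v f P $ i" "dd v (\<lambda>P. f P $ i)"]
          dd_vec_nth[OF smooth_on_imp_differentiable[OF f]] by simp
      finally show ?thesis .
    qed
    show ?thesis using dd_commute_real[OF U fi, of w v] by (simp only: *)
  qed
  then show ?thesis by (simp add: vec_eq_iff)
qed

section \<open>Uniqueness and naturality of the Levi-Civita connection\<close>

lemma metric_form_diff_left: "metric_form g P (u - v) w = metric_form g P u w - metric_form g P v w"
  by (simp add: metric_form_def algebra_simps sum_subtractf)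

lemma torsion_free_onD:
  "torsion_free_on U D \<Longrightarrow> smooth_on U X \<Longrightarrow> smooth_on U Y \<Longrightarrow> P \<in> U \<Longrightarrow>
    D X Y P - D Y X P = lie_bracket X Y P"
  by (simp add: torsion_free_on_def)

lemma metric_compatible_onD:
  "metric_compatible_on U g D \<Longrightarrow> smooth_on U X \<Longrightarrow> smooth_on U Y \<Longrightarrow> smooth_on U W \<Longrightarrow> P \<in> U \<Longrightarrow>
    deriv_along X (\<lambda>Q. metric_form g Q (Y Q) (W Q)) P =
      metric_form g P (D X Y P) (W P) + metric_form g P (Y P) (D X W P)"
  by (simp add: metric_compatible_on_def)

text \<open>The difference of the two connections, paired with a third field, is skew in the last
  two arguments and symmetric in the first two. Alternating both symmetries through all six
  permutations returns the form with the opposite sign, so it vanishes.\<close>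

lemma levi_civita_unique:
  fixes g :: "'n::finite metric"
  assumes sym: "\<And>P v w. metric_form g P v w = metric_form g P w v"
    and nondeg: "\<And>P v. (\<And>w. metric_form g P v w = 0) \<Longrightarrow> v = 0"
    and D: "torsion_free_on U D" "metric_compatible_on U g D"
    and D': "torsion_free_on U D'" "metric_compatible_on U g D'"
    and X: "smooth_on U X" and Y: "smooth_on U Y" and P: "P \<in> U"
  shows "D X Y P = D' X Y P"
proof -
  define S where "S X Y W = metric_form g P (D X Y P - D' X Y P) (W P)" for X Y W
  have skew: "S X Y W + S X W Y = 0" if "smooth_on U X" "smooth_on U Y" "smooth_on U W" for X Y W
  proof -
    have "metric_form g P (D X Y P) (W P) + metric_form g P (Y P) (D X W P) =
        metric_form g P (D' X Y P) (W P) + metric_form g P (Y P) (D' X W P)"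
      using metric_compatible_onD[OF D(2) that P] metric_compatible_onD[OF D'(2) that P] by simp
    then show ?thesis
      by (simp add: S_def metric_form_diff_left sym[of P "Y P" "D X W P"] sym[of P "Y P" "D' X W P"])
  qed
  have swap: "S X Y W = S Y X W" if "smooth_on U X" "smooth_on U Y" for X Y W
  proof -
    have "D X Y P - D Y X P = D' X Y P - D' Y X P"
      using torsion_free_onD[OF D(1) that P] torsion_free_onD[OF D'(1) that P] by simp
    then have "D X Y P - D' X Y P = D Y X P - D' Y X P" by (simp add: algebra_simps)
    then show ?thesis by (simp add: S_def)
  qed
  have "metric_form g P (D X Y P - D' X Y P) w = 0" for w
  proof -
    \<comment> \<open>Constant fields suffice, since they attain every vector at
      \<open>P\<close>.\<close>
    have W: "smooth_on U (\<lambda>Q. w)" by simp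
    have "S X Y (\<lambda>Q. w) = 0"
      using skew[OF X Y W] swap[OF X W, of Y] skew[OF W X Y] swap[OF W Y, of X]
        skew[OF Y W X] swap[OF Y X, of "\<lambda>Q. w"] by linarith
    then show ?thesis by (simp add: S_def)
  qed
  then show ?thesis using nondeg[of P "D X Y P - D' X Y P"] by simp
qed

section \<open>Differentials, pushforwards and pulled back connections\<close>

text \<open>Product rule for a differential applied to a moving vector. Symmetry of second
  derivatives enters as a hypothesis, so that scalar and vector valued maps are both
  covered.\<close>

lemma dd_frechet_field:
  fixes \<phi> :: "'a::euclidean_space \<Rightarrow> 'b::real_normed_vector"
  assumes S: "open S" "P \<in> S" and \<phi>: "smooth_on S \<phi>" and Y: "Y differentiable (at P)"
    and comm: "\<And>u. dd v (dd u \<phi>) P = dd u (dd v \<phi>) P"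
  shows "dd v (\<lambda>Q. dd (Y Q) \<phi> Q) P = dd (dd v Y P) \<phi> P + dd (Y P) (dd v \<phi>) P"
proof -
  have 1: "\<phi> differentiable (at Q)" "(dd b \<phi>) differentiable (at Q)" if "Q \<in> S" for b Q
    using smooth_on_imp_differentiable[OF \<phi> that] smooth_on_imp_differentiable[OF smooth_on_dd[OF \<phi>] that]
    by simp_all
  have Yb: "(\<lambda>Q. Y Q \<bullet> b) differentiable (at P)" for b
    using Y by (intro differentiable_inner) simp_all
  have dY: "dd v (\<lambda>Q. Y Q \<bullet> b) P = dd v Y P \<bullet> b" for b
    by (rule dd_linear_compose[OF bounded_linear_inner_left Y])
  have "dd v (\<lambda>Q. dd (Y Q) \<phi> Q) P = dd v (\<lambda>Q. \<Sum>b\<in>Basis. (Y Q \<bullet> b) *\<^sub>R dd b \<phi> Q) P"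
    by (rule fun_cong[OF fd_cong_open(1)[OF S fd_basis[OF 1(1)]]])
  also have "\<dots> = (\<Sum>b\<in>Basis. dd v (\<lambda>Q. (Y Q \<bullet> b) *\<^sub>R dd b \<phi> Q) P)"
    by (rule dd_sum) (intro differentiable_scaleR Yb 1 S)
  also have "\<dots> = (\<Sum>b\<in>Basis. (Y P \<bullet> b) *\<^sub>R dd v (dd b \<phi>) P + (dd v Y P \<bullet> b) *\<^sub>R dd b \<phi> P)"
    using S by (simp add: dd_scaleR[OF Yb 1(2)] dY)
  also have "\<dots> = (\<Sum>b\<in>Basis. (Y P \<bullet> b) *\<^sub>R dd b (dd v \<phi>) P) + (\<Sum>b\<in>Basis. (dd v Y P \<bullet> b) *\<^sub>R dd b \<phi> P)"
    by (simp only: sum.distrib comm)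
  also have "\<dots> = dd (Y P) (dd v \<phi>) P + dd (dd v Y P) \<phi> P"
    by (simp only: fd_basis[OF 1(2)[OF S(2)], symmetric] fd_basis[OF 1(1)[OF S(2)], symmetric])
  finally show ?thesis by (simp only: add.commute)
qed

lemma frechet_inverse:
  fixes \<phi> :: "'a::real_normed_vector \<Rightarrow> 'b::real_normed_vector"
  assumes "diffeomorphism U V \<phi> \<phi>'" "P \<in> U"
  shows "dd (dd v \<phi> P) \<phi>' (\<phi> P) = v"
proof -
  have U: "open U" and V: "\<phi> P \<in> V" and s: "smooth_on U \<phi>" "smooth_on V \<phi>'"
    and inv: "\<And>Q. Q \<in> U \<Longrightarrow> \<phi>' (\<phi> Q) = Q"
    using assms by (auto simp: diffeomorphism_def)
  have "dd (dd v \<phi> P) \<phi>' (\<phi> P) = dd v (\<lambda>Q. \<phi>' (\<phi> Q)) P"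
    by (rule dd_compose[symmetric, OF smooth_on_imp_differentiable[OF s(1) assms(2)]
          smooth_on_imp_differentiable[OF s(2) V]])
  also have "\<dots> = dd v (\<lambda>Q. Q) P"
    by (rule fun_cong[OF fd_cong_open(1)[OF U assms(2) inv]])
  also have "\<dots> = v" by (simp add: dd_eqI[OF has_derivative_ident])
  finally show ?thesis .
qed

lemma diffeomorphism_sym: "diffeomorphism U V \<phi> \<phi>' \<Longrightarrow> diffeomorphism V U \<phi>' \<phi>"
  by (auto simp: diffeomorphism_def)

lemma smooth_on_pushforward:
  fixes \<phi> :: "real^'n::finite \<Rightarrow> real^'n"
  assumes "diffeomorphism U V \<phi> \<phi>'" "smooth_on U X"
  shows "smooth_on V (pushforward \<phi> \<phi>' X)"
proof -
  have UV: "open U" "open V" "\<phi>' ` V \<subseteq> U" "smooth_on U \<phi>" "smooth_on V \<phi>'"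
    using assms(1) by (simp_all add: diffeomorphism_def)
  have "smooth_on V (\<lambda>Q. (\<lambda>P. dd (X P) \<phi> P) (\<phi>' Q))"
    by (rule smooth_on_compose[OF UV(2,1,3,5) smooth_on_frechet_derivative[OF UV(1,4) assms(2)]])
  then show ?thesis by (simp add: pushforward_def[abs_def])
qed

text \<open>Pushing fields forward preserves Lie brackets and, by \<open>iso\<close>, inner
  products; the two defining identities are therefore carried back from \<open>V\<close> to
  \<open>U\<close>. They are the input of \<open>levi_civita_unique\<close>.\<close>

lemma pullback_levi_civita:
  fixes g h :: "'n::finite metric"
  assumes \<phi>: "diffeomorphism U V \<phi> \<phi>'"
    and iso: "\<And>P v w. P \<in> U \<Longrightarrow> metric_form h (\<phi> P) (dd v \<phi> P) (dd w \<phi> P) = metric_form g P v w"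
    and h: "\<And>Y W. smooth_on V Y \<Longrightarrow> smooth_on V W \<Longrightarrow> smooth_on V (\<lambda>Q. metric_form h Q (Y Q) (W Q))"
    and D: "torsion_free_on V D" "metric_compatible_on V h D"
  shows "torsion_free_on U (pullback_connection \<phi> \<phi>' D)"
    and "metric_compatible_on U g (pullback_connection \<phi> \<phi>' D)"
proof -
  let ?D = "pullback_connection \<phi> \<phi>' D"
  note push = smooth_on_pushforward[OF \<phi>]
  have s\<phi>: "smooth_on U \<phi>" "smooth_on V \<phi>'" and inv: "\<And>P. P \<in> U \<Longrightarrow> \<phi>' (\<phi> P) = P"
    and UV: "open U" "open V" "\<And>P. P \<in> U \<Longrightarrow> \<phi> P \<in> V"
    using \<phi> by (auto simp: diffeomorphism_def)
  have dif: "\<phi> differentiable (at P)" "\<phi>' differentiable (at (\<phi> P))" if "P \<in> U" for P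
    using smooth_on_imp_differentiable[OF s\<phi>(1) that] smooth_on_imp_differentiable[OF s\<phi>(2) UV(3)[OF that]]
    by simp_all
  have pX: "pushforward \<phi> \<phi>' X (\<phi> P) = dd (X P) \<phi> P" if "P \<in> U" for P X
    using inv[OF that] by (simp add: pushforward_def)
  have D': "?D X Y P = dd (D (pushforward \<phi> \<phi>' X) (pushforward \<phi> \<phi>' Y) (\<phi> P)) \<phi>' (\<phi> P)" for X Y P
    by (simp add: pullback_connection_def pushforward_def[of \<phi>' \<phi>])
  have dD': "dd (?D X Y P) \<phi> P = D (pushforward \<phi> \<phi>' X) (pushforward \<phi> \<phi>' Y) (\<phi> P)" if "P \<in> U" for X Y P
    using frechet_inverse[OF diffeomorphism_sym[OF \<phi>] UV(3)[OF that]] inv[OF that] by (simp add: D')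
  have chain: "deriv_along (pushforward \<phi> \<phi>' X) k (\<phi> P) = deriv_along X (\<lambda>Q. k (\<phi> Q)) P"
    if "P \<in> U" "k differentiable (at (\<phi> P))" for X :: "real^'n \<Rightarrow> real^'n" and P and k :: "real^'n \<Rightarrow> 'c::real_normed_vector"
    unfolding deriv_along_def pX[OF that(1)] using dd_compose[OF dif(1)[OF that(1)] that(2)] by simp
  show "torsion_free_on U ?D"
    unfolding torsion_free_on_def
  proof (intro allI impI ballI)
    fix X Y :: "real^'n \<Rightarrow> real^'n" and P assume X: "smooth_on U X" and Y: "smooth_on U Y" and P: "P \<in> U"
    have along: "deriv_along (pushforward \<phi> \<phi>' X) (pushforward \<phi> \<phi>' Y) (\<phi> P) =
      dd (dd (X P) Y P) \<phi> P + dd (Y P) (dd (X P) \<phi>) P" if Y: "smooth_on U Y" for X Y :: "real^'n \<Rightarrow> real^'n"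
    proof -
      have "deriv_along (pushforward \<phi> \<phi>' X) (pushforward \<phi> \<phi>' Y) (\<phi> P) =
          deriv_along X (\<lambda>Q. pushforward \<phi> \<phi>' Y (\<phi> Q)) P"
        by (rule chain[OF P smooth_on_imp_differentiable[OF push[OF Y] UV(3)[OF P]]])
      also have "\<dots> = dd (X P) (\<lambda>Q. dd (Y Q) \<phi> Q) P"
        unfolding deriv_along_def by (rule fun_cong[OF fd_cong_open(1)[OF UV(1) P pX]])
      also have "\<dots> = dd (dd (X P) Y P) \<phi> P + dd (Y P) (dd (X P) \<phi>) P"
        by (rule dd_frechet_field[OF UV(1) P s\<phi>(1) smooth_on_imp_differentiable[OF Y P]
              dd_commute_vec[OF UV(1) P s\<phi>(1)]])
      finally show ?thesis .
    qed
    have "D (pushforward \<phi> \<phi>' X) (pushforward \<phi> \<phi>' Y) (\<phi> P) - D (pushforward \<phi> \<phi>' Y) (pushforward \<phi> \<phi>' X) (\<phi> P)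
        = lie_bracket (pushforward \<phi> \<phi>' X) (pushforward \<phi> \<phi>' Y) (\<phi> P)"
      by (rule torsion_free_onD[OF D(1) push[OF X] push[OF Y] UV(3)[OF P]])
    \<comment> \<open>The second differentials of \<phi> coming from the two orders agree, so only
      the image of the bracket of \<open>X\<close> and \<open>Y\<close> remains.\<close>
    also have "\<dots> = dd (lie_bracket X Y P) \<phi> P"
      unfolding lie_bracket_def along[OF X] along[OF Y]
      by (simp add: deriv_along_def dd_lin[OF dif(1)[OF P]]
          dd_commute_vec[OF UV(1) P s\<phi>(1), of "X P" "Y P"])
    finally have "dd (D (pushforward \<phi> \<phi>' X) (pushforward \<phi> \<phi>' Y) (\<phi> P)
        - D (pushforward \<phi> \<phi>' Y) (pushforward \<phi> \<phi>' X) (\<phi> P)) \<phi>' (\<phi> P) = lie_bracket X Y P"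
      using frechet_inverse[OF \<phi> P] by simp
    then show "?D X Y P - ?D Y X P = lie_bracket X Y P"
      by (simp add: D' dd_lin[OF dif(2)[OF P]])
  qed
  show "metric_compatible_on U g ?D"
    unfolding metric_compatible_on_def
  proof (intro allI impI ballI)
    fix X Y W :: "real^'n \<Rightarrow> real^'n" and P assume X: "smooth_on U X" and Y: "smooth_on U Y" and W: "smooth_on U W" and P: "P \<in> U"
    let ?k = "\<lambda>R. metric_form h R (pushforward \<phi> \<phi>' Y R) (pushforward \<phi> \<phi>' W R)"
    have "deriv_along X (\<lambda>Q. metric_form g Q (Y Q) (W Q)) P = deriv_along X (\<lambda>Q. ?k (\<phi> Q)) P"
      unfolding deriv_along_def by (rule fun_cong[OF fd_cong_open(1)[OF UV(1) P]]) (simp add: pX iso)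
    also have "\<dots> = deriv_along (pushforward \<phi> \<phi>' X) ?k (\<phi> P)"
      by (rule chain[OF P, symmetric])
        (rule smooth_on_imp_differentiable[OF h[OF push[OF Y] push[OF W]] UV(3)[OF P]])
    also have "\<dots> = metric_form h (\<phi> P) (dd (?D X Y P) \<phi> P) (dd (W P) \<phi> P)
        + metric_form h (\<phi> P) (dd (Y P) \<phi> P) (dd (?D X W P) \<phi> P)"
      using metric_compatible_onD[OF D(2) push[OF X] push[OF Y] push[OF W] UV(3)[OF P]]
      by (simp add: dD'[OF P] pX[OF P])
    finally show "deriv_along X (\<lambda>Q. metric_form g Q (Y Q) (W Q)) P =
        metric_form g P (?D X Y P) (W P) + metric_form g P (Y P) (?D X W P)"
      by (simp add: iso[OF P])
  qed
qed

section \<open>The Levi-Civita connection of the metrics\<close>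

definition zc :: "real^('p::finite zindex coord) \<Rightarrow> real^('p zindex)" where "zc P = (\<chi> i. P $ Cz i)"
definition ztc :: "real^('p::finite zindex coord) \<Rightarrow> real^('p zindex)" where "ztc P = (\<chi> i. P $ Czt i)"
definition zsc :: "real^('p::finite zindex coord) \<Rightarrow> real^('p zindex)" where "zsc P = (\<chi> i. P $ Czs i)"
definition ztsc :: "real^('p::finite zindex coord) \<Rightarrow> real^('p zindex)" where "ztsc P = (\<chi> i. P $ Czts i)"

definition mk :: "real \<Rightarrow> real^'p zindex \<Rightarrow> real^'p zindex \<Rightarrow> real \<Rightarrow> real^'p zindex \<Rightarrow> real^'p zindex
    \<Rightarrow> real^('p::finite zindex coord)" where
  "mk x z zt xs zs zts = (\<chi> c. case c of Cx \<Rightarrow> x | Cz i \<Rightarrow> z $ i | Czt i \<Rightarrow> zt $ i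
      | Cxs \<Rightarrow> xs | Czs i \<Rightarrow> zs $ i | Czts i \<Rightarrow> zts $ i)"

lemma mk_simps [simp]:
  "mk x z zt xs zs zts $ Cx = x" "mk x z zt xs zs zts $ Cxs = xs"
  "mk x z zt xs zs zts $ Cz i = z $ i" "mk x z zt xs zs zts $ Czt i = zt $ i"
  "mk x z zt xs zs zts $ Czs i = zs $ i" "mk x z zt xs zs zts $ Czts i = zts $ i"
  "zc (mk x z zt xs zs zts) = z" "ztc (mk x z zt xs zs zts) = zt"
  "zsc (mk x z zt xs zs zts) = zs" "ztsc (mk x z zt xs zs zts) = zts"
  by (simp_all add: mk_def zc_def ztc_def zsc_def ztsc_def vec_eq_iff)

lemma coords_nth [simp]: "zc P $ i = P $ Cz i" "ztc P $ i = P $ Czt i"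
  "zsc P $ i = P $ Czs i" "ztsc P $ i = P $ Czts i"
  by (simp_all add: zc_def ztc_def zsc_def ztsc_def)

lemma coords_eq_iff: "P = Q \<longleftrightarrow> P $ Cx = Q $ Cx \<and> zc P = zc Q \<and> ztc P = ztc Q \<and>
    P $ Cxs = Q $ Cxs \<and> zsc P = zsc Q \<and> ztsc P = ztsc Q"
  for P Q :: "real^('p::finite zindex coord)"
proof
  assume "P $ Cx = Q $ Cx \<and> zc P = zc Q \<and> ztc P = ztc Q \<and>
    P $ Cxs = Q $ Cxs \<and> zsc P = zsc Q \<and> ztsc P = ztsc Q"
  then have "P $ c = Q $ c" for c
    by (cases c) (auto simp: vec_eq_iff)
  then show "P = Q" by (simp add: vec_eq_iff)
qed simp

lemma coords_linear [simp]:
  "bounded_linear zc" "bounded_linear ztc" "bounded_linear zsc" "bounded_linear ztsc"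
  by (rule linear_conv_bounded_linear[THEN iffD1], rule linearI, simp_all add: vec_eq_iff)+

lemma coords_lin_simps [simp]:
  "zc (P + Q) = zc P + zc Q" "ztc (P + Q) = ztc P + ztc Q" "zsc (P + Q) = zsc P + zsc Q" "ztsc (P + Q) = ztsc P + ztsc Q"
  "zc (P - Q) = zc P - zc Q" "ztc (P - Q) = ztc P - ztc Q" "zsc (P - Q) = zsc P - zsc Q" "ztsc (P - Q) = ztsc P - ztsc Q"
  "zc (c *\<^sub>R P) = c *\<^sub>R zc P" "ztc (c *\<^sub>R P) = c *\<^sub>R ztc P" "zsc (c *\<^sub>R P) = c *\<^sub>R zsc P" "ztsc (c *\<^sub>R P) = c *\<^sub>R ztsc P"
  "zc (- P) = - zc P" "ztc (- P) = - ztc P" "zsc (- P) = - zsc P" "ztsc (- P) = - ztsc P"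
  "zc 0 = 0" "ztc 0 = 0" "zsc 0 = 0" "ztsc 0 = 0"
  by (simp_all add: vec_eq_iff)

lemma smooth_on_mk:
  assumes "open S" "smooth_on S x" "smooth_on S z" "smooth_on S zt" "smooth_on S xs" "smooth_on S zs" "smooth_on S zts"
  shows "smooth_on S (\<lambda>P. mk (x P) (z P) (zt P) (xs P) (zs P) (zts P))"
proof -
  have "smooth_on S (\<lambda>P. mk (x P) (z P) (zt P) (xs P) (zs P) (zts P) $ c)" for c
    using assms by (cases c) (simp_all add: smooth_on_vec_nth)
  then show ?thesis using smooth_on_vec_nth_iff[OF assms(1)] by blast
qed

lemma sum_coord: "(\<Sum>c\<in>UNIV. F c) = F Cx + (\<Sum>i\<in>UNIV. F (Cz i)) + (\<Sum>i\<in>UNIV. F (Czt i)) +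
    F Cxs + (\<Sum>i\<in>UNIV. F (Czs i)) + (\<Sum>i\<in>UNIV. F (Czts i))"
  for F :: "'i::finite coord \<Rightarrow> 'b::comm_monoid_add"
proof -
  have r: "sum F (range g) = (\<Sum>i\<in>UNIV. F (g i))" if "inj g" for g :: "'i \<Rightarrow> 'i coord"
    using that by (simp add: sum.reindex)
  have i: "inj Cz" "inj Czt" "inj Czs" "inj Czts"
    by (simp_all add: inj_def)
  have "sum F UNIV = sum F (((((({Cx} \<union> range Cz) \<union> range Czt) \<union> {Cxs}) \<union> range Czs) \<union> range Czts))"
    by (simp add: UNIV_coord)
  also have "\<dots> = F Cx + sum F (range Cz) + sum F (range Czt) + F Cxs + sum F (range Czs) + sum F (range Czts)"
    by (subst sum.union_disjoint, simp, simp, blast)+ simp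
  finally show ?thesis by (simp only: r[OF i(1)] r[OF i(2)] r[OF i(3)] r[OF i(4)])
qed

definition pot :: "(real^('p::finite zindex) \<Rightarrow> real) \<Rightarrow> real^('p zindex coord) \<Rightarrow> real" where
  "pot f P = f (zc P) + zc P \<bullet> ztc P"

text \<open>Each block is paired with its starred block by a constant form; the dependence on the
  point sits in the coefficient of the two x-components alone.\<close>

lemma metric_form_M:
  fixes f :: "real^('p::finite zindex) \<Rightarrow> real"
  shows "metric_form (M_metric f) P v w = - 2 * pot f P * v $ Cx * w $ Cx + v $ Cx * w $ Cxs + v $ Cxs * w $ Cx
    + zc v \<bullet> zsc w + zsc v \<bullet> zc w + ztc v \<bullet> ztsc w + ztsc v \<bullet> ztc w"
proof -
  have d: "(\<Sum>j\<in>UNIV. (if i = j then 1 else 0) * a * b j) = a * b i" for i :: "'p zindex" and a :: real and b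
    by (simp add: if_distrib[of "\<lambda>t. t * _"] cong: if_cong)
  show ?thesis
    unfolding metric_form_def sum_coord
    by (simp add: M_metric_def d pot_def zc_def inner_vec_def ztc_def[abs_def] zsc_def[abs_def] ztsc_def[abs_def])
qed

lemma metric_form_M_sym: "metric_form (M_metric f) P v w = metric_form (M_metric f) P w v"
  by (simp add: metric_form_M inner_commute)

lemma metric_form_M_nondegenerate:
  assumes "\<And>w. metric_form (M_metric f) P v w = 0"
  shows "v = 0"
proof -
  have x: "v $ Cx = 0" using assms[of "mk 0 0 0 1 0 0"] by (simp add: metric_form_M)
  \<comment> \<open>This pairing also contains the potential times \<open>v $ Cx\<close>, so
    \<open>x\<close> has to come first.\<close>
  have xs: "v $ Cxs = 0" using assms[of "mk 1 0 0 0 0 0"] x by (simp add: metric_form_M)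
  have "zc v = 0" using assms[of "mk 0 0 0 0 (zc v) 0"] by (simp add: metric_form_M)
  moreover have "ztc v = 0" using assms[of "mk 0 0 0 0 0 (ztc v)"] by (simp add: metric_form_M)
  moreover have "zsc v = 0" using assms[of "mk 0 (zsc v) 0 0 0 0"] by (simp add: metric_form_M)
  moreover have "ztsc v = 0" using assms[of "mk 0 0 (ztsc v) 0 0 0"] by (simp add: metric_form_M)
  ultimately show ?thesis using x xs by (simp add: coords_eq_iff)
qed

text \<open>
  \<open>gradz f P\<close> and \<open>zc P\<close> are the gradients of the potential in the variables \<open>z\<close> and \<open>z\<close> with
  tilde, and \<open>chr\<close> is the Christoffel form: the Levi-Civita connection is \<open>dY(X) + chr(X, Y)\<close>.
\<close>

definition gradz :: "(real^('p::finite zindex) \<Rightarrow> real) \<Rightarrow> real^('p zindex coord) \<Rightarrow> real^('p zindex)" where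
  "gradz f P = (\<chi> i. dd (axis i 1) f (zc P)) + ztc P"

definition dpot :: "(real^('p::finite zindex) \<Rightarrow> real) \<Rightarrow> real^('p zindex coord) \<Rightarrow> real^('p zindex coord) \<Rightarrow> real" where
  "dpot f P v = gradz f P \<bullet> zc v + zc P \<bullet> ztc v"

definition chr :: "(real^('p::finite zindex) \<Rightarrow> real) \<Rightarrow> real^('p zindex coord) \<Rightarrow> real^('p zindex coord)
    \<Rightarrow> real^('p zindex coord) \<Rightarrow> real^('p zindex coord)" where
  "chr f P v w = mk 0 0 0 (- (v $ Cx * dpot f P w + w $ Cx * dpot f P v))
     ((v $ Cx * w $ Cx) *\<^sub>R gradz f P) ((v $ Cx * w $ Cx) *\<^sub>R zc P)"

lemma chr_commute: "chr f P v w = chr f P w v"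
  by (simp add: chr_def coords_eq_iff mult.commute)

lemma smooth_on_coords:
  assumes "open S" "smooth_on S X"
  shows "smooth_on S (\<lambda>P. zc (X P))" "smooth_on S (\<lambda>P. ztc (X P))"
    "smooth_on S (\<lambda>P. zsc (X P))" "smooth_on S (\<lambda>P. ztsc (X P))"
  by (rule smooth_on_linear_compose[OF assms(1) _ assms(2)], simp)+

lemma smooth_on_ident [simp]: "smooth_on S (\<lambda>P. P)"
  by (rule smooth_on_bounded_linear[OF bounded_linear_ident])

lemmas smooth_on_coords_id [simp] = coords_linear[THEN smooth_on_bounded_linear]

context
  fixes f :: "real^('p::finite zindex) \<Rightarrow> real"
  assumes f: "smooth_on UNIV f"
begin

lemma pot_has_derivative: "(pot f has_derivative dpot f P) (at P)"
proof -
  have fz: "(f has_derivative frechet_derivative f (at (zc P))) (at (zc P))"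
    using smooth_on_has_derivative[OF f] by simp
  define G where "G = (\<chi> i. dd (axis i 1) f (zc P))"
  have g: "gradz f P = G + ztc P" by (simp only: gradz_def G_def)
  have b: "frechet_derivative f (at (zc P)) w = G \<bullet> w" for w
  proof -
    have "(\<Sum>i\<in>UNIV. w $ i *\<^sub>R axis i 1) = w"
      using basis_expansion[of w] by (simp only: scalar_mult_eq_scaleR)
    then have "frechet_derivative f (at (zc P)) w = (\<Sum>i\<in>UNIV. dd (w $ i *\<^sub>R axis i 1) f (zc P))"
      using dd_lin(6)[OF smooth_on_imp_differentiable[OF f], of "zc P" "\<lambda>i. w $ i *\<^sub>R axis i 1" UNIV] by simp
    then show ?thesis
      by (simp add: dd_lin(2)[OF smooth_on_imp_differentiable[OF f]] inner_vec_def G_def mult.commute)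
  qed
  have c: "(zc has_derivative zc) (at P)" "(ztc has_derivative ztc) (at P)"
    by (simp_all add: bounded_linear_imp_has_derivative)
  have "((\<lambda>P. f (zc P) + zc P \<bullet> ztc P) has_derivative
      (\<lambda>v. frechet_derivative f (at (zc P)) (zc v) + (zc P \<bullet> ztc v + zc v \<bullet> ztc P))) (at P)"
    by (rule has_derivative_add[OF has_derivative_compose[where f = zc and g = f, OF c(1) fz]
          has_derivative_inner[OF c]])
  moreover have "(\<lambda>v. frechet_derivative f (at (zc P)) (zc v) + (zc P \<bullet> ztc v + zc v \<bullet> ztc P)) = dpot f P"
    by (simp add: fun_eq_iff b dpot_def g inner_add_left inner_commute[of "zc _" "ztc P"])
  ultimately show ?thesis by (simp add: pot_def[abs_def])
qed

lemma dd_pot: "dd v (pot f) P = dpot f P v"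
  by (rule dd_eqI[OF pot_has_derivative])

lemma smooth_on_pot: "open S \<Longrightarrow> smooth_on S (pot f)"
  unfolding pot_def[abs_def]
  by (intro smooth_on_add smooth_on_inner smooth_on_compose[OF _ _ _ _ f] smooth_on_bounded_linear) simp_all

lemma smooth_on_gradz: "open S \<Longrightarrow> smooth_on S (gradz f)"
  unfolding gradz_def[abs_def]
proof (intro smooth_on_add)
  assume S: "open S"
  have "smooth_on S (\<lambda>P. dd (axis i 1) f (zc P))" for i
    by (rule smooth_on_compose[OF S open_UNIV _ smooth_on_bounded_linear smooth_on_dd[OF f]]) simp_all
  then show "smooth_on S (\<lambda>P. \<chi> i. dd (axis i 1) f (zc P))"
    by (simp add: smooth_on_vec_nth_iff[OF S])
qed (simp_all add: smooth_on_bounded_linear)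

lemma smooth_on_dpot: "open S \<Longrightarrow> smooth_on S X \<Longrightarrow> smooth_on S (\<lambda>P. dpot f P (X P))"
  unfolding dpot_def
  by (intro smooth_on_add smooth_on_inner smooth_on_gradz smooth_on_coords) simp_all

lemma smooth_on_chr:
  assumes S: "open S" and X: "smooth_on S X" and Y: "smooth_on S Y"
  shows "smooth_on S (\<lambda>P. chr f P (X P) (Y P))"
proof -
  have xy: "smooth_on S (\<lambda>P. X P $ Cx)" "smooth_on S (\<lambda>P. Y P $ Cx)"
    by (rule smooth_on_vec_nth[OF S X], rule smooth_on_vec_nth[OF S Y])
  show ?thesis
    unfolding chr_def
    by (rule smooth_on_mk[OF S smooth_on_const smooth_on_const smooth_on_const
          smooth_on_minus[OF S smooth_on_add[OF S smooth_on_mult[OF S xy(1) smooth_on_dpot[OF S Y]]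
            smooth_on_mult[OF S xy(2) smooth_on_dpot[OF S X]]]]
          smooth_on_scaleR[OF S smooth_on_mult[OF S xy] smooth_on_gradz[OF S]]
          smooth_on_scaleR[OF S smooth_on_mult[OF S xy] smooth_on_coords_id(1)]])
qed

lemma smooth_on_metric_form_M:
  assumes S: "open S" and X: "smooth_on S X" and Y: "smooth_on S Y"
  shows "smooth_on S (\<lambda>P. metric_form (M_metric f) P (X P) (Y P))"
proof -
  have x: "smooth_on S (\<lambda>P. X P $ i)" "smooth_on S (\<lambda>P. Y P $ i)" for i
    by (rule smooth_on_vec_nth[OF S X], rule smooth_on_vec_nth[OF S Y])
  show ?thesis
    unfolding metric_form_M
    by (rule S smooth_on_add smooth_on_mult smooth_on_inner smooth_on_const x
        smooth_on_pot smooth_on_coords X Y)+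
qed

text \<open>Torsion-freeness is the symmetry of \<open>chr\<close>. Compatibility holds because
  g(chr(v, a), b) + g(a, chr(v, b)) is -2 \<open>dpot f P v\<close> times the x-components of a and
  b, which is the derivative of the metric along v.\<close>

lemma levi_civita_M_explicit:
  assumes U: "open U"
  shows "is_levi_civita_on U (M_metric f) (\<lambda>X Y P. dd (X P) Y P + chr f P (X P) (Y P))"
  unfolding is_levi_civita_on_def affine_connection_on_def
proof (intro conjI allI impI ballI)
  let ?D = "\<lambda>X Y P. dd (X P) Y P + chr f P (X P) (Y P)"
  note dif = smooth_on_imp_differentiable
  show "smooth_on U (?D X Y)" if "smooth_on U X" "smooth_on U Y" for X Y
    using that U by (intro smooth_on_add smooth_on_frechet_derivative smooth_on_chr)
  show "?D (\<lambda>Q. X Q + X' Q) Y P = ?D X Y P + ?D X' Y P"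
    if "smooth_on U Y" "P \<in> U" for X X' Y P
    by (simp add: dd_lin(1)[OF dif[OF that]] chr_def coords_eq_iff dpot_def algebra_simps inner_add_right)
  show "?D X (\<lambda>Q. Y Q + Y' Q) P = ?D X Y P + ?D X Y' P"
    if "smooth_on U Y" "smooth_on U Y'" "P \<in> U" for X Y Y' P
    using that by (simp add: dd_add dif chr_def coords_eq_iff dpot_def algebra_simps inner_add_right)
  show "?D (\<lambda>Q. a Q *\<^sub>R X Q) Y P = a P *\<^sub>R ?D X Y P"
    if "smooth_on U Y" "P \<in> U" for X Y P and a :: "real^'p zindex coord \<Rightarrow> real"
    by (simp add: dd_lin(2)[OF dif[OF that]] chr_def coords_eq_iff dpot_def algebra_simps)
  show "?D X (\<lambda>Q. a Q *\<^sub>R Y Q) P = deriv_along X a P *\<^sub>R Y P + a P *\<^sub>R ?D X Y P"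
    if "smooth_on U a" "smooth_on U Y" "P \<in> U" for X Y P and a :: "real^'p zindex coord \<Rightarrow> real"
    using that by (simp add: dd_scaleR dif deriv_along_def chr_def coords_eq_iff dpot_def algebra_simps)
  show "torsion_free_on U ?D"
    by (simp add: torsion_free_on_def lie_bracket_def deriv_along_def chr_commute)
  show "metric_compatible_on U (M_metric f) ?D"
    unfolding metric_compatible_on_def
  proof (intro allI impI ballI)
    fix X Y W :: "real^'p zindex coord \<Rightarrow> real^'p zindex coord" and P
    assume Y: "smooth_on U Y" and W: "smooth_on U W" and P: "P \<in> U"
    note dY = smooth_on_has_derivative[OF Y P] and dW = smooth_on_has_derivative[OF W P]
    let ?v = "X P"
    have dYW: "((\<lambda>Q. metric_form (M_metric f) Q (Y Q) (W Q)) has_derivative (\<lambda>v.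
        - 2 * dpot f P v * Y P $ Cx * W P $ Cx
        + metric_form (M_metric f) P (dd v Y P) (W P) + metric_form (M_metric f) P (Y P) (dd v W P))) (at P)"
      unfolding metric_form_M
      by (rule has_derivative_eq_rhs, (rule has_derivative_add has_derivative_mult has_derivative_inner has_derivative_const
         pot_has_derivative
         bounded_linear.has_derivative[OF bounded_linear_vec_nth dY] bounded_linear.has_derivative[OF bounded_linear_vec_nth dW]
         bounded_linear.has_derivative[OF coords_linear(1) dY] bounded_linear.has_derivative[OF coords_linear(1) dW]
         bounded_linear.has_derivative[OF coords_linear(2) dY] bounded_linear.has_derivative[OF coords_linear(2) dW]
         bounded_linear.has_derivative[OF coords_linear(3) dY] bounded_linear.has_derivative[OF coords_linear(3) dW]
         bounded_linear.has_derivative[OF coords_linear(4) dY] bounded_linear.has_derivative[OF coords_linear(4) dW])+)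
        (simp add: fun_eq_iff algebra_simps)
    show "deriv_along X (\<lambda>Q. metric_form (M_metric f) Q (Y Q) (W Q)) P =
        metric_form (M_metric f) P (?D X Y P) (W P) + metric_form (M_metric f) P (Y P) (?D X W P)"
      unfolding deriv_along_def dd_eqI[OF dYW]
      by (simp add: metric_form_M chr_def dpot_def algebra_simps inner_add_left inner_add_right inner_commute)
  qed
qed

lemma levi_civita_M:
  assumes U: "open U"
  shows "is_levi_civita_on U (M_metric f) (levi_civita U (M_metric f))"
  unfolding levi_civita_def
  by (rule someI[where P = "is_levi_civita_on U (M_metric f)", OF levi_civita_M_explicit[OF U]])

text \<open>\<open>levi_civita\<close> is a choice: the explicit connection shows that there is
  something to choose, and uniqueness identifies the values of the chosen connection with
  it.\<close>

lemma levi_civita_M_eq: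
  assumes U: "open U" and X: "smooth_on U X" and Y: "smooth_on U Y" and P: "P \<in> U"
  shows "levi_civita U (M_metric f) X Y P = dd (X P) Y P + chr f P (X P) (Y P)"
proof -
  note L = levi_civita_M[OF U, unfolded is_levi_civita_on_def]
  note E = levi_civita_M_explicit[OF U, unfolded is_levi_civita_on_def]
  show ?thesis
    by (rule levi_civita_unique[OF metric_form_M_sym metric_form_M_nondegenerate
          L[THEN conjunct2, THEN conjunct1] L[THEN conjunct2, THEN conjunct2]
          E[THEN conjunct2, THEN conjunct1] E[THEN conjunct2, THEN conjunct2] X Y P])
qed

end

text \<open>The connection pulled back by an isometry is torsion-free and compatible with the first
  metric, so uniqueness applies.\<close>

lemma isometry_imp_affine_diffeomorphism:
  fixes f h :: "real^('p::finite zindex) \<Rightarrow> real"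
  assumes f: "smooth_on UNIV f" and h: "smooth_on UNIV h"
    and iso: "isometry (M_metric f) (M_metric h) \<phi>"
  shows "affine_diffeomorphism UNIV (M_metric f) UNIV (M_metric h) \<phi>"
proof -
  obtain \<phi>' where \<phi>: "diffeomorphism UNIV UNIV \<phi> \<phi>'"
    using iso by (auto simp: isometry_def)
  note L = levi_civita_M[OF f open_UNIV, unfolded is_levi_civita_on_def]
  note H = levi_civita_M[OF h open_UNIV, unfolded is_levi_civita_on_def]
  have i: "metric_form (M_metric h) (\<phi> P) (dd v \<phi> P) (dd w \<phi> P) = metric_form (M_metric f) P v w"
    if "P \<in> UNIV" for P v w
    using iso by (simp add: isometry_def)
  note B = pullback_levi_civita[OF \<phi> i smooth_on_metric_form_M[OF h open_UNIV]
      H[THEN conjunct2, THEN conjunct1] H[THEN conjunct2, THEN conjunct2]]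
  have "pullback_connection \<phi> \<phi>' (levi_civita UNIV (M_metric h)) X Y P = levi_civita UNIV (M_metric f) X Y P"
    if X: "smooth_on UNIV X" and Y: "smooth_on UNIV Y" for X Y P
  proof (rule levi_civita_unique[OF metric_form_M_sym _ _ _
        L[THEN conjunct2, THEN conjunct1] L[THEN conjunct2, THEN conjunct2] X Y UNIV_I])
    show "v = 0" if "\<And>w. metric_form (M_metric f) P v w = 0" for P v
      using that by (rule metric_form_M_nondegenerate)
  qed (rule B, assumption+)+
  then show ?thesis
    unfolding affine_diffeomorphism_def using \<phi> by blast
qed

section \<open>Functions with parallel differential\<close>

lemma mk_zero [simp]: "mk 0 0 0 0 0 0 = 0"
  by (simp add: coords_eq_iff)

text \<open>The subspace in which \<open>chr\<close> takes its values and on which it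
  vanishes.\<close>

definition star :: "real^('p::finite zindex coord) \<Rightarrow> bool" where
  "star s \<longleftrightarrow> s $ Cx = 0 \<and> zc s = 0 \<and> ztc s = 0"

lemma star_chr: "star (chr f P v w)"
  by (simp add: star_def chr_def)

lemma chr_star: "star s \<Longrightarrow> chr f P v s = 0"
  by (simp add: chr_def star_def dpot_def)

lemma chr_no_x: "v $ Cx = 0 \<Longrightarrow> w $ Cx = 0 \<Longrightarrow> chr f P v w = 0"
  by (simp add: chr_def)

lemma dd_zero_on:
  assumes "open U" "P \<in> U" "\<And>Q. Q \<in> U \<Longrightarrow> g Q = 0"
  shows "dd v g P = 0"
  using fun_cong[OF fd_cong_open(1)[OF assms], where x = v] by (simp add: dd_eqI[OF has_derivative_const])

lemma dd_cong_on:
  assumes "open U" "P \<in> U" "\<And>Q. Q \<in> U \<Longrightarrow> f Q = g Q"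
  shows "dd v f P = dd v g P"
  by (rule fun_cong[OF fd_cong_open(1)[OF assms]])

text \<open>The Hessian of the potential has the identity as its mixed block for z and z tilde,
  whatever \<open>f\<close> is; this is the nondegeneracy exploited below.\<close>

lemma dd_gradz:
  assumes f: "smooth_on UNIV f"
  shows "dd v (gradz f) P = (\<chi> i. dd (zc v) (dd (axis i 1) f) (zc P)) + ztc v"
proof -
  have "dd v (gradz f) P $ i = dd (zc v) (dd (axis i 1) f) (zc P) + ztc v $ i" for i
  proof -
    have d: "(dd (axis i 1) f) differentiable (at (zc P))"
      by (rule smooth_on_imp_differentiable[OF smooth_on_dd[OF f] UNIV_I])
    have c: "zc differentiable (at P)" "(\<lambda>P. P $ Czt i) differentiable (at P)"
      by (simp_all add: bounded_linear_imp_differentiable bounded_linear_vec_nth)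
    have g: "gradz f differentiable (at P)"
      by (rule smooth_on_imp_differentiable[OF smooth_on_gradz[OF f open_UNIV] UNIV_I])
    have "dd v (gradz f) P $ i = dd v (\<lambda>P. dd (axis i 1) f (zc P) + P $ Czt i) P"
      using dd_vec_nth[OF g, where v = v and i = i] by (simp add: gradz_def)
    also have "\<dots> = dd v (\<lambda>P. dd (axis i 1) f (zc P)) P + dd v (\<lambda>P. P $ Czt i) P"
      by (rule dd_add[OF differentiable_compose[OF d c(1)] c(2)])
    also have "dd v (\<lambda>P. dd (axis i 1) f (zc P)) P = dd (dd v zc P) (dd (axis i 1) f) (zc P)"
      by (rule dd_compose[OF c(1) d])
    finally show ?thesis
      by (simp add: dd_eqI[OF bounded_linear_imp_has_derivative[OF coords_linear(1)]]
          dd_eqI[OF bounded_linear_imp_has_derivative[OF bounded_linear_vec_nth]])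
  qed
  then show ?thesis by (simp add: vec_eq_iff)
qed

text \<open>
  The hypothesis says that \<open>du\<close> is parallel, so \<open>u\<close> is an affine function of the unstarred
  coordinates. The reason is the symmetry of third derivatives: it pairs \<open>du\<close> with the Hessian of
  the potential, which is nondegenerate because of the terms \<open>z\<^sub>i * zt\<^sub>i\<close>.
\<close>

lemma parallel_differential:
  fixes f :: "real^('p::finite zindex) \<Rightarrow> real" and u :: "real^('p zindex coord) \<Rightarrow> real"
  assumes f: "smooth_on UNIV f" and U: "open U" and u: "smooth_on U u"
    and hess: "\<And>P v w. P \<in> U \<Longrightarrow> dd v (dd w u) P = dd (chr f P v w) u P"
    and P: "P \<in> U"
  shows "star s \<Longrightarrow> dd s u P = 0" and "dd v (dd w u) P = 0"
proof -
  let ?x = "mk 1 0 0 0 0 0 :: real^('p zindex coord)" and ?xs = "mk 0 0 0 1 0 0 :: real^('p zindex coord)"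
  have du: "u differentiable (at Q)" if "Q \<in> U" for Q
    by (rule smooth_on_imp_differentiable[OF u that])
  have ddu: "(dd v u) differentiable (at Q)" if "Q \<in> U" for Q v
    by (rule smooth_on_imp_differentiable[OF smooth_on_dd[OF u] that])
  have swap: "dd a (dd b (dd c u)) Q = dd b (dd a (dd c u)) Q" if "Q \<in> U" for a b c Q
    by (rule dd_commute_real[OF U that smooth_on_dd[OF u]])
  have swap2: "dd a (dd b (dd c u)) Q = dd a (dd c (dd b u)) Q" if "Q \<in> U" for a b c Q
    by (rule dd_cong_on[OF U that]) (rule dd_commute_real[OF U _ u])
  \<comment> \<open>The third derivative along \<open>?z\<close>, \<open>?x\<close>,
    \<open>?t\<close> is computed in two orders. With \<open>?z\<close> outermost it is minus the
    derivative along \<open>?xs\<close>; with \<open>?x\<close> outermost it is 0, as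
    \<open>chr\<close> vanishes on two vectors without x-component.\<close>
  have xs: "dd ?xs u Q = 0" if Q: "Q \<in> U" for Q
  proof -
    fix i :: "'p zindex"
    let ?t = "mk 0 0 (axis i 1) 0 0 0 :: real^('p zindex coord)"
      and ?z = "mk 0 (axis i 1) 0 0 0 0 :: real^('p zindex coord)"
    have "dd ?x (dd ?t u) R = - (R $ Cz i) * dd ?xs u R" if R: "R \<in> U" for R
    proof -
      have "chr f R ?x ?t = (- (R $ Cz i)) *\<^sub>R ?xs"
        by (simp add: chr_def dpot_def coords_eq_iff inner_axis)
      then show ?thesis using hess[OF R, where v = ?x and w = ?t] dd_lin(2,5)[OF du[OF R]] by simp
    qed
    then have "dd ?z (dd ?x (dd ?t u)) Q = dd ?z (\<lambda>R. - (R $ Cz i) * dd ?xs u R) Q"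
      by (rule dd_cong_on[OF U Q])
    also have "\<dots> = - (Q $ Cz i) * dd ?z (dd ?xs u) Q + dd ?z (\<lambda>R. - (R $ Cz i)) Q * dd ?xs u Q"
      by (rule dd_mult[OF _ ddu[OF Q]])
        (simp add: bounded_linear_imp_differentiable bounded_linear_vec_nth)
    also have "dd ?z (\<lambda>R. - (R $ Cz i)) Q = - 1"
      by (simp add: dd_eqI[OF bounded_linear_imp_has_derivative[OF bounded_linear_minus[OF bounded_linear_vec_nth]]])
    also have "dd ?z (dd ?xs u) Q = 0"
      using hess[OF Q, where v = ?z and w = ?xs] chr_star[of ?xs f Q ?z] dd_lin(3)[OF du[OF Q]] by (simp add: star_def)
    also have "dd ?z (dd ?x (dd ?t u)) Q = dd ?x (dd ?z (dd ?t u)) Q"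
      by (rule swap[OF Q])
    also have "dd ?x (dd ?z (dd ?t u)) Q = 0"
      using hess chr_no_x[of ?z ?t] dd_lin(3)[OF du] by (intro dd_zero_on[OF U Q]) simp
    finally show ?thesis by simp
  qed
  \<comment> \<open>The second derivative of \<open>u\<close> along \<open>?x\<close> twice is its
    derivative along the starred field \<open>?Y\<close>. Differentiating along \<open>v\<close>
    leaves the derivative along the change of \<open>?Y\<close>; with \<open>?x\<close> outermost
    the same third derivative is 0, since the mixed second derivative is a multiple of the one along
    \<open>?xs\<close>.\<close>
  have field: "dd (mk 0 0 0 0 (dd v (gradz f) Q) (zc v)) u Q = 0" if Q: "Q \<in> U" and v: "v $ Cx = 0" for Q v
  proof -
    let ?Y = "\<lambda>R. mk 0 0 0 0 (gradz f R) (zc R)"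
    have chrx: "chr f R ?x ?x = ?Y R" for R
      by (simp add: chr_def dpot_def coords_eq_iff)
    have lin: "bounded_linear (\<lambda>(a, b). mk 0 0 0 0 a b :: real^('p zindex coord))"
      by (rule linear_conv_bounded_linear[THEN iffD1], rule linearI) (auto simp: coords_eq_iff)
    have dg: "(gradz f has_derivative frechet_derivative (gradz f) (at Q)) (at Q)"
      by (rule smooth_on_has_derivative[OF smooth_on_gradz[OF f open_UNIV] UNIV_I])
    have dY: "(?Y has_derivative (\<lambda>v. mk 0 0 0 0 (dd v (gradz f) Q) (zc v))) (at Q)"
      using bounded_linear.has_derivative[OF lin has_derivative_Pair[OF dg
          bounded_linear_imp_has_derivative[OF coords_linear(1)]]] by simp
    have "dd v (dd ?x (dd ?x u)) Q = dd v (\<lambda>R. dd (?Y R) u R) Q"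
      using hess[where v = ?x and w = ?x] by (intro dd_cong_on[OF U Q]) (simp add: chrx)
    also have "\<dots> = dd (dd v ?Y Q) u Q + dd (?Y Q) (dd v u) Q"
      by (rule dd_frechet_field[OF U Q u _ dd_commute_real[OF U Q u]])
        (use dY in \<open>auto simp: differentiable_def\<close>)
    also have "dd (?Y Q) (dd v u) Q = 0"
      using hess[OF Q, where v = "?Y Q" and w = v] chr_star[of "?Y Q" f Q v] dd_lin(3)[OF du[OF Q]]
      by (simp add: chr_commute star_def)
    also have "dd v ?Y Q = mk 0 0 0 0 (dd v (gradz f) Q) (zc v)"
      by (rule dd_eqI[OF dY])
    also have "dd v (dd ?x (dd ?x u)) Q = dd ?x (dd v (dd ?x u)) Q"
      by (rule swap[OF Q])
    also have "\<dots> = 0"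
    proof (rule dd_zero_on[OF U Q])
      fix R assume R: "R \<in> U"
      have "chr f R v ?x = (- dpot f R v) *\<^sub>R ?xs"
        using v by (simp add: chr_def dpot_def coords_eq_iff)
      then show "dd v (dd ?x u) R = 0"
        using hess[OF R, where v = v and w = ?x] dd_lin(2,5)[OF du[OF R]] xs[OF R] by simp
    qed
    finally show ?thesis by simp
  qed
  \<comment> \<open>A direction in the block of z tilde changes the gradient by exactly
    \<open>t\<close> and leaves \<open>zc\<close> fixed; a direction in the block of z then yields
    the last block after subtracting what is known here.\<close>
  have zs: "dd (mk 0 0 0 0 t 0) u P = 0" for t
    using field[OF P, of "mk 0 0 t 0 0 0"] by (simp add: dd_gradz[OF f] dd_lin[OF du] zero_vec_def[symmetric]
        dd_lin(3)[OF smooth_on_imp_differentiable[OF smooth_on_dd[OF f] UNIV_I]])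
  have zts: "dd (mk 0 0 0 0 0 t) u P = 0" for t
  proof -
    let ?g = "dd (mk 0 t 0 0 0 0) (gradz f) P"
    have "mk 0 0 0 0 ?g t = mk 0 0 0 0 ?g 0 + mk 0 0 0 0 0 t"
      by (simp add: coords_eq_iff)
    then show ?thesis
      using field[OF P, of "mk 0 t 0 0 0 0"] zs[of ?g] by (simp add: dd_lin(1)[OF du[OF P]])
  qed
  show s0: "dd s u P = 0" if "star s" for s
  proof -
    have "s = (s $ Cxs) *\<^sub>R ?xs + mk 0 0 0 0 (zsc s) 0 + mk 0 0 0 0 0 (ztsc s)"
      using that by (simp add: coords_eq_iff star_def)
    then have "dd s u P = dd ((s $ Cxs) *\<^sub>R ?xs + mk 0 0 0 0 (zsc s) 0 + mk 0 0 0 0 0 (ztsc s)) u P"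
      by (rule arg_cong)
    then show ?thesis by (simp add: dd_lin(1,2)[OF du[OF P]] xs[OF P] zs zts)
  qed
  show "dd v (dd w u) P = 0"
    using hess[OF P] s0[OF star_chr] by simp
qed

section \<open>Affine diffeomorphisms\<close>

lemma subspace_star: "subspace {s. star s}"
  by (simp add: subspace_def star_def)

lemma injective_linear_preimage_subspace:
  fixes T :: "'a::euclidean_space \<Rightarrow> 'a"
  assumes "linear T" "inj T" "subspace S" "T ` S \<subseteq> S" "T y \<in> S"
  shows "y \<in> S"
proof -
  have "T ` S = S"
    using assms by (intro subspace_dim_equal linear_subspace_image)
      (simp_all add: dim_image_eq inj_on_subset[OF assms(2)])
  then show ?thesis using assms(2,5) by (metis inj_image_mem_iff)
qed

locale affine_pair =
  fixes f1 f2 :: "real^('p::finite zindex) \<Rightarrow> real"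
    and U V :: "(real^('p zindex coord)) set" and \<phi> \<phi>' :: "real^('p zindex coord) \<Rightarrow> real^('p zindex coord)"
  assumes f1: "smooth_on UNIV f1" and f2: "smooth_on UNIV f2"
    and diffeo: "diffeomorphism U V \<phi> \<phi>'"
    and conn: "\<And>X Y P. smooth_on U X \<Longrightarrow> smooth_on U Y \<Longrightarrow> P \<in> U \<Longrightarrow>
      pullback_connection \<phi> \<phi>' (levi_civita V (M_metric f2)) X Y P = levi_civita U (M_metric f1) X Y P"
begin

lemma openU: "open U" and openV: "open V" and smooth\<phi>: "smooth_on U \<phi>"
  and inv: "P \<in> U \<Longrightarrow> \<phi>' (\<phi> P) = P" and \<phi>V: "P \<in> U \<Longrightarrow> \<phi> P \<in> V"
  using diffeo by (auto simp: diffeomorphism_def)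

lemma dif\<phi>: "P \<in> U \<Longrightarrow> \<phi> differentiable (at P)"
  by (rule smooth_on_imp_differentiable[OF smooth\<phi>])

text \<open>Preservation of the connection is tested on constant fields: upstairs their covariant
  derivative is just the Christoffel form, and along \<phi> their pushforwards are the directional
  derivatives of \<phi>.\<close>

lemma transformation_law:
  assumes P: "P \<in> U"
  shows "dd v (dd w \<phi>) P + chr f2 (\<phi> P) (dd v \<phi> P) (dd w \<phi> P) = dd (chr f1 P v w) \<phi> P"
proof -
  let ?pv = "pushforward \<phi> \<phi>' (\<lambda>_. v)" and ?pw = "pushforward \<phi> \<phi>' (\<lambda>_. w)"
  have sv: "smooth_on V ?pv" and sw: "smooth_on V ?pw"
    by (rule smooth_on_pushforward[OF diffeo smooth_on_const])+
  have pv: "?pv (\<phi> Q) = dd v \<phi> Q" "?pw (\<phi> Q) = dd w \<phi> Q" if "Q \<in> U" for Q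
    using inv[OF that] by (simp_all add: pushforward_def)
  have "dd (levi_civita V (M_metric f2) ?pv ?pw (\<phi> P)) \<phi>' (\<phi> P) = levi_civita U (M_metric f1) (\<lambda>_. v) (\<lambda>_. w) P"
    using conn[OF smooth_on_const smooth_on_const P] by (simp add: pullback_connection_def pushforward_def[of \<phi>' \<phi>])
  also have "\<dots> = chr f1 P v w"
    by (simp add: levi_civita_M_eq[OF f1 openU smooth_on_const smooth_on_const P] dd_eqI[OF has_derivative_const])
  finally have "dd (chr f1 P v w) \<phi> P = levi_civita V (M_metric f2) ?pv ?pw (\<phi> P)"
    using frechet_inverse[OF diffeomorphism_sym[OF diffeo] \<phi>V[OF P]] inv[OF P] by metis
  also have "\<dots> = dd (dd v \<phi> P) ?pw (\<phi> P) + chr f2 (\<phi> P) (dd v \<phi> P) (dd w \<phi> P)"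
    by (simp add: levi_civita_M_eq[OF f2 openV sv sw \<phi>V[OF P]] pv[OF P])
  also have "dd (dd v \<phi> P) ?pw (\<phi> P) = dd v (\<lambda>Q. ?pw (\<phi> Q)) P"
    by (rule dd_compose[symmetric, OF dif\<phi>[OF P] smooth_on_imp_differentiable[OF sw \<phi>V[OF P]]])
  also have "\<dots> = dd v (dd w \<phi>) P"
    by (rule dd_cong_on[OF openU P pv(2)])
  finally show ?thesis by simp
qed

section \<open>The components of an affine diffeomorphism\<close>

definition cpt :: "'p zindex coord \<Rightarrow> real^('p zindex coord) \<Rightarrow> real" where
  "cpt c P = \<phi> P $ c"

lemma smooth_cpt: "smooth_on U (cpt c)"
  unfolding cpt_def[abs_def] by (rule smooth_on_vec_nth[OF openU smooth\<phi>])

lemma dif_cpt: "P \<in> U \<Longrightarrow> (cpt c) differentiable (at P)"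
  "P \<in> U \<Longrightarrow> (dd v (cpt c)) differentiable (at P)"
  by (rule smooth_on_imp_differentiable[OF smooth_cpt], assumption,
      rule smooth_on_imp_differentiable[OF smooth_on_dd[OF smooth_cpt]])

lemma dd_cpt: "P \<in> U \<Longrightarrow> dd v (cpt c) P = dd v \<phi> P $ c"
  unfolding cpt_def[abs_def] by (rule dd_vec_nth[OF dif\<phi>])

lemma dd2_cpt:
  assumes P: "P \<in> U"
  shows "dd v (dd w (cpt c)) P =
    dd (chr f1 P v w) (cpt c) P - chr f2 (\<phi> P) (dd v \<phi> P) (dd w \<phi> P) $ c"
proof -
  have "dd v (dd w (cpt c)) P = dd v (\<lambda>Q. dd w \<phi> Q $ c) P"
    by (rule dd_cong_on[OF openU P dd_cpt])
  also have "\<dots> = dd v (dd w \<phi>) P $ c"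
    by (rule dd_vec_nth[OF smooth_on_imp_differentiable[OF smooth_on_dd[OF smooth\<phi>] P]])
  finally show ?thesis
    using arg_cong[OF transformation_law[OF P, where v = v and w = w], of "\<lambda>x. x $ c"] by (simp add: dd_cpt[OF P])
qed

text \<open>The Christoffel form of the target has no unstarred components, so the transformation
  law for such a component is the hypothesis of \<open>parallel_differential\<close>.\<close>

lemma unstarred:
  assumes c: "c = Cx \<or> c \<in> range Cz \<or> c \<in> range Czt" and P: "P \<in> U"
  shows "star s \<Longrightarrow> dd s (cpt c) P = 0" and "dd v (dd w (cpt c)) P = 0"
proof -
  have h: "dd v (dd w (cpt c)) Q = dd (chr f1 Q v w) (cpt c) Q" if "Q \<in> U" for Q v w
    using c dd2_cpt[OF that] by (auto simp: chr_def)
  show "star s \<Longrightarrow> dd s (cpt c) P = 0"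
    by (rule parallel_differential(1)[OF f1 openU smooth_cpt h P])
  show "dd v (dd w (cpt c)) P = 0"
    by (rule parallel_differential(2)[OF f1 openU smooth_cpt h P])
qed

text \<open>By \<open>unstarred\<close> the differential preserves the starred subspace; being
  injective it also reflects it.\<close>

lemma dd_star:
  assumes P: "P \<in> U"
  shows "star (dd s \<phi> P) \<longleftrightarrow> star s"
proof -
  have 1: "star (dd s \<phi> P)" if "star s" for s
    unfolding star_def vec_eq_iff coords_nth zero_index dd_cpt[OF P, symmetric]
    by (intro conjI allI unstarred(1)[OF _ P that]) simp_all
  have "inj (\<lambda>s. dd s \<phi> P)"
    by (rule inj_on_inverseI[where g = "\<lambda>s. dd s \<phi>' (\<phi> P)"]) (rule frechet_inverse[OF diffeo P])
  then have "s \<in> {s. star s}" if "star (dd s \<phi> P)"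
    by (rule injective_linear_preimage_subspace[OF linear_frechet_derivative[OF dif\<phi>[OF P]] _ subspace_star])
      (use that 1 in blast)+
  then show ?thesis using 1 by blast
qed

text \<open>
  Otherwise some vector \<open>w \<noteq> 0\<close> in the span of the directions \<open>z\<^sub>i\<close> and \<open>zt\<^sub>i\<close> is annihilated by the
  differential of the \<open>x\<close>-component; symmetry of third derivatives of the starred components then
  makes the gradient of the potential constant along \<open>d\<phi>(w)\<close>, so \<open>d\<phi>(w)\<close> and hence \<open>w\<close> are starred.
\<close>

lemma x_independent_of_z:
  assumes P: "P \<in> U"
  shows "dd (mk 0 (axis i 1) 0 0 0 0) (cpt Cx) P = 0"
proof (rule ccontr)
  let ?y = "mk 0 (axis i 1) 0 0 0 0 :: real^('p zindex coord)"
    and ?t = "mk 0 0 (axis i 1) 0 0 0 :: real^('p zindex coord)"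
  assume ne: "dd ?y (cpt Cx) P \<noteq> 0"
  \<comment> \<open>The combination annihilated by the differential of the x-component; its
    coefficient on \<open>?t\<close> is nonzero by \<open>ne\<close>, which contradicts starredness
    of \<open>w\<close> at the end.\<close>
  define w where "w = dd ?y (cpt Cx) P *\<^sub>R ?t - dd ?t (cpt Cx) P *\<^sub>R ?y"
  have wx: "dd w (cpt Cx) P = 0"
    by (simp add: w_def dd_lin[OF dif_cpt(1)[OF P]])
  have X2: "dd a (dd b (cpt Cx)) P = 0" for a b
    by (rule unstarred(2)[OF _ P]) simp
  \<comment> \<open>The third derivative of a starred component along \<open>w\<close>,
    \<open>?y\<close>, \<open>?y\<close> is a nonzero multiple of \<open>dd w G P\<close> with
    \<open>w\<close> outermost. With one \<open>?y\<close> outermost it is 0: the x-component has no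
    derivative along \<open>w\<close> at \<open>P\<close> and no second derivatives.\<close>
  have G0: "dd w G P = 0"
    if G: "G differentiable (at P)"
      and c: "\<And>Q a b. a $ Cx = 0 \<Longrightarrow> b $ Cx = 0 \<Longrightarrow> Q \<in> U \<Longrightarrow>
        dd a (dd b (cpt c)) Q = - (dd a (cpt Cx) Q * dd b (cpt Cx) Q * G Q)"
    for G c
  proof -
    have d: "(\<lambda>Q. dd a (cpt Cx) Q * dd b (cpt Cx) Q) differentiable (at P)" for a b
      by (intro differentiable_mult dif_cpt[OF P])
    have e: "dd v (\<lambda>Q. - (dd a (cpt Cx) Q * dd b (cpt Cx) Q * G Q)) P =
        - (dd a (cpt Cx) P * dd b (cpt Cx) P * dd v G P)" for v a b
      by (simp add: dd_minus differentiable_mult[OF d G] dd_mult[OF d G] dd_mult[OF dif_cpt(2)[OF P] dif_cpt(2)[OF P]] X2)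
    have "dd w (dd ?y (dd ?y (cpt c))) P = dd w (\<lambda>Q. - (dd ?y (cpt Cx) Q * dd ?y (cpt Cx) Q * G Q)) P"
      by (rule dd_cong_on[OF openU P]) (rule c, simp_all)
    moreover have "dd ?y (dd w (dd ?y (cpt c))) P = dd ?y (\<lambda>Q. - (dd w (cpt Cx) Q * dd ?y (cpt Cx) Q * G Q)) P"
      by (rule dd_cong_on[OF openU P]) (rule c, simp_all add: w_def)
    moreover have "dd w (dd ?y (dd ?y (cpt c))) P = dd ?y (dd w (dd ?y (cpt c))) P"
      by (rule dd_commute_real[OF openU P smooth_on_dd[OF smooth_cpt]])
    ultimately show ?thesis using ne by (simp add: e wx)
  qed
  have z: "zc (dd w \<phi> P) = 0"
  proof -
    have "dd w (cpt (Cz j)) P = 0" for j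
      by (rule G0[of _ "Czts j"], rule dif_cpt[OF P])
        (simp add: dd2_cpt chr_no_x dd_cpt dd_lin(3)[OF dif\<phi>], simp add: chr_def cpt_def)
    then show ?thesis by (simp add: vec_eq_iff dd_cpt[OF P])
  qed
  \<comment> \<open>Now that the z-part of the image is known to vanish, the derivative of
    \<open>gradz f2\<close> along it is just its part in z tilde.\<close>
  have zt: "ztc (dd w \<phi> P) = 0"
  proof -
    have g: "(gradz f2) differentiable (at (\<phi> P))"
      by (rule smooth_on_imp_differentiable[OF smooth_on_gradz[OF f2 open_UNIV] UNIV_I])
    have d: "(\<lambda>Q. gradz f2 (\<phi> Q)) differentiable (at P)"
      by (rule differentiable_compose[OF g dif\<phi>[OF P]])
    have "dd w (\<lambda>Q. gradz f2 (\<phi> Q) $ j) P = 0" for j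
      by (rule G0[of _ "Czs j"], intro differentiable_compose[OF bounded_linear_imp_differentiable[OF bounded_linear_vec_nth] d])
        (simp add: dd2_cpt chr_no_x dd_cpt dd_lin(3)[OF dif\<phi>], simp add: chr_def cpt_def)
    moreover have "dd w (\<lambda>Q. gradz f2 (\<phi> Q) $ j) P = ztc (dd w \<phi> P) $ j" for j
    proof -
      have "dd w (\<lambda>Q. gradz f2 (\<phi> Q) $ j) P = dd w (\<lambda>Q. gradz f2 (\<phi> Q)) P $ j"
        by (rule dd_vec_nth[OF d])
      also have "dd w (\<lambda>Q. gradz f2 (\<phi> Q)) P = dd (dd w \<phi> P) (gradz f2) (\<phi> P)"
        by (rule dd_compose[OF dif\<phi>[OF P] g])
      finally show ?thesis
        by (simp add: dd_gradz[OF f2] z dd_lin(3)[OF smooth_on_imp_differentiable[OF smooth_on_dd[OF f2] UNIV_I]])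
    qed
    ultimately show ?thesis by (simp add: vec_eq_iff)
  qed
  have "star w"
    using z zt wx dd_star[OF P, of w] by (simp add: star_def dd_cpt[OF P])
  then have "ztc w $ i = 0" by (simp add: star_def)
  then show False using ne by (simp add: w_def)
qed

text \<open>As the x-component of \<phi> does not depend on the z-variables, the mixed derivative of
  the component \<open>Cxs\<close> along \<open>x\<close> and \<open>y\<close> involves only the
  first derivatives of both potentials along \<open>y\<close>. A further derivative along
  \<open>y\<close> gives the Hessians; in the other order it is 0, because the second derivative
  along \<open>y\<close> twice vanishes.\<close>

lemma hessian_relation:
  fixes i :: "'p zindex"
  defines "x \<equiv> mk 1 0 0 0 0 0" and "xs \<equiv> mk 0 0 0 1 0 0" and "y \<equiv> mk 0 (axis i 1) 0 0 0 0"
  assumes P: "P \<in> U"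
  shows "dd xs (cpt Cxs) P \<noteq> 0"
    and "dd y (dd xs (cpt Cxs)) P = 0"
    and "dd x (cpt Cx) P * dd y (dd y (\<lambda>Q. pot f2 (\<phi> Q))) P = dd xs (cpt Cxs) P * dd y (dd y (pot f1)) P"
proof -
  let ?t = "mk 0 0 (axis i 1) 0 0 0 :: real^('p zindex coord)"
  have star_xs: "star xs" by (simp add: star_def xs_def)
  have Xy: "dd y (cpt Cx) Q = 0" and Xxs: "dd xs (cpt Cx) Q = 0" if "Q \<in> U" for Q
    using x_independent_of_z[OF that] unstarred(1)[OF _ that star_xs] by (simp_all add: y_def)
  have chr_xy: "chr f1 Q x y = (- dpot f1 Q y) *\<^sub>R xs" for Q
    by (simp add: chr_def x_def y_def xs_def coords_eq_iff dpot_def)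
  have yx: "y $ Cx = 0" "?t $ Cx = 0" by (simp_all add: y_def)
  have dp: "(\<lambda>Q. dpot f1 Q y) differentiable (at P)"
    by (rule smooth_on_imp_differentiable[OF smooth_on_dpot[OF f1 open_UNIV smooth_on_const] UNIV_I])
  \<comment> \<open>The same comparison of orders, along \<open>?t\<close>, \<open>x\<close>,
    \<open>y\<close>: the derivative of \<open>dpot f1 Q y\<close> along \<open>?t\<close> is 1 and
    isolates \<open>dd xs (cpt c) P\<close>. So the image of \<open>xs\<close> is a multiple of
    \<open>xs\<close>, nonzero by injectivity.\<close>
  have xs0: "dd xs (cpt c) P = 0" if c: "c \<in> range Czs \<or> c \<in> range Czts" for c
  proof -
    have 1: "dd x (dd y (cpt c)) Q = - (dpot f1 Q y * dd xs (cpt c) Q)" if "Q \<in> U" for Q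
      using c Xy[OF that] by (auto simp: dd2_cpt[OF that] chr_xy dd_lin[OF dif_cpt(1)[OF that]] chr_def[of f2] dd_cpt[OF that, symmetric])
    have 2: "dd ?t (dd y (cpt c)) Q = 0" if "Q \<in> U" for Q
      using c Xy[OF that] yx by (auto simp: dd2_cpt[OF that] chr_no_x[of ?t y] dd_lin[OF dif_cpt(1)[OF that]] chr_def[of f2] dd_cpt[OF that, symmetric])
    have 3: "dd ?t (dd xs (cpt c)) P = 0"
      using c Xxs[OF P] by (auto simp: dd2_cpt[OF P] chr_star[OF star_xs] dd_lin[OF dif_cpt(1)[OF P]] chr_def[of f2] dd_cpt[OF P, symmetric])
    have "dd ?t (\<lambda>Q. - (dpot f1 Q y * dd xs (cpt c) Q)) P = dd ?t (dd x (dd y (cpt c))) P"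
      by (rule dd_cong_on[OF openU P 1[symmetric]])
    also have "\<dots> = dd x (dd ?t (dd y (cpt c))) P"
      by (rule dd_commute_real[OF openU P smooth_on_dd[OF smooth_cpt]])
    also have "\<dots> = 0" by (rule dd_zero_on[OF openU P 2])
    finally have "dd ?t (\<lambda>Q. dpot f1 Q y) P * dd xs (cpt c) P = 0"
      by (simp add: dd_minus differentiable_mult[OF dp dif_cpt(2)[OF P]] dd_mult[OF dp dif_cpt(2)[OF P]] 3)
    moreover have "dd ?t (\<lambda>Q. dpot f1 Q y) P = 1"
    proof -
      have g: "(gradz f1) differentiable (at P)"
        by (rule smooth_on_imp_differentiable[OF smooth_on_gradz[OF f1 open_UNIV] UNIV_I])
      have "(\<lambda>Q. dpot f1 Q y) = (\<lambda>Q. gradz f1 Q $ i)"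
        by (simp add: dpot_def y_def inner_axis fun_eq_iff)
      then show ?thesis
        by (simp add: dd_vec_nth[OF g] dd_gradz[OF f1] dd_lin(3)[OF smooth_on_imp_differentiable[OF smooth_on_dd[OF f1] UNIV_I]])
    qed
    ultimately show ?thesis by simp
  qed
  show "dd xs (cpt Cxs) P \<noteq> 0"
  proof
    assume 0: "dd xs (cpt Cxs) P = 0"
    have "dd xs \<phi> P = 0"
      using dd_star[OF P, of xs] star_xs 0 xs0
      by (auto simp: coords_eq_iff star_def dd_cpt[OF P, symmetric] vec_eq_iff)
    then have "xs = 0"
      using frechet_inverse[OF diffeo P, of xs] dd_lin(3)[OF smooth_on_imp_differentiable[of V \<phi>']] diffeo \<phi>V[OF P]
      by (simp add: diffeomorphism_def)
    then show False by (simp add: xs_def coords_eq_iff)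
  qed
  \<comment> \<open>Both Christoffel terms vanish, since \<open>xs\<close> and its image are
    starred.\<close>
  have comp0: "dd v (dd xs (cpt Cxs)) P = 0" for v
    using dd_star[OF P, of xs] star_xs Xxs[OF P]
    by (simp add: dd2_cpt[OF P] chr_star dd_lin[OF dif_cpt(1)[OF P]])
  then show "dd y (dd xs (cpt Cxs)) P = 0" .
  let ?H = "\<lambda>Q. dd y (\<lambda>Q. pot f2 (\<phi> Q)) Q"
  have sH: "smooth_on U (\<lambda>Q. pot f2 (\<phi> Q))"
    by (rule smooth_on_compose[OF openU open_UNIV _ smooth\<phi> smooth_on_pot[OF f2 open_UNIV]]) simp
  have dH: "?H differentiable (at P)"
    by (rule smooth_on_imp_differentiable[OF smooth_on_dd[OF sH] P])
  have H: "?H Q = dpot f2 (\<phi> Q) (dd y \<phi> Q)" if "Q \<in> U" for Q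
    using dd_compose[OF dif\<phi>[OF that] smooth_on_imp_differentiable[OF smooth_on_pot[OF f2 open_UNIV] UNIV_I]]
    by (simp add: dd_pot[OF f2])
  have yy: "dd y (dd y (cpt Cxs)) Q = 0" if "Q \<in> U" for Q
    using Xy[OF that] by (simp add: dd2_cpt[OF that] chr_no_x[OF yx(1) yx(1)] dd_lin[OF dif_cpt(1)[OF that]]
        chr_def[of f2] dd_cpt[OF that, symmetric])
  have xy: "dd x (dd y (cpt Cxs)) Q = dd x (cpt Cx) Q * ?H Q - dpot f1 Q y * dd xs (cpt Cxs) Q" if "Q \<in> U" for Q
    using Xy[OF that] by (simp add: dd2_cpt[OF that] chr_xy dd_lin[OF dif_cpt(1)[OF that]]
        chr_def[of f2] dd_cpt[OF that, symmetric] H[OF that])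
  have "dd y (\<lambda>Q. dd x (cpt Cx) Q * ?H Q - dpot f1 Q y * dd xs (cpt Cxs) Q) P = dd y (dd x (dd y (cpt Cxs))) P"
    by (rule dd_cong_on[OF openU P xy[symmetric]])
  also have "\<dots> = dd x (dd y (dd y (cpt Cxs))) P"
    by (rule dd_commute_real[OF openU P smooth_on_dd[OF smooth_cpt]])
  also have "\<dots> = 0" by (rule dd_zero_on[OF openU P yy])
  finally show "dd x (cpt Cx) P * dd y ?H P = dd xs (cpt Cxs) P * dd y (dd y (pot f1)) P"
    using unstarred(2)[OF _ P, of Cx x y] comp0[of y]
    by (simp add: dd_diff[OF differentiable_mult[OF dif_cpt(2)[OF P] dH] differentiable_mult[OF dp dif_cpt(2)[OF P]]]
        dd_mult[OF dif_cpt(2)[OF P] dH] dd_mult[OF dp dif_cpt(2)[OF P]] dd_pot[OF f1] mult.commute)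
qed

end

section \<open>Real analytic functions of one variable\<close>

text \<open>Phrased with iterated \<open>deriv\<close>, the form in which derivatives enter
  \<open>alpha\<close>.\<close>

definition infinitely_differentiable :: "(real \<Rightarrow> real) \<Rightarrow> bool" where
  "infinitely_differentiable f \<longleftrightarrow>
    (\<forall>n t. ((deriv ^^ n) f has_real_derivative (deriv ^^ Suc n) f t) (at t))"

lemma infinitely_differentiableD:
  "infinitely_differentiable f \<Longrightarrow> ((deriv ^^ n) f has_real_derivative (deriv ^^ Suc n) f t) (at t)"
  by (simp add: infinitely_differentiable_def)

lemma higher_deriv_eqI:
  assumes "G 0 = f" "\<And>n t. (G n has_real_derivative G (Suc n) t) (at t)"
  shows "(deriv ^^ n) f = G n" and "infinitely_differentiable f"
proof -
  show *: "(deriv ^^ n) f = G n" for n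
  proof (induction n)
    case (Suc n)
    have "deriv (G n) = G (Suc n)" by (rule ext) (rule DERIV_imp_deriv[OF assms(2)])
    then show ?case using Suc by simp
  qed (simp add: assms(1))
  show "infinitely_differentiable f"
    unfolding infinitely_differentiable_def * by (simp add: assms(2))
qed

lemma smooth_on_infinitely_differentiable:
  assumes "infinitely_differentiable f"
  shows "smooth_on UNIV f"
proof -
  have d: "((deriv ^^ k) f has_derivative (\<lambda>v. (deriv ^^ Suc k) f t * v)) (at t)" for k t
    using infinitely_differentiableD[OF assms, of k t] by (simp add: has_field_derivative_def)
  have "C_on n UNIV ((deriv ^^ k) f)" for n k
  proof (induction n arbitrary: k)
    case 0
    then show ?case
      using has_derivative_continuous[OF d] by (auto simp: continuous_on_eq_continuous_at)
  next
    case (Suc n)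
    have "C_on n UNIV (\<lambda>t. (deriv ^^ Suc k) f t * v)" for v
      by (rule C_on_bilinear[OF open_UNIV bounded_bilinear_mult Suc.IH C_on_const])
    then show ?case
      using d[of k] unfolding C_on.simps dd_eqI[OF d] by (auto simp: differentiable_def)
  qed
  from this[of _ 0] show ?thesis by (simp add: smooth_on_def)
qed

section \<open>Power series and the identity theorem\<close>

text \<open>The condition inside \<open>real_analytic_on\<close> with radius and coefficients named,
  so that both can be followed through differentiation.\<close>

definition power_series_at :: "(real \<Rightarrow> real) \<Rightarrow> real \<Rightarrow> real \<Rightarrow> (nat \<Rightarrow> real) \<Rightarrow> bool" where
  "power_series_at f t r a \<longleftrightarrow> r > 0 \<and> (\<forall>s. \<bar>s - t\<bar> < r \<longrightarrow> (\<lambda>n. a n * (s - t) ^ n) sums f s)"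

text \<open>Termwise differentiation after moving the centre to 0; the radius is unchanged, which
  permits iteration.\<close>

lemma power_series_at_deriv:
  assumes "power_series_at f t r a"
  shows "\<bar>s - t\<bar> < r \<Longrightarrow> (f has_real_derivative deriv f s) (at s)"
    and "power_series_at (deriv f) t r (diffs a)"
proof -
  have f: "(\<lambda>n. a n * z ^ n) sums f (z + t)" if "norm z < r" for z
    using assms that by (auto simp: power_series_at_def dest: spec[of _ "z + t"])
  have d: "(f has_real_derivative deriv f s) (at s)" if s: "\<bar>s - t\<bar> < r" for s
  proof -
    have "((\<lambda>z. \<Sum>n. a n * z ^ n) has_real_derivative (\<Sum>n. diffs a n * (s - t) ^ n)) (at (s - t))"
      using s by (intro termdiffs_strong'[where K = r]) (auto intro: sums_summable[OF f])
    moreover have "eventually (\<lambda>z. (\<Sum>n. a n * z ^ n) = f (z + t)) (nhds (s - t))"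
    proof -
      have "eventually (\<lambda>z. z \<in> ball 0 r) (nhds (s - t))"
        using s by (intro eventually_nhds_in_open) auto
      then show ?thesis
        by eventually_elim (use f in \<open>auto simp: sums_iff\<close>)
    qed
    ultimately have "((\<lambda>z. f (z + t)) has_real_derivative (\<Sum>n. diffs a n * (s - t) ^ n)) (at (s - t))"
      by (subst (asm) DERIV_cong_ev[OF refl _ refl])
    then have "(f has_real_derivative (\<Sum>n. diffs a n * (s - t) ^ n)) (at s)"
      using DERIV_shift[of f _ "s - t" t] by simp
    then show ?thesis using DERIV_imp_deriv by metis
  qed
  then show "\<bar>s - t\<bar> < r \<Longrightarrow> (f has_real_derivative deriv f s) (at s)" .
  have "(\<lambda>n. diffs a n * (s - t) ^ n) sums deriv f s" if s: "\<bar>s - t\<bar> < r" for s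
  proof (rule termdiffs_sums_strong[where f = "\<lambda>z. f (z + t)" and K = r])
    show "((\<lambda>z. f (z + t)) has_real_derivative deriv f s) (at (s - t))"
      using d[OF s] DERIV_shift[of f _ "s - t" t] by simp
  qed (use f s in auto)
  then show "power_series_at (deriv f) t r (diffs a)"
    using assms by (simp add: power_series_at_def)
qed

lemma funpow_diffs: "(diffs ^^ n) a k * fact k = fact (n + k) * (a (n + k) :: real)"
proof (induction n arbitrary: k)
  case (Suc n)
  have "(diffs ^^ Suc n) a k * fact k = (diffs ^^ n) a (Suc k) * fact (Suc k)"
    by (simp add: diffs_def algebra_simps)
  then show ?case using Suc[of "Suc k"] by simp
qed simp

lemma power_series_at_coeff:
  assumes "power_series_at f t r a"
  shows "(deriv ^^ n) f t = fact n * a n"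
proof -
  have "power_series_at ((deriv ^^ n) f) t r ((diffs ^^ n) a)"
    using assms by (induction n) (auto intro: power_series_at_deriv(2))
  then have "(\<lambda>k. (diffs ^^ n) a k * 0 ^ k) sums (deriv ^^ n) f t"
    unfolding power_series_at_def by (metis abs_zero diff_self)
  moreover have "(\<lambda>k. (diffs ^^ n) a k * 0 ^ k) sums ((diffs ^^ n) a 0)"
    by (rule powser_sums_zero)
  ultimately show ?thesis
    using sums_unique2 funpow_diffs[of n a 0] by fastforce
qed

lemma real_analytic_on_iff: "real_analytic_on UNIV f \<longleftrightarrow> (\<forall>t. \<exists>r a. power_series_at f t r a)"
  unfolding real_analytic_on_def power_series_at_def by blast

lemma real_analytic_higher_deriv:
  assumes "real_analytic_on UNIV f"
  shows "real_analytic_on UNIV ((deriv ^^ n) f)"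
proof (induction n)
  case (Suc n)
  then show ?case unfolding real_analytic_on_iff by (metis power_series_at_deriv(2) comp_apply funpow.simps(2))
qed (simp add: assms)

lemma real_analytic_imp_infinitely_differentiable:
  assumes "real_analytic_on UNIV f"
  shows "infinitely_differentiable f"
  unfolding infinitely_differentiable_def
proof (intro allI)
  fix n t
  obtain r a where p: "power_series_at ((deriv ^^ n) f) t r a"
    using real_analytic_higher_deriv[OF assms, of n] unfolding real_analytic_on_iff by blast
  then have "r > 0" by (simp add: power_series_at_def)
  then show "((deriv ^^ n) f has_real_derivative (deriv ^^ Suc n) f t) (at t)"
    using power_series_at_deriv(1)[OF p, of t] by simp
qed

text \<open>The points where all derivatives vanish form a set that is closed by continuity, open by
  the local power series, and contains \<open>t0\<close>; the line is connected.\<close>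

lemma real_analytic_identity:
  assumes f: "real_analytic_on UNIV f" and z: "\<And>n. (deriv ^^ n) f t0 = 0"
  shows "f t = 0"
proof -
  let ?S = "{t. \<forall>n. (deriv ^^ n) f t = 0}"
  have zero: "(deriv ^^ n) (\<lambda>_. 0 :: real) = (\<lambda>_. 0)" for n
    by (rule higher_deriv_eqI(1)) auto
  have "open ?S"
    unfolding open_dist
  proof (intro ballI)
    fix t assume t: "t \<in> ?S"
    obtain r a where p: "power_series_at f t r a"
      using f unfolding real_analytic_on_iff by blast
    have "a n = 0" for n using power_series_at_coeff[OF p, of n] t by simp
    then have "a = (\<lambda>_. 0)" by blast
    then have f0: "f s = 0" if "\<bar>s - t\<bar> < r" for s
      using p that sums_unique2[OF sums_zero, of "f s"] by (simp add: power_series_at_def)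
    have "s \<in> ?S" if s: "dist s t < r" for s
    proof -
      have "eventually (\<lambda>s. s \<in> ball t r) (nhds s)"
        using s by (intro eventually_nhds_in_open) (auto simp: dist_commute)
      then have "eventually (\<lambda>s. f s = 0) (nhds s)"
        by eventually_elim (use f0 in \<open>auto simp: dist_real_def\<close>)
      then have "(deriv ^^ n) f s = (deriv ^^ n) (\<lambda>_. 0) s" for n
        by (rule higher_deriv_cong_ev) simp
      then show ?thesis by (simp add: zero)
    qed
    then show "\<exists>e>0. \<forall>y. dist y t < e \<longrightarrow> y \<in> ?S"
      using p by (auto simp: power_series_at_def)
  qed
  moreover have "closed ?S"
  proof -
    have "isCont ((deriv ^^ n) f) t" for n t
      using infinitely_differentiableD[OF real_analytic_imp_infinitely_differentiable[OF f]] DERIV_isCont by blast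
    then have "closed {t. (deriv ^^ n) f t = 0}" for n
      by (intro closed_Collect_eq) (simp_all add: continuous_on_eq_continuous_at)
    then show ?thesis by (rule closed_Collect_all)
  qed
  moreover have "t0 \<in> ?S" using z by simp
  ultimately have "?S = UNIV" using clopen[of ?S] by blast
  then have "\<forall>n. (deriv ^^ n) f t = 0" by blast
  from this[rule_format, of 0] show ?thesis by simp
qed

section \<open>Functions that agree up to a polynomial\<close>

lemma funpow_pderiv_eq_0: "degree q < n \<Longrightarrow> (pderiv ^^ n) q = 0" for q :: "real poly"
proof (induction n arbitrary: q)
  case (Suc n)
  show ?case
  proof (cases "degree q = 0")
    case True
    then have "pderiv q = 0" by (simp add: pderiv_eq_0_iff)
    moreover have "(pderiv ^^ n) 0 = (0 :: real poly)" by (induction n) auto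
    ultimately show ?thesis by (simp add: funpow_Suc_right del: funpow.simps)
  next
    case False
    then show ?thesis
      using Suc by (simp add: funpow_Suc_right degree_pderiv del: funpow.simps)
  qed
qed simp

text \<open>\<open>q\<close> is the Taylor polynomial at 0; the Lagrange remainder contains the
  derivative of order \<open>Suc n\<close> and vanishes.\<close>

lemma zero_higher_deriv_imp_poly:
  assumes f: "infinitely_differentiable f" and z: "\<And>t. (deriv ^^ Suc n) f t = 0"
  shows "\<exists>q. degree q \<le> n \<and> f = poly q"
proof -
  define q where "q = (\<Sum>m<Suc n. monom ((deriv ^^ m) f 0 / fact m) m)"
  have "degree q \<le> n"
    unfolding q_def
  proof (rule degree_sum_le)
    show "degree (monom ((deriv ^^ m) f 0 / fact m) m) \<le> n" if "m \<in> {..<Suc n}" for m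
      by (rule order_trans[OF degree_monom_le]) (use that in simp)
  qed simp
  moreover have "f x = poly q x" for x
  proof -
    have "\<exists>t. \<bar>t\<bar> \<le> \<bar>x\<bar> \<and> f x = (\<Sum>m<Suc n. ((deriv ^^ m) f 0 / fact m) * x ^ m)
        + ((deriv ^^ Suc n) f t / fact (Suc n)) * x ^ Suc n"
      by (rule Maclaurin_all_le[where diff = "\<lambda>n. (deriv ^^ n) f"])
        (simp, intro allI infinitely_differentiableD[OF f])
    then have "f x = (\<Sum>m<Suc n. ((deriv ^^ m) f 0 / fact m) * x ^ m)"
      unfolding z by (simp only: div_0 mult_zero_left add_0_right) blast
    then show ?thesis
      by (simp only: q_def poly_sum poly_monom)
  qed
  ultimately show ?thesis by blast
qed

lemma higher_deriv_poly_plus_affine: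
  assumes f: "infinitely_differentiable f"
  shows "(deriv ^^ n) (\<lambda>t. poly q t + k * f (c * t + d)) =
      (\<lambda>t. poly ((pderiv ^^ n) q) t + k * c ^ n * (deriv ^^ n) f (c * t + d))"
    and "infinitely_differentiable (\<lambda>t. poly q t + k * f (c * t + d))"
proof -
  let ?G = "\<lambda>n t. poly ((pderiv ^^ n) q) t + k * c ^ n * (deriv ^^ n) f (c * t + d)"
  have 0: "?G 0 = (\<lambda>t. poly q t + k * f (c * t + d))" by simp
  have S: "(?G n has_real_derivative ?G (Suc n) t) (at t)" for n t
  proof -
    have "((\<lambda>t. (deriv ^^ n) f (c * t + d)) has_real_derivative (deriv ^^ Suc n) f (c * t + d) * c) (at t)"
      by (rule DERIV_chain2[OF infinitely_differentiableD[OF f]]) (auto intro!: derivative_eq_intros)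
    from DERIV_add[OF poly_DERIV[of "(pderiv ^^ n) q"] DERIV_cmult[OF this, of "k * c ^ n"]]
    show ?thesis by (simp add: algebra_simps)
  qed
  show "(deriv ^^ n) (\<lambda>t. poly q t + k * f (c * t + d)) = ?G n"
    and "infinitely_differentiable (\<lambda>t. poly q t + k * f (c * t + d))"
    by (rule higher_deriv_eqI[of ?G, OF 0 S])+
qed

lemma power_series_at_shift_scale:
  assumes "power_series_at f (c * t + d) r a"
  shows "\<exists>r'. power_series_at (\<lambda>t. f (c * t + d)) t r' (\<lambda>n. a n * c ^ n)"
proof -
  \<comment> \<open>The summand 1 keeps the quotient meaningful for \<open>c = 0\<close>.\<close>
  define r' where "r' = r / (\<bar>c\<bar> + 1)"
  have r: "r > 0" using assms by (simp add: power_series_at_def)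
  have "(\<lambda>n. a n * c ^ n * (s - t) ^ n) sums f (c * s + d)" if s: "\<bar>s - t\<bar> < r'" for s
  proof -
    have "\<bar>c * s + d - (c * t + d)\<bar> = \<bar>c\<bar> * \<bar>s - t\<bar>"
      by (simp add: abs_mult[symmetric] algebra_simps)
    also have "\<dots> \<le> (\<bar>c\<bar> + 1) * \<bar>s - t\<bar>" by (simp add: mult_right_mono)
    also have "\<dots> < (\<bar>c\<bar> + 1) * r'" using s by (intro mult_strict_left_mono) auto
    also have "\<dots> = r" by (simp add: r'_def add_nonneg_pos[THEN less_imp_neq, THEN not_sym])
    finally have "(\<lambda>n. a n * (c * s + d - (c * t + d)) ^ n) sums f (c * s + d)"
      using assms unfolding power_series_at_def by blast
    moreover have "c * s + d - (c * t + d) = c * (s - t)" by (simp add: algebra_simps)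
    ultimately show ?thesis by (simp add: power_mult_distrib mult.assoc)
  qed
  then have "power_series_at (\<lambda>t. f (c * t + d)) t r' (\<lambda>n. a n * c ^ n)"
    using r by (simp add: power_series_at_def r'_def divide_pos_pos add_nonneg_pos)
  then show ?thesis by blast
qed

lemma real_analytic_on_affine:
  assumes "real_analytic_on UNIV f"
  shows "real_analytic_on UNIV (\<lambda>t. f (c * t + d))"
  unfolding real_analytic_on_iff
proof
  fix t
  obtain r a where "power_series_at f (c * t + d) r a"
    using assms unfolding real_analytic_on_iff by blast
  from power_series_at_shift_scale[OF this]
  show "\<exists>r a. power_series_at (\<lambda>t. f (c * t + d)) t r a" by blast
qed

lemma real_analytic_on_lincomb:
  assumes "real_analytic_on UNIV f" "real_analytic_on UNIV g"
  shows "real_analytic_on UNIV (\<lambda>t. k * f t + l * g t)"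
  unfolding real_analytic_on_iff
proof
  fix t
  obtain r a where f: "power_series_at f t r a" using assms(1) unfolding real_analytic_on_iff by blast
  obtain r' b where g: "power_series_at g t r' b" using assms(2) unfolding real_analytic_on_iff by blast
  have "(\<lambda>n. (k * a n + l * b n) * (s - t) ^ n) sums (k * f s + l * g s)" if "\<bar>s - t\<bar> < min r r'" for s
    using sums_add[OF sums_mult[of "\<lambda>n. a n * (s - t) ^ n" "f s" k] sums_mult[of "\<lambda>n. b n * (s - t) ^ n" "g s" l]]
      f g that by (simp add: power_series_at_def algebra_simps)
  then have "power_series_at (\<lambda>t. k * f t + l * g t) t (min r r') (\<lambda>n. k * a n + l * b n)"
    using f g by (simp add: power_series_at_def)
  then show "\<exists>r a. power_series_at (\<lambda>t. k * f t + l * g t) t r a" by blast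
qed

text \<open>All derivatives of the difference from order \<open>Suc N\<close> on vanish at
  \<open>t0\<close>; by the identity theorem its derivative of that order is 0 everywhere.\<close>

lemma analytic_eq_up_to_poly:
  assumes f: "real_analytic_on UNIV f" and g: "real_analytic_on UNIV g"
    and eq: "\<And>n. n > N \<Longrightarrow> c ^ n * (deriv ^^ n) g (c * t0 + d) = s * (deriv ^^ n) f t0"
  shows "\<exists>q. degree q \<le> N \<and> (\<forall>t. g (c * t + d) = s * f t + poly q t)"
proof -
  define h where "h t = 1 * g (c * t + d) + (- s) * f t" for t
  have h: "real_analytic_on UNIV h"
    unfolding h_def[abs_def] by (intro real_analytic_on_lincomb real_analytic_on_affine f g)
  let ?G = "\<lambda>n t. c ^ n * (deriv ^^ n) g (c * t + d) - s * (deriv ^^ n) f t"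
  have id: "infinitely_differentiable f" "infinitely_differentiable g"
    using f g real_analytic_imp_infinitely_differentiable by blast+
  have S: "(?G n has_real_derivative ?G (Suc n) t) (at t)" for n t
  proof -
    have "((\<lambda>t. (deriv ^^ n) g (c * t + d)) has_real_derivative (deriv ^^ Suc n) g (c * t + d) * c) (at t)"
      by (rule DERIV_chain2[OF infinitely_differentiableD[OF id(2)]]) (auto intro!: derivative_eq_intros)
    from DERIV_diff[OF DERIV_cmult[OF this, of "c ^ n"] DERIV_cmult[OF infinitely_differentiableD[OF id(1), of n t], of s]]
    show ?thesis by (simp add: algebra_simps)
  qed
  have G: "(deriv ^^ n) h = ?G n" "infinitely_differentiable h" for n
    by (rule higher_deriv_eqI[of ?G, OF _ S], simp add: h_def fun_eq_iff)+
  have "(deriv ^^ n) ((deriv ^^ Suc N) h) t0 = 0" for n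
    using G(1)[of "n + Suc N"] eq[of "n + Suc N"] by (simp only: funpow_add o_apply)
  then have "(deriv ^^ Suc N) h t = 0" for t
    by (rule real_analytic_identity[OF real_analytic_higher_deriv[OF h]])
  from zero_higher_deriv_imp_poly[OF G(2) this] obtain q where "degree q \<le> N" "h = poly q" by blast
  then show ?thesis by (intro exI[of _ q]) (simp add: h_def fun_eq_iff algebra_simps)
qed

section \<open>Affine equivalence determines the invariants\<close>

lemma smooth_on_f_psi:
  assumes "infinitely_differentiable \<psi>"
  shows "smooth_on UNIV (f_psi \<psi> :: real^('p::finite zindex) \<Rightarrow> real)"
proof -
  have c: "smooth_on UNIV (\<lambda>z :: real^'p zindex. z $ i)" for i
    by (rule smooth_on_bounded_linear[OF bounded_linear_vec_nth])
  have "smooth_on UNIV (\<lambda>z :: real^'p zindex. \<psi> (z $ zi 0))"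
    by (rule smooth_on_compose[OF open_UNIV open_UNIV _ c smooth_on_infinitely_differentiable[OF assms]]) simp
  then show ?thesis
    unfolding f_psi_def[abs_def]
    by (intro smooth_on_add[OF open_UNIV] smooth_on_sum[OF open_UNIV] smooth_on_mult[OF open_UNIV]
        smooth_on_power[OF open_UNIV] c)
qed

text \<open>On a line, every term apart from \<psi> is a product of affine functions of
  \<open>t\<close>, at most \<open>CARD('p) + 2\<close> of them in the summands with power
  \<open>i + 1\<close>. Derivatives of order \<open>CARD('p) + 3\<close> and higher therefore see
  \<psi> alone.\<close>

lemma f_psi_on_line:
  fixes z v zt w :: "real^('p::finite zindex)"
  shows "\<exists>q. degree q \<le> CARD('p) + 2 \<and>
    (\<forall>t. f_psi \<psi> (z + t *\<^sub>R v) + (z + t *\<^sub>R v) \<bullet> (zt + t *\<^sub>R w) = poly q t + \<psi> (v $ zi 0 * t + z $ zi 0))"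
proof -
  define L where "L a b = [:a, b:]" for a b :: real
  define q where "q = (\<Sum>i = 1..CARD('p). L (z $ zi i) (v $ zi i) * L (z $ zi 0) (v $ zi 0) ^ (i + 1))
      + (\<Sum>i\<in>UNIV. L (z $ i) (v $ i) * L (zt $ i) (w $ i))"
  have L1: "degree (L a b) \<le> 1" for a b by (simp add: L_def)
  have Lp: "degree (L a b ^ k) \<le> k" for a b k
    using degree_power_le[of "L a b" k] L1[of a b] by (metis mult_le_mono1 nat_mult_1 order_trans)
  have "degree q \<le> CARD('p) + 2"
    unfolding q_def
  proof (intro degree_add_le degree_sum_le)
    show "degree (L (z $ zi i) (v $ zi i) * L (z $ zi 0) (v $ zi 0) ^ (i + 1)) \<le> CARD('p) + 2"
      if "i \<in> {1..CARD('p)}" for i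
      using degree_mult_le[of "L (z $ zi i) (v $ zi i)" "L (z $ zi 0) (v $ zi 0) ^ (i + 1)"]
        L1[of "z $ zi i" "v $ zi i"] Lp[of "z $ zi 0" "v $ zi 0" "i + 1"] that by simp
    show "degree (L (z $ i) (v $ i) * L (zt $ i) (w $ i)) \<le> CARD('p) + 2" for i
      using degree_mult_le[of "L (z $ i) (v $ i)" "L (zt $ i) (w $ i)"] L1[of "z $ i" "v $ i"] L1[of "zt $ i" "w $ i"]
      by simp
  qed simp_all
  moreover have "f_psi \<psi> (z + t *\<^sub>R v) + (z + t *\<^sub>R v) \<bullet> (zt + t *\<^sub>R w) = poly q t + \<psi> (v $ zi 0 * t + z $ zi 0)" for t
    by (simp add: q_def L_def f_psi_def poly_sum inner_vec_def algebra_simps)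
  ultimately show ?thesis by blast
qed

text \<open>With \<open>D1 n = r * l ^ n * D2 n\<close>, numerator and denominator both acquire the
  factor \<open>r ^ k * l ^ ((N + 1) * k)\<close>, because (k + N) + N (k - 1) = (N + 1) k.\<close>

lemma alpha_ratio:
  fixes D1 D2 :: "nat \<Rightarrow> real"
  assumes rel: "\<And>n. n \<ge> N \<Longrightarrow> a * l ^ n * D2 n = b * D1 n" and b: "b \<noteq> 0" and D: "D1 N \<noteq> 0" and k: "k \<ge> 1" and N: "N > 0"
  shows "D1 (k + N) * D1 N ^ (k - 1) / D1 (N + 1) ^ k = D2 (k + N) * D2 N ^ (k - 1) / D2 (N + 1) ^ k"
proof -
  have "a * l ^ N * D2 N \<noteq> 0" using rel[of N] b D by simp
  then have al: "a \<noteq> 0" "l ^ N \<noteq> 0" by (metis mult_zero_left mult_zero_right)+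
  have l: "l \<noteq> 0"
  proof
    assume "l = 0"
    with al(2) N show False by (simp add: power_0_left)
  qed
  obtain m where m: "k = Suc m" using k by (cases k) auto
  define r where "r = a / b"
  have D1: "D1 n = r * l ^ n * D2 n" if "n \<ge> N" for n
    using rel[OF that] b by (simp add: r_def field_simps)
  have r: "r \<noteq> 0" using al b by (simp add: r_def)
  have "D1 (k + N) * D1 N ^ (k - 1) = (r ^ k * l ^ ((N + 1) * k)) * (D2 (k + N) * D2 N ^ (k - 1))"
    by (simp add: D1 m power_mult_distrib power_add power_mult[symmetric] algebra_simps)
  moreover have "D1 (N + 1) ^ k = (r ^ k * l ^ ((N + 1) * k)) * D2 (N + 1) ^ k"
    by (simp add: D1 power_mult_distrib power_mult[symmetric] power_add algebra_simps)
  ultimately show ?thesis using r l by simp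
qed

context affine_pair
begin

lemma segment_in_U:
  assumes "P \<in> U"
  obtains e where "e > 0" "\<And>t. \<bar>t\<bar> < e \<Longrightarrow> P + t *\<^sub>R v \<in> U"
proof -
  obtain d where d: "d > 0" "ball P d \<subseteq> U" using openU assms openE by blast
  show ?thesis
  proof (rule that)
    show "d / (norm v + 1) > 0" using d by (simp add: add_nonneg_pos)
    fix t assume t: "\<bar>t\<bar> < d / (norm v + 1)"
    have n: "norm v + 1 > 0" by (simp add: add_nonneg_pos)
    have "\<bar>t\<bar> * norm v \<le> \<bar>t\<bar> * (norm v + 1)" by (simp add: mult_left_mono)
    also have "\<dots> < d" using t n by (simp add: pos_less_divide_eq)
    finally have "dist P (P + t *\<^sub>R v) < d" by (simp add: dist_norm)
    then show "P + t *\<^sub>R v \<in> U" using d by auto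
  qed
qed

end

section \<open>Restriction to a line in the direction of the first z-coordinate\<close>

lemma constant_on_interval:
  fixes h :: "real \<Rightarrow> real"
  assumes "\<And>t. \<bar>t\<bar> < e \<Longrightarrow> (h has_real_derivative 0) (at t)" "\<bar>t\<bar> < e"
  shows "h t = h 0"
proof -
  have "\<exists>c. \<forall>t\<in>ball 0 e. h t = c"
  proof (rule has_field_derivative_zero_constant)
    show "(h has_field_derivative 0) (at t within ball 0 e)" if "t \<in> ball 0 e" for t
      by (rule has_field_derivative_at_within[OF assms(1)]) (use that in simp)
  qed simp
  then obtain c where "\<And>t. t \<in> ball 0 e \<Longrightarrow> h t = c" by blast
  from this[of t] this[of 0] show ?thesis using assms(2) by simp
qed

lemma second_deriv_on_interval:
  assumes g: "\<And>t. \<bar>t\<bar> < e \<Longrightarrow> g t = G t"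
    and G: "\<And>t. \<bar>t\<bar> < e \<Longrightarrow> (G has_real_derivative G' t) (at t)"
    and G': "\<And>t. \<bar>t\<bar> < e \<Longrightarrow> (G' has_real_derivative G'' t) (at t)"
    and t: "\<bar>t\<bar> < e"
  shows "(deriv ^^ 2) g t = G'' t"
proof -
  have ev: "eventually (\<lambda>s. \<bar>s\<bar> < e) (nhds s)" if "\<bar>s\<bar> < e" for s
  proof -
    have "eventually (\<lambda>s. s \<in> ball 0 e) (nhds s)"
      using that by (intro eventually_nhds_in_open) auto
    then show ?thesis by eventually_elim simp
  qed
  have 1: "deriv g s = G' s" if "\<bar>s\<bar> < e" for s
  proof -
    have "eventually (\<lambda>s. g s = G s) (nhds s)"
      using ev[OF that] by eventually_elim (rule g)
    then have "deriv g s = deriv G s" by (rule deriv_cong_ev) simp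
    then show ?thesis using DERIV_imp_deriv[OF G[OF that]] by simp
  qed
  have "eventually (\<lambda>s. deriv g s = G' s) (nhds t)"
    using ev[OF t] by eventually_elim (rule 1)
  then have "deriv (deriv g) t = deriv G' t" by (rule deriv_cong_ev) simp
  then show ?thesis using DERIV_imp_deriv[OF G'[OF t]] by (simp add: numeral_2_eq_2)
qed

text \<open>The Hessian relation is restricted to a segment through \<open>P\<close> and
  differentiated \<open>n - 2\<close> more times at 0, where the polynomial parts have disappeared.
  That \<open>l\<close> is nonzero is left to \<open>alpha_ratio\<close>.\<close>

lemma affine_imp_derivative_relation:
  fixes P :: "real^('p::finite zindex coord)"
  assumes ap: "affine_pair (f_psi \<psi>1) (f_psi \<psi>2) U V \<phi> \<phi>'"
    and \<psi>: "infinitely_differentiable \<psi>1" "infinitely_differentiable \<psi>2" and P: "P \<in> U"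
  shows "\<exists>a b l. b \<noteq> 0 \<and> (\<forall>n\<ge>CARD('p) + 3.
    a * l ^ n * (deriv ^^ n) \<psi>2 (\<phi> P $ Cz (zi 0)) = b * (deriv ^^ n) \<psi>1 (P $ Cz (zi 0)))"
proof -
  interpret affine_pair "f_psi \<psi>1" "f_psi \<psi>2" U V \<phi> \<phi>' by (rule ap)
  define x where "x = (mk 1 0 0 0 0 0 :: real^('p zindex coord))"
  define xs where "xs = (mk 0 0 0 1 0 0 :: real^('p zindex coord))"
  define y where "y = (mk 0 (axis (zi 0) 1) 0 0 0 0 :: real^('p zindex coord))"
  note H = hessian_relation(1)[folded xs_def]
    hessian_relation(2,3)[where i = "zi 0", folded x_def xs_def y_def]
  obtain e where e: "e > 0" and L: "\<And>t. \<bar>t\<bar> < e \<Longrightarrow> P + t *\<^sub>R y \<in> U"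
    using segment_in_U[OF P] by blast
  let ?L = "\<lambda>t. P + t *\<^sub>R y"
  have line: "((\<lambda>t. h (?L t)) has_real_derivative dd y h (?L t)) (at t)"
    if "smooth_on U h" "\<bar>t\<bar> < e" for h t
    by (rule line_has_real_derivative[OF smooth_on_imp_differentiable[OF that(1) L[OF that(2)]]])
  have const: "h (?L t) = h P" if h: "smooth_on U h" "\<And>Q. Q \<in> U \<Longrightarrow> dd y h Q = 0" and t: "\<bar>t\<bar> < e" for h :: "_ \<Rightarrow> real" and t
  proof -
    have "((\<lambda>t. h (?L t)) has_real_derivative 0) (at t)" if "\<bar>t\<bar> < e" for t
      using line[OF h(1) that] h(2)[OF L[OF that]] by simp
    from constant_on_interval[of e, OF this t] show ?thesis by simp
  qed
  define a where "a = dd x (cpt Cx) P"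
  define b where "b = dd xs (cpt Cxs) P"
  \<comment> \<open>The two factors in the Hessian relation are constant on the segment, since their
    derivatives along \<open>y\<close> vanish.\<close>
  have a: "dd x (cpt Cx) (?L t) = a" if "\<bar>t\<bar> < e" for t
    unfolding a_def by (rule const[OF smooth_on_dd[OF smooth_cpt] unstarred(2) that]) simp
  have b: "dd xs (cpt Cxs) (?L t) = b" if "\<bar>t\<bar> < e" for t
    unfolding b_def by (rule const[OF smooth_on_dd[OF smooth_cpt] H(2) that])
  have lin: "\<phi> (?L t) $ c = \<phi> P $ c + t * dd y \<phi> P $ c"
    if c: "c = Cx \<or> c \<in> range Cz \<or> c \<in> range Czt" and t: "\<bar>t\<bar> < e" for t c
  proof -
    have d: "dd y (cpt c) (?L t) = dd y (cpt c) P" if "\<bar>t\<bar> < e" for t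
      by (rule const[OF smooth_on_dd[OF smooth_cpt] unstarred(2)[OF c] that])
    have "((\<lambda>t. cpt c (?L t) - t * dd y (cpt c) P) has_real_derivative 0) (at t)" if "\<bar>t\<bar> < e" for t
      using line[OF smooth_cpt that, of c] d[OF that] by (auto intro!: derivative_eq_intros)
    from constant_on_interval[of e, OF this t] show ?thesis
      by (simp add: cpt_def[abs_def] dd_cpt[OF P, unfolded cpt_def[abs_def]])
  qed
  define l where "l = dd y \<phi> P $ Cz (zi 0)"
  obtain q2 where q2: "degree q2 \<le> CARD('p) + 2"
    and pot2': "\<And>t. f_psi \<psi>2 (zc (\<phi> P) + t *\<^sub>R zc (dd y \<phi> P)) + (zc (\<phi> P) + t *\<^sub>R zc (dd y \<phi> P)) \<bullet> (ztc (\<phi> P) + t *\<^sub>R ztc (dd y \<phi> P))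
      = poly q2 t + \<psi>2 (zc (dd y \<phi> P) $ zi 0 * t + zc (\<phi> P) $ zi 0)"
    using f_psi_on_line[where \<psi> = \<psi>2 and z = "zc (\<phi> P)" and v = "zc (dd y \<phi> P)" and zt = "ztc (\<phi> P)"
        and w = "ztc (dd y \<phi> P)"] by blast
  obtain q1 where q1: "degree q1 \<le> CARD('p) + 2"
    and pot1': "\<And>t. f_psi \<psi>1 (zc P + t *\<^sub>R zc y) + (zc P + t *\<^sub>R zc y) \<bullet> (ztc P + t *\<^sub>R ztc y)
      = poly q1 t + \<psi>1 (zc y $ zi 0 * t + zc P $ zi 0)"
    using f_psi_on_line[where \<psi> = \<psi>1 and z = "zc P" and v = "zc y" and zt = "ztc P" and w = "ztc y"] by blast
  \<comment> \<open>The factors 1 give both functions the shape treated by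
    \<open>higher_deriv_poly_plus_affine\<close>.\<close>
  define g1 where "g1 t = poly q1 t + 1 * \<psi>1 (1 * t + P $ Cz (zi 0))" for t
  define g2 where "g2 t = poly q2 t + 1 * \<psi>2 (l * t + \<phi> P $ Cz (zi 0))" for t
  have pot1: "g1 t = pot (f_psi \<psi>1) (?L t)" for t
    using pot1'[of t] by (simp add: pot_def g1_def y_def)
  have pot2: "g2 t = pot (f_psi \<psi>2) (\<phi> (?L t))" if "\<bar>t\<bar> < e" for t
  proof -
    have "zc (\<phi> (?L t)) = zc (\<phi> P) + t *\<^sub>R zc (dd y \<phi> P)" "ztc (\<phi> (?L t)) = ztc (\<phi> P) + t *\<^sub>R ztc (dd y \<phi> P)"
      using that by (simp_all add: vec_eq_iff lin)
    then show ?thesis using pot2'[of t] by (simp add: pot_def g2_def l_def)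
  qed
  have s2: "smooth_on U (\<lambda>Q. pot (f_psi \<psi>2) (\<phi> Q))"
    by (rule smooth_on_compose[OF openU open_UNIV _ smooth\<phi> smooth_on_pot[OF f2 open_UNIV]]) simp
  have s1: "smooth_on U (pot (f_psi \<psi>1))" by (rule smooth_on_pot[OF f1 openU])
  have eq2: "a * (deriv ^^ 2) g2 t = b * (deriv ^^ 2) g1 t" if t: "\<bar>t\<bar> < e" for t
  proof -
    have "(deriv ^^ 2) g1 t = dd y (dd y (pot (f_psi \<psi>1))) (?L t)"
      by (rule second_deriv_on_interval[OF pot1 line[OF s1] line[OF smooth_on_dd[OF s1]] t])
    moreover have "(deriv ^^ 2) g2 t = dd y (dd y (\<lambda>Q. pot (f_psi \<psi>2) (\<phi> Q))) (?L t)"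
      by (rule second_deriv_on_interval[OF pot2 line[OF s2] line[OF smooth_on_dd[OF s2]] t])
    ultimately show ?thesis using H(3)[OF L[OF t]] a[OF t] b[OF t] by simp
  qed
  have "a * l ^ n * (deriv ^^ n) \<psi>2 (\<phi> P $ Cz (zi 0)) = b * (deriv ^^ n) \<psi>1 (P $ Cz (zi 0))"
    if n: "n \<ge> CARD('p) + 3" for n
  proof -
    \<comment> \<open>Two derivatives are already spent in the Hessian relation.\<close>
    define m where "m = n - 2"
    have m: "n = m + 2" using n by (simp add: m_def)
    have scale: "(deriv ^^ m) (\<lambda>t. c * (deriv ^^ 2) g t) = (\<lambda>t. c * (deriv ^^ n) g t)"
      if "infinitely_differentiable g" for c g
    proof -
      have "(deriv ^^ m) (\<lambda>t. c * (deriv ^^ 2) g t) = (\<lambda>t. c * (deriv ^^ (m + 2)) g t)"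
      proof (rule higher_deriv_eqI(1)[of "\<lambda>m t. c * (deriv ^^ (m + 2)) g t"])
        show "((\<lambda>t. c * (deriv ^^ (k + 2)) g t) has_real_derivative c * (deriv ^^ (Suc k + 2)) g t) (at t)" for k t
          using DERIV_cmult[OF infinitely_differentiableD[OF that], of c "k + 2" t] by (simp only: add_Suc)
      qed (simp only: add_0)
      then show ?thesis by (simp only: m)
    qed
    have g: "infinitely_differentiable g1" "infinitely_differentiable g2"
      unfolding g1_def[abs_def] g2_def[abs_def] by (intro higher_deriv_poly_plus_affine(2) \<psi>)+
    have "eventually (\<lambda>t. t \<in> ball 0 e) (nhds (0 :: real))"
      using e by (intro eventually_nhds_in_open) auto
    then have "eventually (\<lambda>t. a * (deriv ^^ 2) g2 t = b * (deriv ^^ 2) g1 t) (nhds 0)"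
      by eventually_elim (rule eq2, simp)
    then have "(deriv ^^ m) (\<lambda>t. a * (deriv ^^ 2) g2 t) 0 = (deriv ^^ m) (\<lambda>t. b * (deriv ^^ 2) g1 t) 0"
      by (rule higher_deriv_cong_ev) simp
    then have "a * (deriv ^^ n) g2 0 = b * (deriv ^^ n) g1 0"
      by (simp only: scale[OF g(1)] scale[OF g(2)])
    moreover have "(deriv ^^ n) g1 0 = (deriv ^^ n) \<psi>1 (P $ Cz (zi 0))"
      unfolding g1_def[abs_def] higher_deriv_poly_plus_affine(1)[OF \<psi>(1)]
      using q1 n by (simp add: funpow_pderiv_eq_0)
    moreover have "(deriv ^^ n) g2 0 = l ^ n * (deriv ^^ n) \<psi>2 (\<phi> P $ Cz (zi 0))"
      unfolding g2_def[abs_def] higher_deriv_poly_plus_affine(1)[OF \<psi>(2)]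
      using q2 n by (simp add: funpow_pderiv_eq_0)
    ultimately show ?thesis by simp
  qed
  moreover have "b \<noteq> 0" using H(1)[OF P] by (simp add: b_def)
  ultimately show ?thesis by blast
qed

section \<open>Construction of isometries\<close>

lemma has_derivative_mk:
  assumes "(x has_derivative x') (at Q within S)" "(z has_derivative z') (at Q within S)"
    "(zt has_derivative zt') (at Q within S)" "(xs has_derivative xs') (at Q within S)"
    "(zs has_derivative zs') (at Q within S)" "(zts has_derivative zts') (at Q within S)"
  shows "((\<lambda>P. mk (x P) (z P) (zt P) (xs P) (zs P) (zts P) :: real^('p::finite zindex coord)) has_derivative
    (\<lambda>v. mk (x' v) (z' v) (zt' v) (xs' v) (zs' v) (zts' v))) (at Q within S)"
proof -
  have "bounded_linear (\<lambda>(x, z, zt, xs, zs, zts). mk x z zt xs zs zts :: real^('p zindex coord))"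
    by (rule linear_conv_bounded_linear[THEN iffD1], rule linearI) (auto simp: coords_eq_iff)
  from bounded_linear.has_derivative[OF this has_derivative_Pair[OF assms(1) has_derivative_Pair[OF assms(2)
        has_derivative_Pair[OF assms(3) has_derivative_Pair[OF assms(4) has_derivative_Pair[OF assms(5,6)]]]]]]
  show ?thesis by simp
qed

text \<open>On z tilde the map is \<open>Bt\<close> applied to \<open>s\<close> times z tilde minus
  \<open>Q\<close> of z; paired with \<open>A z\<close> this gives the bilinear term times
  \<open>s\<close> and cancels the quadratic one. The potential is then multiplied by
  \<open>s\<close>, which rescaling x undoes, up to an affine function \<open>lf\<close>, which the
  starred coordinates absorb.\<close>

lemma isometry_M_metric:
  fixes f f' :: "real^('p::finite zindex) \<Rightarrow> real" and P1 P2 :: "real^('p zindex coord)"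
  assumes A: "linear A" and B: "linear B" and AB: "\<And>z. A (B z) = z" "\<And>z. B (A z) = z"
    and Q: "linear Q" and s: "s > 0"
    and f': "\<And>z. f' (A z + b) = s * f z + z \<bullet> Q z + \<beta> \<bullet> z + \<gamma>"
    and z12: "A (zc P1) + b = zc P2"
  shows "\<exists>\<phi>. isometry (M_metric f) (M_metric f') \<phi> \<and> \<phi> P1 = P2"
proof -
  define At Bt Qt where "At = adjoint A" and "Bt = adjoint B" and "Qt = adjoint Q"
  have lin: "linear At" "linear Bt" "linear Qt"
    using A B Q by (simp_all add: At_def Bt_def Qt_def adjoint_linear)
  have inn: "A u \<bullet> w = u \<bullet> At w" "B u \<bullet> w = u \<bullet> Bt w" "Q u \<bullet> w = u \<bullet> Qt w" for u w
    using adjoint_works[OF A] adjoint_works[OF B] adjoint_works[OF Q] by (simp_all add: At_def Bt_def Qt_def inner_commute)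
  have AtBt: "At (Bt w) = w" "Bt (At w) = w" for w
    by (rule vector_eq_ldot[THEN iffD1], simp add: inn[symmetric] AB)+
  have bl: "bounded_linear A" "bounded_linear B" "bounded_linear Q" "bounded_linear At" "bounded_linear Bt" "bounded_linear Qt"
    using A B Q lin by (simp_all add: linear_conv_bounded_linear)
  \<comment> \<open>The square of \<open>a\<close> appears with the potential and cancels the factor
    \<open>s\<close>.\<close>
  define a where "a = 1 / sqrt s"
  have a: "a \<noteq> 0" "a * a = 1 / s" using s by (simp_all add: a_def)
  \<comment> \<open>Makes the z tilde part of the image of \<open>P1\<close> equal to that of
    \<open>P2\<close>.\<close>
  define \<tau> where "\<tau> = ztc P2 - Bt (s *\<^sub>R ztc P1 - Q (zc P1))"
  \<comment> \<open>\<open>ez\<close>, \<open>et\<close> and \<open>e0\<close> are the coefficients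
    of what remains of the potential after division by \<open>s\<close>.\<close>
  define ez where "ez = (1 / s) *\<^sub>R (\<beta> - Qt (B b) + At \<tau>)"
  define et where "et = B b"
  define e0 where "e0 = (\<gamma> + b \<bullet> \<tau>) / s"
  define lf where "lf P = ez \<bullet> zc P + et \<bullet> ztc P + e0" for P :: "real^('p zindex coord)"
  \<comment> \<open>Adding x times \<open>lf\<close> to the starred x-coordinate cancels -2
    \<open>lf\<close> in the metric but creates cross terms of x with z and z tilde; the quadratic
    shifts in \<open>hz\<close> and \<open>ht\<close> remove these.\<close>
  define hz where "hz P = zsc P - ((P $ Cx)\<^sup>2 / 2) *\<^sub>R ez" for P :: "real^('p zindex coord)"
  define ht where "ht P = ztsc P - ((P $ Cx)\<^sup>2 / 2) *\<^sub>R et" for P :: "real^('p zindex coord)"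
  define xs0 where "xs0 P = (P $ Cxs + P $ Cx * lf P) / a" for P :: "real^('p zindex coord)"
  define zs0 where "zs0 P = Bt (hz P + (1 / s) *\<^sub>R Qt (ht P))" for P :: "real^('p zindex coord)"
  define zts0 where "zts0 P = (1 / s) *\<^sub>R A (ht P)" for P :: "real^('p zindex coord)"
  define \<phi> where "\<phi> P = mk (a * P $ Cx + (P2 $ Cx - a * P1 $ Cx)) (A (zc P) + b)
    (Bt (s *\<^sub>R ztc P - Q (zc P)) + \<tau>) (xs0 P + (P2 $ Cxs - xs0 P1))
    (zs0 P + (zsc P2 - zs0 P1)) (zts0 P + (ztsc P2 - zts0 P1))" for P
  have \<phi>P1: "\<phi> P1 = P2"
    by (simp add: \<phi>_def coords_eq_iff z12 \<tau>_def)
  have pot': "pot f' (\<phi> P) = s * (pot f P + lf P)" for P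
  proof -
    have "pot f' (\<phi> P) = s * f (zc P) + zc P \<bullet> Q (zc P) + \<beta> \<bullet> zc P + \<gamma>
        + (A (zc P) + b) \<bullet> (Bt (s *\<^sub>R ztc P - Q (zc P)) + \<tau>)"
      by (simp add: pot_def \<phi>_def f')
    also have "(A (zc P) + b) \<bullet> (Bt (s *\<^sub>R ztc P - Q (zc P)) + \<tau>) =
        zc P \<bullet> (s *\<^sub>R ztc P - Q (zc P)) + zc P \<bullet> At \<tau> + B b \<bullet> (s *\<^sub>R ztc P - Q (zc P)) + b \<bullet> \<tau>"
      by (simp add: inner_add_left inner_add_right inn AtBt)
    also have "B b \<bullet> (s *\<^sub>R ztc P - Q (zc P)) = s * (et \<bullet> ztc P) - Qt (B b) \<bullet> zc P"
      by (simp add: inner_diff_right et_def inner_commute[of "B b" "Q _"] inn(3)) (simp add: inner_commute)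
    finally have "pot f' (\<phi> P) = s * f (zc P) + s * (zc P \<bullet> ztc P)
        + ((\<beta> - Qt (B b) + At \<tau>) \<bullet> zc P + s * (et \<bullet> ztc P) + (\<gamma> + b \<bullet> \<tau>))"
      by (simp add: inner_add_left inner_diff_left inner_add_right inner_diff_right inner_commute)
    also have "(\<beta> - Qt (B b) + At \<tau>) \<bullet> zc P + s * (et \<bullet> ztc P) + (\<gamma> + b \<bullet> \<tau>) = s * lf P"
    proof -
      have "s * (ez \<bullet> zc P) = (\<beta> - Qt (B b) + At \<tau>) \<bullet> zc P" "s * e0 = \<gamma> + b \<bullet> \<tau>"
        using s by (simp_all add: ez_def e0_def)
      then show ?thesis by (simp add: lf_def distrib_left)
    qed
    finally show ?thesis by (simp add: pot_def distrib_left)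
  qed
  define d\<phi> where "d\<phi> P v = mk (a * v $ Cx) (A (zc v)) (Bt (s *\<^sub>R ztc v - Q (zc v)))
      ((v $ Cxs + (P $ Cx * (ez \<bullet> zc v + et \<bullet> ztc v) + v $ Cx * lf P)) / a)
      (Bt ((zsc v - (P $ Cx * v $ Cx) *\<^sub>R ez) + (1 / s) *\<^sub>R Qt (ztsc v - (P $ Cx * v $ Cx) *\<^sub>R et)))
      ((1 / s) *\<^sub>R A (ztsc v - (P $ Cx * v $ Cx) *\<^sub>R et))" for P v
  have der: "(\<phi> has_derivative d\<phi> P) (at P)" for P
  proof -
    have c: "((\<lambda>P. P $ i) has_derivative (\<lambda>v. v $ i)) (at P)" for i
      by (rule bounded_linear_imp_has_derivative[OF bounded_linear_vec_nth])
    have zz: "(zc has_derivative zc) (at P)" "(ztc has_derivative ztc) (at P)"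
      "(zsc has_derivative zsc) (at P)" "(ztsc has_derivative ztsc) (at P)"
      by (simp_all add: bounded_linear_imp_has_derivative)
    have l: "(lf has_derivative (\<lambda>v. ez \<bullet> zc v + et \<bullet> ztc v)) (at P)"
      unfolding lf_def[abs_def] by (auto intro!: derivative_eq_intros zz)
    have h: "(hz has_derivative (\<lambda>v. zsc v - (P $ Cx * v $ Cx) *\<^sub>R ez)) (at P)"
      "(ht has_derivative (\<lambda>v. ztsc v - (P $ Cx * v $ Cx) *\<^sub>R et)) (at P)"
      unfolding hz_def[abs_def] ht_def[abs_def] by (auto intro!: derivative_eq_intros zz c)
    have 1: "(xs0 has_derivative (\<lambda>v. (v $ Cxs + (P $ Cx * (ez \<bullet> zc v + et \<bullet> ztc v) + v $ Cx * lf P)) / a)) (at P)"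
      unfolding xs0_def[abs_def]
      by (rule bounded_linear.has_derivative[OF bounded_linear_divide has_derivative_add[OF c has_derivative_mult[OF c l]]])
    have 2: "(zs0 has_derivative (\<lambda>v. Bt ((zsc v - (P $ Cx * v $ Cx) *\<^sub>R ez) + (1 / s) *\<^sub>R Qt (ztsc v - (P $ Cx * v $ Cx) *\<^sub>R et)))) (at P)"
      unfolding zs0_def[abs_def]
      by (rule bounded_linear.has_derivative[OF bl(5) has_derivative_add[OF h(1)
            has_derivative_scaleR_right[OF bounded_linear.has_derivative[OF bl(6) h(2)]]]])
    have 3: "(zts0 has_derivative (\<lambda>v. (1 / s) *\<^sub>R A (ztsc v - (P $ Cx * v $ Cx) *\<^sub>R et))) (at P)"
      unfolding zts0_def[abs_def]
      by (rule has_derivative_scaleR_right[OF bounded_linear.has_derivative[OF bl(1) h(2)]])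
    have 4: "((\<lambda>P. Bt (s *\<^sub>R ztc P - Q (zc P))) has_derivative (\<lambda>v. Bt (s *\<^sub>R ztc v - Q (zc v)))) (at P)"
      by (rule bounded_linear.has_derivative[OF bl(5) has_derivative_diff[OF has_derivative_scaleR_right[OF zz(2)]
            bounded_linear.has_derivative[OF bl(3) zz(1)]]])
    have 5: "((\<lambda>P. A (zc P)) has_derivative (\<lambda>v. A (zc v))) (at P)"
      by (rule bounded_linear.has_derivative[OF bl(1) zz(1)])
    have 6: "((\<lambda>P. a * P $ Cx) has_derivative (\<lambda>v. a * v $ Cx)) (at P)"
      by (rule has_derivative_mult_right[OF c])
    show ?thesis
      unfolding \<phi>_def[abs_def] d\<phi>_def[abs_def]
      by (intro has_derivative_mk has_derivative_add_const 1 2 3 4 5 6)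
  qed
  have metric: "metric_form (M_metric f') (\<phi> P) (dd v \<phi> P) (dd w \<phi> P) = metric_form (M_metric f) P v w" for P v w
  proof -
    have i1: "A u \<bullet> Bt u' = u \<bullet> u'" "Bt u' \<bullet> A u = u \<bullet> u'" for u u'
      by (simp_all add: inn AtBt inner_commute[of "Bt u'"])
    have i2: "u \<bullet> Qt u' = Q u \<bullet> u'" for u u' by (simp add: inn)
    have "- 2 * pot f' (\<phi> P) * (a * v $ Cx) * (a * w $ Cx) = - 2 * pot f' (\<phi> P) * (a * a) * v $ Cx * w $ Cx"
      by (simp add: algebra_simps)
    also have "\<dots> = - 2 * (pot f P + lf P) * v $ Cx * w $ Cx"
      using s by (simp add: pot' a(2))
    finally have 1: "- 2 * pot f' (\<phi> P) * (a * v $ Cx) * (a * w $ Cx) = - 2 * (pot f P + lf P) * v $ Cx * w $ Cx" .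
    \<comment> \<open>The correction by \<open>Qt\<close> in \<open>zs0\<close> is dual to the term
      with \<open>Q\<close> in the z tilde part: the two contributions of \<open>Q\<close>
      cancel.\<close>
    have 2: "A (zc v) \<bullet> Bt (h + (1 / s) *\<^sub>R Qt k) + Bt (s *\<^sub>R ztc v - Q (zc v)) \<bullet> ((1 / s) *\<^sub>R A k) = zc v \<bullet> h + ztc v \<bullet> k" for v h k
      using s by (simp add: i1 i2 inner_add_right inner_diff_right inner_commute[of k] field_simps)
    define hv hw kv kw where "hv = zsc v - (P $ Cx * v $ Cx) *\<^sub>R ez" and "hw = zsc w - (P $ Cx * w $ Cx) *\<^sub>R ez"
      and "kv = ztsc v - (P $ Cx * v $ Cx) *\<^sub>R et" and "kw = ztsc w - (P $ Cx * w $ Cx) *\<^sub>R et"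
    define xv xw where "xv = v $ Cxs + (P $ Cx * (ez \<bullet> zc v + et \<bullet> ztc v) + v $ Cx * lf P)"
      and "xw = w $ Cxs + (P $ Cx * (ez \<bullet> zc w + et \<bullet> ztc w) + w $ Cx * lf P)"
    note d = hv_def[symmetric] hw_def[symmetric] kv_def[symmetric] kw_def[symmetric] xv_def[symmetric] xw_def[symmetric]
    have 3: "a * v $ Cx * (xw / a) = v $ Cx * xw" "xv / a * (a * w $ Cx) = xv * w $ Cx"
      using a(1) by simp_all
    have "metric_form (M_metric f') (\<phi> P) (dd v \<phi> P) (dd w \<phi> P) =
        - 2 * (pot f P + lf P) * v $ Cx * w $ Cx + v $ Cx * xw + xv * w $ Cx
        + (zc v \<bullet> hw + ztc v \<bullet> kw) + (zc w \<bullet> hv + ztc w \<bullet> kv)"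
      unfolding dd_eqI[OF der] metric_form_M d\<phi>_def mk_simps d 1 3 2[symmetric]
        inner_commute[of _ "A (zc w)"] inner_commute[of _ "Bt (s *\<^sub>R ztc w - Q (zc w))"]
      by simp
    also have "\<dots> = metric_form (M_metric f) P v w"
      unfolding metric_form_M hv_def hw_def kv_def kw_def xv_def xw_def
      by (simp add: inner_diff_right algebra_simps inner_commute)
    finally show ?thesis .
  qed
  \<comment> \<open>The inverse is solved block by block: x and z, then z tilde, then the starred
    blocks, which use the earlier ones.\<close>
  define X where "X P = (P $ Cx - (P2 $ Cx - a * P1 $ Cx)) / a" for P :: "real^('p zindex coord)"
  define Z where "Z P = B (zc P - b)" for P :: "real^('p zindex coord)"
  define Zt where "Zt P = (1 / s) *\<^sub>R (At (ztc P - \<tau>) + Q (Z P))" for P :: "real^('p zindex coord)"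
  define Ht where "Ht P = s *\<^sub>R B (ztsc P - (ztsc P2 - zts0 P1))" for P :: "real^('p zindex coord)"
  define Hz where "Hz P = At (zsc P - (zsc P2 - zs0 P1)) - (1 / s) *\<^sub>R Qt (Ht P)" for P :: "real^('p zindex coord)"
  define \<phi>' where "\<phi>' P = mk (X P) (Z P) (Zt P)
    (a * (P $ Cxs - (P2 $ Cxs - xs0 P1)) - X P * (ez \<bullet> Z P + et \<bullet> Zt P + e0))
    (Hz P + ((X P)\<^sup>2 / 2) *\<^sub>R ez) (Ht P + ((X P)\<^sup>2 / 2) *\<^sub>R et)" for P
  have left: "\<phi>' (\<phi> P) = P" for P
  proof -
    have x: "X (\<phi> P) = P $ Cx" using a by (simp add: X_def \<phi>_def)
    have z: "Z (\<phi> P) = zc P" by (simp add: Z_def \<phi>_def AB)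
    have t: "Zt (\<phi> P) = ztc P" using s by (simp add: Zt_def z) (simp add: \<phi>_def AtBt)
    have h: "Ht (\<phi> P) = ht P"
      using s by (simp add: Ht_def) (simp add: \<phi>_def zts0_def linear_scale[OF B] AB)
    have k: "Hz (\<phi> P) = hz P" by (simp add: Hz_def h) (simp add: \<phi>_def zs0_def AtBt)
    show ?thesis
      using a by (simp add: \<phi>'_def x z t h k coords_eq_iff hz_def ht_def) (simp add: \<phi>_def xs0_def lf_def)
  qed
  have right: "\<phi> (\<phi>' P) = P" for P
  proof -
    have l: "lf (\<phi>' P) = ez \<bullet> Z P + et \<bullet> Zt P + e0" by (simp add: lf_def \<phi>'_def)
    have h: "ht (\<phi>' P) = Ht P" "hz (\<phi>' P) = Hz P" by (simp_all add: ht_def hz_def \<phi>'_def)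
    have "A (Z P) + b = zc P" by (simp add: Z_def AB)
    moreover have "Bt (s *\<^sub>R Zt P - Q (Z P)) + \<tau> = ztc P" using s by (simp add: Zt_def AtBt)
    moreover have "a * X P + (P2 $ Cx - a * P1 $ Cx) = P $ Cx" using a by (simp add: X_def)
    moreover have "xs0 (\<phi>' P) + (P2 $ Cxs - xs0 P1) = P $ Cxs" using a by (simp add: xs0_def[of "\<phi>' P"] l) (simp add: \<phi>'_def)
    moreover have "zs0 (\<phi>' P) + (zsc P2 - zs0 P1) = zsc P" by (simp add: zs0_def[of "\<phi>' P"] h) (simp add: Hz_def AtBt)
    moreover have "zts0 (\<phi>' P) + (ztsc P2 - zts0 P1) = ztsc P"
      using s by (simp add: zts0_def[of "\<phi>' P"] h) (simp add: Ht_def linear_scale[OF A] AB)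
    ultimately show ?thesis
      by (simp add: \<phi>_def[of "\<phi>' P"] coords_eq_iff) (simp add: \<phi>'_def)
  qed
  note O = open_UNIV
  note sm = smooth_on_add[OF O] smooth_on_diff[OF O] smooth_on_scaleR[OF O] smooth_on_mult[OF O] smooth_on_inner[OF O]
    smooth_on_const smooth_on_coords_id smooth_on_bounded_linear[OF bounded_linear_vec_nth] smooth_on_power[OF O]
    smooth_on_linear_compose[OF O bl(1)] smooth_on_linear_compose[OF O bl(2)] smooth_on_linear_compose[OF O bl(3)]
    smooth_on_linear_compose[OF O bl(4)] smooth_on_linear_compose[OF O bl(5)] smooth_on_linear_compose[OF O bl(6)]
  have "smooth_on UNIV lf" "smooth_on UNIV hz" "smooth_on UNIV ht"
    unfolding lf_def[abs_def] hz_def[abs_def] ht_def[abs_def] divide_inverse by (rule sm)+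
  note sm1 = sm this
  have "smooth_on UNIV xs0" "smooth_on UNIV zs0" "smooth_on UNIV zts0"
    unfolding xs0_def[abs_def] zs0_def[abs_def] zts0_def[abs_def] divide_inverse by (rule sm1)+
  note sm2 = sm this
  have s\<phi>: "smooth_on UNIV \<phi>"
    unfolding \<phi>_def[abs_def] by (rule smooth_on_mk[OF O] sm2)+
  have "smooth_on UNIV X" "smooth_on UNIV Z" "smooth_on UNIV Ht"
    unfolding X_def[abs_def] Z_def[abs_def] Ht_def[abs_def] divide_inverse by (rule sm)+
  note sm3 = sm this
  have "smooth_on UNIV Zt" "smooth_on UNIV Hz"
    unfolding Zt_def[abs_def] Hz_def[abs_def] by (rule sm3)+
  note sm4 = sm3 this
  have s\<phi>': "smooth_on UNIV \<phi>'"
    unfolding \<phi>'_def[abs_def] divide_inverse by (rule smooth_on_mk[OF O] sm4)+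
  have "diffeomorphism UNIV UNIV \<phi> \<phi>'"
    unfolding diffeomorphism_def using s\<phi> s\<phi>' left right by (auto intro!: surjI)
  then have "isometry (M_metric f) (M_metric f') \<phi>"
    unfolding isometry_def using metric by blast
  then show ?thesis using \<phi>P1 by blast
qed

section \<open>Normalizing the functions by affine substitutions\<close>

text \<open>The coordinates z_i with i at least 1 only reach coefficients of degree 2 and higher;
  the constant and linear ones are left over.\<close>

lemma sum_coeff_powers:
  fixes R :: "real poly"
  assumes "degree R \<le> N + 1"
  shows "(\<Sum>i = 1..N. coeff R (i + 1) * w ^ (i + 1)) = poly R w - coeff R 0 - coeff R 1 * w"
proof -
  have "poly R w = poly (\<Sum>i\<le>N + 1. monom (coeff R i) i) w"
    using poly_as_sum_of_monoms'[OF assms] by simp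
  also have "\<dots> = (\<Sum>i\<le>N + 1. coeff R i * w ^ i)"
    by (simp only: poly_sum poly_monom)
  also have "\<dots> = coeff R 0 + (\<Sum>i\<le>N. coeff R (Suc i) * w ^ Suc i)"
    using sum.atMost_Suc_shift[of "\<lambda>i. coeff R i * w ^ i" N] by simp
  also have "(\<Sum>i\<le>N. coeff R (Suc i) * w ^ Suc i) = coeff R 1 * w + (\<Sum>i = 1..N. coeff R (i + 1) * w ^ (i + 1))"
  proof -
    have "{..N} = insert 0 {1..N}" by auto
    then show ?thesis by simp
  qed
  finally show ?thesis by simp
qed

lemma Rep_zi [simp]: "i \<le> CARD('p) \<Longrightarrow> Rep_zindex (zi i :: 'p::finite zindex) = i"
  by (simp add: Abs_zindex_inverse)

text \<open>Separates the variable z_0 from the coordinates that serve as coefficients, so that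
  substituting for z_0 becomes \<open>pcompose\<close>.\<close>

definition zpoly :: "real^('p::finite zindex) \<Rightarrow> real poly" where
  "zpoly z = (\<Sum>i = 1..CARD('p). monom (z $ zi i) (i + 1))"

lemma f_psi_eq: "f_psi \<psi> z = poly (zpoly z) (z $ zi 0) + \<psi> (z $ zi 0)"
  by (simp only: f_psi_def zpoly_def poly_sum poly_monom)

lemma degree_zpoly: "degree (zpoly (z :: real^('p::finite zindex))) \<le> CARD('p) + 1"
  unfolding zpoly_def
  by (rule degree_sum_le) (auto intro!: order_trans[OF degree_monom_le])

lemma coeff_zpoly:
  fixes z :: "real^('p::finite zindex)"
  assumes "1 \<le> i" "i \<le> CARD('p)"
  shows "coeff (zpoly z) (i + 1) = z $ zi i"
  using assms by (simp add: zpoly_def coeff_sum)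

lemma zpoly_linear: "zpoly (u + v) = zpoly u + zpoly v" "zpoly (c *\<^sub>R u) = smult c (zpoly u)"
proof -
  show "zpoly (u + v) = zpoly u + zpoly v"
    by (simp add: zpoly_def add_monom[symmetric] sum.distrib)
  show "zpoly (c *\<^sub>R u) = smult c (zpoly u)"
    by (rule poly_eqI) (simp add: zpoly_def coeff_sum sum_distrib_left if_distrib cong: if_cong)
qed

text \<open>
  In the new variable \<open>w = l * z\<^sub>0 + m\<close> the polynomial \<open>\<Sum> z\<^sub>i z\<^sub>0^(i+1)\<close> has
  coefficients that are linear in \<open>z\<close>; these are the new coordinates. Adding multiples
  \<open>C\<^sub>i * (w - t)\<close> to them, with \<open>t\<close> the value of \<open>w\<close> at the base point, absorbs the terms of
  degree at least three of \<open>q\<close>.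
\<close>

lemma f_psi_equivalence:
  fixes z1 z2 :: "real^('p::finite zindex)"
  assumes \<psi>: "\<And>t. \<psi>2 (l * t + m) = s * \<psi>1 t + poly q t" and q: "degree q \<le> CARD('p) + 2"
    and l: "l \<noteq> 0" and s: "s \<noteq> 0" and base: "l * z1 $ zi 0 + m = z2 $ zi 0"
  shows "\<exists>A b Q \<beta> \<gamma>. linear A \<and> inj A \<and> linear Q \<and> A z1 + b = z2 \<and>
    (\<forall>z :: real^'p zindex. f_psi \<psi>2 (A z + b) = s * f_psi \<psi>1 z + z \<bullet> Q z + \<beta> \<bullet> z + \<gamma>)"
proof -
  let ?N = "CARD('p)" and ?o = "zi 0 :: 'p zindex"
  define t where "t = z2 $ ?o"
  \<comment> \<open>The inner polynomial is the inverse of the substitution w = l z_0 + m, so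
    \<open>T z\<close> is \<open>s\<close> times \<open>zpoly z\<close> written in w.\<close>
  define T where "T z = smult s (pcompose (zpoly z) [:- m / l, 1 / l:])" for z :: "real^'p zindex"
  have pT: "poly (T z) (l * u + m) = s * poly (zpoly z) u" for z u
    using l by (simp add: T_def poly_pcompose field_simps)
  have degT: "degree (T z) \<le> ?N + 1" for z
    using degree_zpoly[of z] l by (simp add: T_def degree_smult_eq degree_pcompose s)
  have Tlin: "T (u + v) = T u + T v" "T (c *\<^sub>R u) = smult c (T u)" for u v c
    by (simp_all add: T_def zpoly_linear pcompose_add pcompose_smult smult_add_right mult.commute)
  \<comment> \<open>Constants adjusting the coordinates at the base point, where w = t and the terms
    with \<open>C\<close> vanish.\<close>
  define B where "B i = z2 $ zi i - coeff (T z1) (i + 1)" for i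
  define r where "r = pcompose q [:- m / l, 1 / l:] + (\<Sum>i = 1..?N. monom (B i) (i + 1))"
  have degr: "degree r \<le> ?N + 2"
    unfolding r_def
  proof (rule degree_add_le)
    show "degree (pcompose q [:- m / l, 1 / l:]) \<le> ?N + 2" using q l by (simp add: degree_pcompose)
    show "degree (\<Sum>i = 1..?N. monom (B i) (i + 1)) \<le> ?N + 2"
      by (rule degree_sum_le) (auto intro!: order_trans[OF degree_monom_le])
  qed
  have pr: "poly r (l * u + m) = poly q u + (\<Sum>i = 1..?N. B i * (l * u + m) ^ (i + 1))" for u
    using l by (simp add: r_def poly_pcompose poly_sum poly_monom field_simps del: power_Suc)
  \<comment> \<open>Up to the constant \<open>poly r t\<close>, \<open>r\<close> is (w - t) times
    \<open>k\<close>. The terms with \<open>C\<close> cancel this product except for the constant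
    and linear parts of \<open>k\<close>, leaving a quadratic polynomial in w.\<close>
  define k where "k = synthetic_div r t"
  have degk: "degree k \<le> ?N + 1" using degr by (simp add: k_def degree_synthetic_div)
  have rk: "poly r w = (w - t) * poly k w + poly r t" for w
    using arg_cong[OF synthetic_div_correct'[of t r], of "\<lambda>p. poly p w"] by (simp add: k_def algebra_simps)
  define C where "C i = - coeff k (i + 1)" for i
  \<comment> \<open>The new coordinate is \<open>coeff (T z) (i + 1) + C i * (w - t) + B i\<close>,
    split into the linear part \<open>A\<close> and the constant \<open>b\<close>.\<close>
  define A where "A z = (\<chi> c. if c = ?o then l * z $ ?o
      else coeff (T z) (Rep_zindex c + 1) + C (Rep_zindex c) * l * z $ ?o)" for z :: "real^'p zindex"
  define b where "b = (\<chi> c. if c = ?o then m else C (Rep_zindex c) * (m - t) + B (Rep_zindex c))"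
  have A0: "A z $ ?o = l * z $ ?o" for z by (simp add: A_def)
  have zi_ne: "(zi i :: 'p zindex) \<noteq> ?o" if "i \<in> {1..?N}" for i
    using that Rep_zi[of i, where 'p = 'p] Rep_zi[of 0, where 'p = 'p] by fastforce
  have Ai: "A z $ zi i = coeff (T z) (i + 1) + C i * l * z $ ?o" "b $ zi i = C i * (m - t) + B i" if "i \<in> {1..?N}" for z i
    using that zi_ne[OF that] by (simp_all add: A_def b_def)
  have b0: "b $ ?o = m" by (simp add: b_def)
  have zcases: "c = ?o \<or> (\<exists>i\<in>{1..?N}. c = zi i)" for c :: "'p zindex"
  proof -
    obtain i where "i \<le> ?N" "c = zi i" using UNIV_zindex[where 'p = 'p] by blast
    then show ?thesis by (cases "i = 0") auto
  qed
  have linA: "linear A"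
    by (rule linearI) (auto simp: vec_eq_iff A_def Tlin algebra_simps)
  \<comment> \<open>If \<open>A z = 0\<close>, then z_0 = 0 and \<open>T z\<close> has degree at
    most 1; so has \<open>zpoly z\<close>, whose coefficients begin in degree 2.\<close>
  have injA: "inj A"
  proof (subst linear_injective_0[OF linA], intro allI impI)
    fix z assume z: "A z = 0"
    have z0: "z $ ?o = 0" using A0[of z] z l by simp
    have T0: "coeff (T z) (Suc (Suc j)) = 0" for j
    proof (cases "Suc j \<in> {1..?N}")
      case True
      then show ?thesis using Ai(1)[OF True, of z] z z0 by simp
    next
      case False
      then show ?thesis using degT[of z] by (intro coeff_eq_0) auto
    qed
    have "degree (T z) \<le> 1"
    proof (rule degree_le, intro allI impI)
      fix i :: nat assume "1 < i"
      then show "coeff (T z) i = 0" using T0[of "i - 2"] by (simp add: numeral_2_eq_2 Suc_diff_Suc)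
    qed
    then have "degree (zpoly z) \<le> 1"
      using l s by (simp add: T_def degree_smult_eq degree_pcompose)
    then have "z $ zi i = 0" if "i \<in> {1..?N}" for i
      using coeff_zpoly[of i z] that by (simp add: coeff_eq_0)
    then have "z $ c = 0" for c using zcases[of c] z0 by auto
    then show "z = 0" by (simp add: vec_eq_iff)
  qed
  have base': "A z1 + b = z2"
  proof -
    have "(A z1 + b) $ c = z2 $ c" for c
    proof -
      consider "c = ?o" | i where "i \<in> {1..?N}" "c = zi i" using zcases by blast
      then show ?thesis
      proof cases
        case 1
        then show ?thesis using base by (simp add: A0 b0)
      next
        case 2
        have "A z1 $ zi i + b $ zi i = z2 $ zi i + C i * (l * z1 $ ?o + m - t)"
          unfolding Ai[OF 2(1)] by (simp add: B_def algebra_simps)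
        then show ?thesis using 2 base by (simp add: t_def)
      qed
    qed
    then show ?thesis by (simp add: vec_eq_iff)
  qed
  \<comment> \<open>The leftover polynomial in w, expanded in z_0, is z_0 times the linear form
    \<open>G\<close>, plus the linear form \<open>H\<close>, plus a constant. The vector
    \<open>adjoint H 1\<close> represents \<open>H\<close>.\<close>
  define G where "G z = l * l * coeff k 1 * z $ ?o - l * coeff (T z) 1" for z :: "real^'p zindex"
  define H where "H z = l * (coeff k 0 + coeff k 1 * m + coeff k 1 * (m - t)) * z $ ?o - coeff (T z) 0 - m * coeff (T z) 1" for z :: "real^'p zindex"
  have linG: "linear G" and linH: "linear H"
    by (rule linearI; simp add: G_def H_def Tlin algebra_simps)+
  define Q where "Q z = G z *\<^sub>R axis ?o (1 :: real)" for z :: "real^'p zindex"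
  have linQ: "linear Q"
    by (rule linearI) (simp_all add: Q_def linear_add[OF linG] linear_scale[OF linG] scaleR_add_left)
  have main: "f_psi \<psi>2 (A z + b) = s * f_psi \<psi>1 z + z \<bullet> Q z + adjoint H 1 \<bullet> z + ((m - t) * (coeff k 0 + coeff k 1 * m) + poly r t)" for z
  proof -
    let ?w = "l * z $ ?o + m"
    have "f_psi \<psi>2 (A z + b) = (\<Sum>i = 1..?N. (A z + b) $ zi i * ?w ^ (i + 1)) + \<psi>2 ?w"
      by (simp add: f_psi_def A0 b0)
    also have "(\<Sum>i = 1..?N. (A z + b) $ zi i * ?w ^ (i + 1)) =
        (\<Sum>i = 1..?N. coeff (T z) (i + 1) * ?w ^ (i + 1) + C i * ?w ^ (i + 1) * (?w - t) + B i * ?w ^ (i + 1))"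
    proof (rule sum.cong[OF refl])
      fix i assume i: "i \<in> {1..?N}"
      show "(A z + b) $ zi i * ?w ^ (i + 1) =
          coeff (T z) (i + 1) * ?w ^ (i + 1) + C i * ?w ^ (i + 1) * (?w - t) + B i * ?w ^ (i + 1)"
        unfolding vector_add_component Ai[OF i] by (simp only: algebra_simps)
    qed
    also have "\<dots> = (\<Sum>i = 1..?N. coeff (T z) (i + 1) * ?w ^ (i + 1))
        - (\<Sum>i = 1..?N. coeff k (i + 1) * ?w ^ (i + 1)) * (?w - t) + (\<Sum>i = 1..?N. B i * ?w ^ (i + 1))"
      by (simp only: sum.distrib C_def sum_distrib_right mult_minus_left sum_negf diff_conv_add_uminus)
    also have "(\<Sum>i = 1..?N. B i * ?w ^ (i + 1)) = poly r ?w - poly q (z $ ?o)"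
      by (simp only: pr)
    also have "(\<Sum>i = 1..?N. coeff (T z) (i + 1) * ?w ^ (i + 1)) = s * poly (zpoly z) (z $ ?o) - coeff (T z) 0 - coeff (T z) 1 * ?w"
      by (simp only: sum_coeff_powers[OF degT] pT)
    also have "(\<Sum>i = 1..?N. coeff k (i + 1) * ?w ^ (i + 1)) = poly k ?w - coeff k 0 - coeff k 1 * ?w"
      by (rule sum_coeff_powers[OF degk])
    also have "poly r ?w = (?w - t) * poly k ?w + poly r t" by (rule rk)
    also have "s * poly (zpoly z) (z $ ?o) - coeff (T z) 0 - coeff (T z) 1 * ?w
        - (poly k ?w - coeff k 0 - coeff k 1 * ?w) * (?w - t)
        + ((?w - t) * poly k ?w + poly r t - poly q (z $ ?o)) + \<psi>2 ?w
      = s * f_psi \<psi>1 z - coeff (T z) 0 - coeff (T z) 1 * ?w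
        + (?w - t) * (coeff k 0 + coeff k 1 * ?w) + poly r t"
      unfolding \<psi> f_psi_eq[where \<psi> = \<psi>1 and z = z] by (simp add: algebra_simps)
    also have "\<dots> = s * f_psi \<psi>1 z + z $ ?o * G z + H z + ((m - t) * (coeff k 0 + coeff k 1 * m) + poly r t)"
      by (simp add: G_def H_def algebra_simps)
    also have "z $ ?o * G z = z \<bullet> Q z" by (simp add: Q_def inner_axis)
    also have "H z = adjoint H 1 \<bullet> z" using adjoint_works[OF linH, of z 1] by (simp add: inner_commute)
    finally show ?thesis .
  qed
  show ?thesis using linA injA linQ base' main by blast
qed

text \<open>Solves the equality of invariants of order \<open>k\<close> for the higher derivative;
  the base of the power is the scale fixed by the derivatives of orders p + 3 and p + 4.\<close>

lemma ratio_power: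
  fixes b1 c1 b2 c2 X Y :: real
  assumes pos: "b1 > 0" "c1 > 0" "b2 > 0" "c2 > 0"
    and eq: "X * b1 ^ (k - 1) / c1 ^ k = Y * b2 ^ (k - 1) / c2 ^ k" and k: "k \<ge> 1"
  shows "((c1 * b2) / (b1 * c2)) ^ k * Y = b2 / b1 * X"
proof -
  obtain j where j: "k = Suc j" using k by (cases k) auto
  have "((c1 * b2) / (b1 * c2)) ^ k * Y = (c1 ^ k * b2 / b1 ^ k) * (Y * b2 ^ (k - 1) / c2 ^ k)"
    by (simp add: j power_mult_distrib power_divide mult_ac)
  also have "\<dots> = b2 / b1 * X"
    unfolding eq[symmetric] using pos by (simp add: j)
  finally show ?thesis .
qed

theorem theorem1p9:
  fixes \<psi>1 \<psi>2 :: "real \<Rightarrow> real"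
    and P1 P2 :: "real^('p::finite zindex coord)"
  assumes "real_analytic_on UNIV \<psi>1" and "real_analytic_on UNIV \<psi>2"
    and "\<And>t. (deriv ^^ (CARD('p) + 3)) \<psi>1 t > 0" and "\<And>t. (deriv ^^ (CARD('p) + 4)) \<psi>1 t > 0"
    and "\<And>t. (deriv ^^ (CARD('p) + 3)) \<psi>2 t > 0" and "\<And>t. (deriv ^^ (CARD('p) + 4)) \<psi>2 t > 0"
  shows "((\<exists>U V \<phi>. P1 \<in> U \<and> P2 \<in> V \<and>
             affine_diffeomorphism U (N_metric \<psi>1) V (N_metric \<psi>2) \<phi> \<and> \<phi> P1 = P2)
           \<longleftrightarrow> (\<forall>k\<ge>2. alpha k \<psi>1 P1 = alpha k \<psi>2 P2)) \<and>
         ((\<forall>k\<ge>2. alpha k \<psi>1 P1 = alpha k \<psi>2 P2)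
           \<longleftrightarrow> (\<exists>\<phi>. isometry (N_metric \<psi>1) (N_metric \<psi>2) \<phi> \<and> \<phi> P1 = P2))"
proof -
  let ?N = "CARD('p) + 3"
  define t1 t2 where "t1 = P1 $ Cz (zi 0)" and "t2 = P2 $ Cz (zi 0)"
  have id: "infinitely_differentiable \<psi>1" "infinitely_differentiable \<psi>2"
    using assms(1,2) real_analytic_imp_infinitely_differentiable by blast+
  have f: "smooth_on UNIV (f_psi \<psi>1 :: real^'p zindex \<Rightarrow> real)" "smooth_on UNIV (f_psi \<psi>2 :: real^'p zindex \<Rightarrow> real)"
    using id smooth_on_f_psi by blast+
  have alpha_eq: "alpha k \<psi> P = (deriv ^^ (k + ?N)) \<psi> (P $ Cz (zi 0)) * (deriv ^^ ?N) \<psi> (P $ Cz (zi 0)) ^ (k - 1)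
      / (deriv ^^ (?N + 1)) \<psi> (P $ Cz (zi 0)) ^ k" for k \<psi> and P :: "real^'p zindex coord"
  proof -
    have "k + CARD('p) + 3 = k + ?N" "CARD('p) + 4 = ?N + 1" by simp_all
    then show ?thesis by (simp only: alpha_def)
  qed
  have affine_imp_alpha: "\<forall>k\<ge>2. alpha k \<psi>1 P1 = alpha k \<psi>2 P2"
    if P1: "P1 \<in> U" and aff: "affine_diffeomorphism U (N_metric \<psi>1) V (N_metric \<psi>2) \<phi>"
      and P2: "\<phi> P1 = P2" for U V \<phi>
  proof -
    obtain \<phi>' where diffeo: "diffeomorphism U V \<phi> \<phi>'"
      and conn: "\<And>X Y P. smooth_on U X \<Longrightarrow> smooth_on U Y \<Longrightarrow> P \<in> U \<Longrightarrow>
        pullback_connection \<phi> \<phi>' (levi_civita V (N_metric \<psi>2)) X Y P = levi_civita U (N_metric \<psi>1) X Y P"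
      using aff unfolding affine_diffeomorphism_def by blast
    have "affine_pair (f_psi \<psi>1) (f_psi \<psi>2) U V \<phi> \<phi>'"
      by (rule affine_pair.intro[OF f diffeo]) (rule conn[unfolded N_metric_def])
    from affine_imp_derivative_relation[OF this id P1, unfolded P2, folded t1_def t2_def]
    obtain a b l where b: "b \<noteq> 0"
      and rel: "\<And>n. n \<ge> ?N \<Longrightarrow> a * l ^ n * (deriv ^^ n) \<psi>2 t2 = b * (deriv ^^ n) \<psi>1 t1"
      by blast
    have "alpha k \<psi>1 P1 = alpha k \<psi>2 P2" if "k \<ge> 2" for k
      using alpha_ratio[of ?N a l "\<lambda>n. (deriv ^^ n) \<psi>2 t2" b "\<lambda>n. (deriv ^^ n) \<psi>1 t1" k, OF rel b]
        assms(3)[of t1] that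
      unfolding alpha_eq t1_def[symmetric] t2_def[symmetric] by simp
    then show ?thesis by blast
  qed
  have alpha_imp_isometry: "\<exists>\<phi>. isometry (N_metric \<psi>1) (N_metric \<psi>2) \<phi> \<and> \<phi> P1 = P2"
    if al: "\<forall>k\<ge>2. alpha k \<psi>1 P1 = alpha k \<psi>2 P2"
  proof -
    define D1 D2 where "D1 n = (deriv ^^ n) \<psi>1 t1" and "D2 n = (deriv ^^ n) \<psi>2 t2" for n
    have "CARD('p) + 4 = ?N + 1" by simp
    then have pos: "D1 ?N > 0" "D1 (?N + 1) > 0" "D2 ?N > 0" "D2 (?N + 1) > 0"
      using assms(3,4)[of t1] assms(5,6)[of t2] by (simp_all only: D1_def D2_def)
    have eq: "D1 (k + ?N) * D1 ?N ^ (k - 1) / D1 (?N + 1) ^ k = D2 (k + ?N) * D2 ?N ^ (k - 1) / D2 (?N + 1) ^ k"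
      if "k \<ge> 2" for k
      using al[rule_format, OF that] by (simp only: alpha_eq D1_def D2_def t1_def t2_def)
    \<comment> \<open>The relation \<open>l ^ n * D2 n = s * D1 n\<close> for \<open>n = ?N\<close>
      fixes \<open>s\<close>, and its quotient with the case \<open>?N + 1\<close> fixes
      \<open>l\<close>. Positivity of the derivatives makes both positive.\<close>
    define l where "l = (D1 (?N + 1) * D2 ?N) / (D1 ?N * D2 (?N + 1))"
    define s where "s = D2 ?N * l ^ ?N / D1 ?N"
    have l: "l > 0" using pos by (simp add: l_def)
    have s: "s > 0" using pos l by (simp add: s_def)
    have rel: "l ^ n * D2 n = s * D1 n" if n: "n \<ge> ?N" for n
    proof -
      define k where "k = n - ?N"
      have k: "n = k + ?N" using n by (simp add: k_def)
      have lk: "l ^ k * D2 (k + ?N) = D2 ?N / D1 ?N * D1 (k + ?N)"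
      proof -
        \<comment> \<open>The cases 0 and 1 hold by the choice of \<open>s\<close> and
          \<open>l\<close>; the invariants supply the rest.\<close>
        consider "k = 0" | "k = 1" | "k \<ge> 2" by linarith
        then show ?thesis
        proof cases
          case 3
          then show ?thesis unfolding l_def by (intro ratio_power[OF pos eq]) simp_all
        qed (use pos in \<open>simp_all add: l_def field_simps\<close>)
      qed
      have "l ^ n * D2 n = l ^ ?N * (l ^ k * D2 (k + ?N))" by (simp add: k power_add)
      also have "\<dots> = s * D1 n" unfolding lk by (simp add: s_def k)
      finally show ?thesis .
    qed
    \<comment> \<open>Makes the affine substitution send \<open>t1\<close> to
      \<open>t2\<close>.\<close>
    define m where "m = t2 - l * t1"
    have "\<exists>q. degree q \<le> CARD('p) + 2 \<and> (\<forall>t. \<psi>2 (l * t + m) = s * \<psi>1 t + poly q t)"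
    proof (rule analytic_eq_up_to_poly[where ?t0.0 = t1, OF assms(1,2)])
      show "l ^ n * (deriv ^^ n) \<psi>2 (l * t1 + m) = s * (deriv ^^ n) \<psi>1 t1" if "n > CARD('p) + 2" for n
        using rel[of n] that by (simp add: m_def D1_def D2_def)
    qed
    then obtain q where q: "degree q \<le> CARD('p) + 2" "\<And>t. \<psi>2 (l * t + m) = s * \<psi>1 t + poly q t"
      by blast
    have "\<exists>A b Q \<beta> \<gamma>. linear A \<and> inj A \<and> linear Q \<and> A (zc P1) + b = zc P2 \<and>
      (\<forall>z. f_psi \<psi>2 (A z + b) = s * f_psi \<psi>1 z + z \<bullet> Q z + \<beta> \<bullet> z + \<gamma>)"
      by (rule f_psi_equivalence[OF q(2,1)]) (use l s in \<open>simp_all add: m_def t1_def t2_def\<close>)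
    then obtain A b Q \<beta> \<gamma> where A: "linear A" "inj A" and Q: "linear Q" and b: "A (zc P1) + b = zc P2"
      and eqf: "\<And>z. f_psi \<psi>2 (A z + b) = s * f_psi \<psi>1 z + z \<bullet> Q z + \<beta> \<bullet> z + \<gamma>" by blast
    obtain B where B: "linear B" "\<And>z. B (A z) = z" "\<And>z. A (B z) = z"
      using linear_injective_isomorphism[OF A] by blast
    show ?thesis
      unfolding N_metric_def by (rule isometry_M_metric[OF A(1) B(1) B(3,2) Q s eqf b])
  qed
  \<comment> \<open>A global isometry serves as the local map, both neighbourhoods being the whole
    space.\<close>
  have isometry_imp_affine: "\<exists>U V \<phi>. P1 \<in> U \<and> P2 \<in> V \<and>
      affine_diffeomorphism U (N_metric \<psi>1) V (N_metric \<psi>2) \<phi> \<and> \<phi> P1 = P2"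
    if "isometry (N_metric \<psi>1) (N_metric \<psi>2) \<phi>" "\<phi> P1 = P2" for \<phi>
    using isometry_imp_affine_diffeomorphism[OF f that(1)[unfolded N_metric_def], folded N_metric_def] that(2)
    by (intro exI[of _ UNIV] exI[of _ \<phi>]) simp
  show ?thesis
  proof (intro conjI iffI)
    assume "\<exists>U V \<phi>. P1 \<in> U \<and> P2 \<in> V \<and>
      affine_diffeomorphism U (N_metric \<psi>1) V (N_metric \<psi>2) \<phi> \<and> \<phi> P1 = P2"
    then obtain U V \<phi> where "P1 \<in> U" "affine_diffeomorphism U (N_metric \<psi>1) V (N_metric \<psi>2) \<phi>" "\<phi> P1 = P2"
      by blast
    then show "\<forall>k\<ge>2. alpha k \<psi>1 P1 = alpha k \<psi>2 P2" by (rule affine_imp_alpha)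
  next
    assume "\<forall>k\<ge>2. alpha k \<psi>1 P1 = alpha k \<psi>2 P2"
    then obtain \<phi> where "isometry (N_metric \<psi>1) (N_metric \<psi>2) \<phi>" "\<phi> P1 = P2"
      using alpha_imp_isometry by blast
    then show "\<exists>U V \<phi>. P1 \<in> U \<and> P2 \<in> V \<and>
      affine_diffeomorphism U (N_metric \<psi>1) V (N_metric \<psi>2) \<phi> \<and> \<phi> P1 = P2"
      by (rule isometry_imp_affine)
  next
    assume "\<forall>k\<ge>2. alpha k \<psi>1 P1 = alpha k \<psi>2 P2"
    then show "\<exists>\<phi>. isometry (N_metric \<psi>1) (N_metric \<psi>2) \<phi> \<and> \<phi> P1 = P2"
      by (rule alpha_imp_isometry)
  next
    assume "\<exists>\<phi>. isometry (N_metric \<psi>1) (N_metric \<psi>2) \<phi> \<and> \<phi> P1 = P2"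
    then obtain \<phi> where "isometry (N_metric \<psi>1) (N_metric \<psi>2) \<phi>" "\<phi> P1 = P2" by blast
    from isometry_imp_affine[OF this] obtain U V \<phi>' where
      "P1 \<in> U" "affine_diffeomorphism U (N_metric \<psi>1) V (N_metric \<psi>2) \<phi>'" "\<phi>' P1 = P2" by blast
    then show "\<forall>k\<ge>2. alpha k \<psi>1 P1 = alpha k \<psi>2 P2" by (rule affine_imp_alpha)
  qed
qed

end
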